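(* Let $\varphi$ be an $H$-flow on $M$ with $h_{\mathrm{Gur}}^\infty(\varphi)<h_{\mathrm{Gur}}(\varphi)$. Let $K_0\subset M$ be a compact set with nonempty interior for which there is $\epsilon_0>0$ with $$\limsup_{L\to\infty}\frac1L\log\#\mathcal P_{K_0}^{\epsilon_0}(L,L+5\tau_{K_0})<\lim_{L\to\infty}\frac1L\log\#\mathcal P_{K_0}(L,L+5\tau_{K_0}).$$ Let $m_\infty$ be any accumulation point, as $L\to+\infty$, of the family $(m_{K_0,L})_{L}$ for the vague topology. Let $K\subset M$ be a compact set whose interior $\mathring K$ contains $K_0$ and satisfies $m_\infty(\mathring K)>\frac34m_\infty(M)$. Let $(L_k)_k$ be an increasing sequence with $L_k\to+\infty$ such that $m_{K_0,L_k}\to m_\infty$ in the vague topology, and fix a point $y_0\in K_0$. Then there exists $\delta_{\mathrm{end}}>0$ such that for every $0<\delta<\delta_{\mathrm{end}}$ there exists $\epsilon_{\mathrm{end},\delta}>0$ such that for every $0<\epsilon<\epsilon_{\mathrm{end},\delta}$ there exists $\eta_{\mathrm{end},\delta,\epsilon}>0$ such that for every $0<\eta<\eta_{\mathrm{end},\delta,\epsilon}$ there exist constants $S^-,S^+,D^-,D^+>0$ and $T_{\mathrm{end}}>0$ such that, for every $x\in K$ and $T>T_{\mathrm{end}}$ with $\varphi_T(x)\in K$, $$\frac{D^-}{\mathcal N_{\mathcal C}(x,y_0,\eta,T+S^-,T+S^-+5\tau_{K_0},\delta)}\le m_\infty(B(x,\epsilon,T))\le\frac{D^+}{\mathcal N_{\mathcal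 C}(x,y_0,\epsilon,T-S^+,T-S^++5\tau_{K_0},\delta)}.$$
   Context: **Setting.** $(M,g)$ is a complete connected (not necessarily compact) Riemannian manifold with associated distance $d$; $B(x,r)$ is the open ball. **$H$-flow.** An $H$-flow is a $C^1$ flow $(\varphi_t)_{t\in\mathbb R}$ on a complete Riemannian manifold such that: (1) there is a constant $lip(\varphi)$ with $d(\varphi_\tau(x),\varphi_\tau(y))\le lip(\varphi)\,d(x,y)$ for all $x,y\in M$, $\tau\in[-1,1]$; (2) there exist $0<a\le b$ such that for every $x\in M$ there is $\rho>0$ with $a|t|\le d(x,\varphi_t(x))\le b|t|$ for all $t\in[-\rho,\rho]$; (3) (transitivity) for all nonempty open $U,V\subset M$ and every $T>0$ there is $t\ge T$ with $\varphi_t(U)\cap V\ne\emptyset$; (4) (finite exact shadowing) for every compact $K\subset M$, $\delta>0$ and integer $N\ge1$ there is $\eta>0$ such that, for all $x_1,\dots,x_N\in K$ and $t_1,\dots,t_N\ge 0$ with $d(\varphi_{t_i}(x_i),x_{i+1})<\eta$ for $1\le i\le N-1$, there is $y\in M$ with $d(\varphi_{s+\sum_{j=1}^{i-1}t_j}(y),\varphi_s(x_i))<\delta$ for all $1\le i\le N$ and $0\le s\le t_i$; (5) (closing lemma) for every $\epsilon>0$ and $x\in M$ there exist $\delta>0$ and $T_{\min}>0$ such that for every $y\in B(x,\epsilon)$ and $t\ge T_{\min}$ with $d(\varphi_t(y),y)\le\delta$ there exist $z\in B(y,\epsilon)$ and $\tau\in[t-\epsilon,t+\epsilon]$ with $\varphi_\tau(z)=z$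 and $d(\varphi_s(z),\varphi_s(y))\le\epsilon$ for all $0\le s\le t$; (6) (expansivity) for every $\nu>0$ there is $\epsilon>0$ such that, for all $x,y\in M$, if there is a continuous map $s:\mathbb R\to\mathbb R$ with $s(0)=0$ and $d(\varphi_t(x),\varphi_{s(t)}(y))\le\epsilon$ for all $t\in\mathbb R$, then $y=\varphi_\tau(x)$ for some $\tau\in[-\nu,\nu]$. **Periodic orbits and Gurevic entropies.** A periodic orbit $\gamma$ is a pair $(\{\varphi_t(x):t\in\mathbb R\},T)$ with $T>0$, $\varphi_T(x)=x$; its period is $\ell(\gamma)=T$ (so multiples of an orbit count as distinct periodic orbits). $\ell(\gamma\cap A)$ is the Lebesgue measure of $\{t\in[0,\ell(\gamma)]:\varphi_t(x)\in A\}$. For $K$ compact, $\mathcal P_K(T_0,T_1)$ is the set of periodic orbits $\gamma$ with $\ell(\gamma)\in[T_0,T_1]$ and $\gamma\cap K\neq\emptyset$; $\mathcal P_K^\alpha(L,L+\sigma)=\{\gamma\in\mathcal P_K(L,L+\sigma):\ell(\gamma\cap K)<\alpha\,\ell(\gamma)\}$. $\tau_K$ is the minimal period of a periodic orbit (possibly multiply covered) with period $\ge1$ intersecting $K$. $h_{\mathrm{Gur}}(\varphi)=\limsup_{L\to\infty}\frac1L\log\#\mathcal P_K(L,L+\sigma)$ for any compact $K$ with nonempty interior and any $\sigma>0$ (independent of $K,\sigma$; a true limit when $\sigma\ge5\tau_K$). $h_{\mathrm{Gur}}^{K,\alpha}(\varphi)=\limsup_{L\to\infty}\frac1L\log\#\mathcal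 P_K^\alpha(L,L+\sigma)$ (independent of $\sigma>0$), $h_{\mathrm{Gur}}^\infty(\varphi)=\inf_K\lim_{\alpha\to0}h_{\mathrm{Gur}}^{K,\alpha}(\varphi)$ over compact $K$ with nonempty interior. **Measures.** For a periodic orbit $\gamma$, $\mu_\gamma$ is the invariant probability measure equidistributed (with respect to time) on $\gamma$, and $m_{K_0,L}=\frac{1}{\#\mathcal P_{K_0}(L,L+5\tau_{K_0})}\sum_{\gamma\in\mathcal P_{K_0}(L,L+5\tau_{K_0})}\mu_\gamma$. Vague topology: convergence of integrals of continuous compactly supported functions. **Chords.** $B(z,\delta,T)=\{y:d(\varphi_t(z),\varphi_t(y))<\delta\ \forall t\in[0,T]\}$ is the dynamical ball. For $\eta>0$, $0<T^-<T^+$, $\mathcal C(x,y,\eta,T^-,T^+)=\{z\in B(x,\eta):\varphi_{[T^-,T^+]}(z)\cap B(y,\eta)\ne\emptyset\}$. A set $E$ is $(\delta,T)$-separating if for all distinct $p,q\in E$ there is $t\in[0,T]$ with $d(\varphi_t(p),\varphi_t(q))\ge\delta$. $\mathcal N_{\mathcal C}(x,y,\eta,T^-,T^+,\delta)$ is the maximal cardinality of a $(\delta,T^-)$-separating set $E\subset\mathcal C(x,y,\eta,T^-,T^+)$ such that $\mathcal C(x,y,\eta,T^-,T^+)\subset\bigcup_{z\in E}B(z,\delta,T^-)$. *)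

theory Defs
  imports "HOL-Analysis.Analysis"
begin

section \<open>Riemannian manifolds\<close>

text \<open>\<open>Ck_on k S f\<close>: the map \<open>f\<close> is of class \<open>C\<^sup>k\<close> on the open subset \<open>S\<close> of a Euclidean space.\<close>

primrec Ck_on ::
  "nat \<Rightarrow> 'e::euclidean_space set \<Rightarrow> ('e \<Rightarrow> 'f::real_normed_vector) \<Rightarrow> bool" where
  "Ck_on 0 S f \<longleftrightarrow> continuous_on S f"
| "Ck_on (Suc k) S f \<longleftrightarrow>
     (\<forall>x\<in>S. f differentiable at x) \<and>
     (\<forall>v. Ck_on k S (\<lambda>x. frechet_derivative f (at x) v))"

definition smooth_on :: "'e::euclidean_space set \<Rightarrow> ('e \<Rightarrow> 'f::real_normed_vector) \<Rightarrow> bool" where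
  "smooth_on S f \<longleftrightarrow> (\<forall>k. Ck_on k S f)"

text \<open>A chart is a pair of its domain and a coordinate map (whose values off the domain are irrelevant).\<close>

type_synonym ('a, 'e) chart = "'a set \<times> ('a \<Rightarrow> 'e)"

abbreviation chart_inv :: "('a, 'e) chart \<Rightarrow> 'e \<Rightarrow> 'a" where
  "chart_inv \<kappa> \<equiv> inv_into (fst \<kappa>) (snd \<kappa>)"

definition smooth_atlas :: "('a::topological_space, 'e::euclidean_space) chart set \<Rightarrow> bool" where
  "smooth_atlas \<A> \<longleftrightarrow>
     (\<Union>\<kappa>\<in>\<A>. fst \<kappa>) = UNIV \<and>
     (\<forall>\<kappa>\<in>\<A>. open (fst \<kappa>) \<and> open (snd \<kappa> ` fst \<kappa>) \<and>
        homeomorphism (fst \<kappa>) (snd \<kappa> ` fst \<kappa>) (snd \<kappa>) (chart_inv \<kappa>)) \<and>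
     (\<forall>\<kappa>\<in>\<A>. \<forall>\<kappa>'\<in>\<A>.
        smooth_on (snd \<kappa> ` (fst \<kappa> \<inter> fst \<kappa>')) (snd \<kappa>' \<circ> chart_inv \<kappa>))"

text \<open>A metric tensor is given by its coordinate expressions: \<open>g \<kappa> p v w\<close> is the inner product of
  the two tangent vectors at \<open>p\<close> whose coordinates in the chart \<open>\<kappa>\<close> are \<open>v\<close> and \<open>w\<close>. The last
  clause says that these expressions represent one and the same tensor in all charts.\<close>

definition riemannian_metric ::
  "('a::topological_space, 'e::euclidean_space) chart set \<Rightarrow>
   (('a, 'e) chart \<Rightarrow> 'a \<Rightarrow> 'e \<Rightarrow> 'e \<Rightarrow> real) \<Rightarrow> bool" where
  "riemannian_metric \<A> g \<longleftrightarrow>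
     (\<forall>\<kappa>\<in>\<A>. \<forall>p\<in>fst \<kappa>.
        bilinear (g \<kappa> p) \<and>
        (\<forall>v w. g \<kappa> p v w = g \<kappa> p w v) \<and>
        (\<forall>v. v \<noteq> 0 \<longrightarrow> 0 < g \<kappa> p v v)) \<and>
     (\<forall>\<kappa>\<in>\<A>. \<forall>v w. smooth_on (snd \<kappa> ` fst \<kappa>) (\<lambda>z. g \<kappa> (chart_inv \<kappa> z) v w)) \<and>
     (\<forall>\<kappa>\<in>\<A>. \<forall>\<kappa>'\<in>\<A>. \<forall>p\<in>fst \<kappa> \<inter> fst \<kappa>'. \<forall>v w.
        let D = frechet_derivative (snd \<kappa>' \<circ> chart_inv \<kappa>) (at (snd \<kappa> p))
        in g \<kappa> p v w = g \<kappa>' p (D v) (D w))"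

text \<open>One-sided derivatives are meant at the end points of \<open>[a, b]\<close>.\<close>

definition C1_curve_on ::
  "('a::topological_space, 'e::euclidean_space) chart set \<Rightarrow> real \<Rightarrow> real \<Rightarrow> (real \<Rightarrow> 'a) \<Rightarrow> bool" where
  "C1_curve_on \<A> a b c \<longleftrightarrow>
     (\<forall>\<kappa>\<in>\<A>. \<exists>D. continuous_on {t\<in>{a..b}. c t \<in> fst \<kappa>} D \<and>
        (\<forall>t\<in>{a..b}. c t \<in> fst \<kappa> \<longrightarrow>
           ((snd \<kappa> \<circ> c) has_vector_derivative D t) (at t within {a..b})))"

definition piecewise_C1_path ::
  "('a::topological_space, 'e::euclidean_space) chart set \<Rightarrow> (real \<Rightarrow> 'a) \<Rightarrow> bool" where
  "piecewise_C1_path \<A> c \<longleftrightarrow>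
     path c \<and>
     (\<exists>P. finite P \<and>
        (\<forall>a b. 0 \<le> a \<and> a < b \<and> b \<le> 1 \<and> {a<..<b} \<inter> P = {} \<longrightarrow> C1_curve_on \<A> a b c))"

text \<open>By chart independence of the metric tensor the choice of the chart does not matter.\<close>

definition speed ::
  "('a, 'e::euclidean_space) chart set \<Rightarrow> (('a, 'e) chart \<Rightarrow> 'a \<Rightarrow> 'e \<Rightarrow> 'e \<Rightarrow> real) \<Rightarrow>
   (real \<Rightarrow> 'a) \<Rightarrow> real \<Rightarrow> real" where
  "speed \<A> g c t =
     (let \<kappa> = (SOME \<kappa>. \<kappa> \<in> \<A> \<and> c t \<in> fst \<kappa>);
          v = vector_derivative (snd \<kappa> \<circ> c) (at t)
      in sqrt (g \<kappa> (c t) v v))"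

definition path_length ::
  "('a, 'e::euclidean_space) chart set \<Rightarrow> (('a, 'e) chart \<Rightarrow> 'a \<Rightarrow> 'e \<Rightarrow> 'e \<Rightarrow> real) \<Rightarrow>
   (real \<Rightarrow> 'a) \<Rightarrow> real" where
  "path_length \<A> g c = integral {0..1} (speed \<A> g c)"

definition riemannian_dist ::
  "('a::topological_space, 'e::euclidean_space) chart set \<Rightarrow>
   (('a, 'e) chart \<Rightarrow> 'a \<Rightarrow> 'e \<Rightarrow> 'e \<Rightarrow> real) \<Rightarrow> 'a \<Rightarrow> 'a \<Rightarrow> real" where
  "riemannian_dist \<A> g x y =
     Inf {path_length \<A> g c |c. piecewise_C1_path \<A> c \<and> pathstart c = x \<and> pathfinish c = y}"

text \<open>The manifold is the whole type \<open>'a\<close>; its type class metric is required to be the Riemannian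
  distance, so that \<open>dist\<close>, \<open>ball\<close>, \<open>compact\<close> etc. are those of \<open>(M, g)\<close>.\<close>

locale complete_riemannian_manifold =
  fixes \<A> :: "('a::metric_space, 'e::euclidean_space) chart set"
    and g :: "('a, 'e) chart \<Rightarrow> 'a \<Rightarrow> 'e \<Rightarrow> 'e \<Rightarrow> real"
  assumes smooth_atlas: "smooth_atlas \<A>"
    and riemannian_metric: "riemannian_metric \<A> g"
    and connected: "connected (UNIV :: 'a set)"
    and dist_eq: "dist x y = riemannian_dist \<A> g x y"
    and complete: "complete (UNIV :: 'a set)"


section \<open>H-flows\<close>

text \<open>A flow of class \<open>C\<^sup>1\<close> jointly in time and space.\<close>

definition C1_flow ::
  "('a::topological_space, 'e::euclidean_space) chart set \<Rightarrow> (real \<Rightarrow> 'a \<Rightarrow> 'a) \<Rightarrow> bool" where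
  "C1_flow \<A> \<phi> \<longleftrightarrow>
     (\<forall>x. \<phi> 0 x = x) \<and>
     (\<forall>s t x. \<phi> (s + t) x = \<phi> s (\<phi> t x)) \<and>
     continuous_on UNIV (\<lambda>(t, x). \<phi> t x) \<and>
     (\<forall>\<kappa>\<in>\<A>. \<forall>\<kappa>'\<in>\<A>.
        Ck_on 1 {(t, z). z \<in> snd \<kappa> ` fst \<kappa> \<and> \<phi> t (chart_inv \<kappa> z) \<in> fst \<kappa>'}
          (\<lambda>(t, z). snd \<kappa>' (\<phi> t (chart_inv \<kappa> z))))"

locale H_flow = complete_riemannian_manifold \<A> g
  for \<A> :: "('a::metric_space, 'e::euclidean_space) chart set"
    and g :: "('a, 'e) chart \<Rightarrow> 'a \<Rightarrow> 'e \<Rightarrow> 'e \<Rightarrow> real" +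
  fixes \<phi> :: "real \<Rightarrow> 'a \<Rightarrow> 'a"
  assumes C1_flow: "C1_flow \<A> \<phi>"
    and lipschitz:
      "\<exists>lip. \<forall>x y. \<forall>\<tau>\<in>{-1..1}. dist (\<phi> \<tau> x) (\<phi> \<tau> y) \<le> lip * dist x y"
    and bounded_speed:
      "\<exists>a b. 0 < a \<and> a \<le> b \<and>
         (\<forall>x. \<exists>\<rho>>0. \<forall>t\<in>{-\<rho>..\<rho>}. a * \<bar>t\<bar> \<le> dist x (\<phi> t x) \<and> dist x (\<phi> t x) \<le> b * \<bar>t\<bar>)"
    and transitivity:
      "\<lbrakk>open U; U \<noteq> {}; open V; V \<noteq> {}; 0 < T\<rbrakk> \<Longrightarrow> \<exists>t\<ge>T. \<phi> t ` U \<inter> V \<noteq> {}"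
    and finite_exact_shadowing:
      "\<lbrakk>compact K; 0 < \<delta>; 1 \<le> N\<rbrakk> \<Longrightarrow>
         \<exists>\<eta>>0. \<forall>(x :: nat \<Rightarrow> 'a) (t :: nat \<Rightarrow> real).
           (\<forall>i\<in>{1..N}. x i \<in> K \<and> 0 \<le> t i) \<longrightarrow>
           (\<forall>i\<in>{1..N - 1}. dist (\<phi> (t i) (x i)) (x (i + 1)) < \<eta>) \<longrightarrow>
           (\<exists>y. \<forall>i\<in>{1..N}. \<forall>s\<in>{0..t i}.
              dist (\<phi> (s + (\<Sum>j=1..i - 1. t j)) y) (\<phi> s (x i)) < \<delta>)"
    and closing_lemma:
      "0 < \<epsilon> \<Longrightarrow>
         \<exists>\<delta>>0. \<exists>Tmin>0. \<forall>y\<in>ball x \<epsilon>. \<forall>t\<ge>Tmin. dist (\<phi> t y) y \<le> \<delta> \<longrightarrow>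
           (\<exists>z\<in>ball y \<epsilon>. \<exists>\<tau>\<in>{t - \<epsilon>..t + \<epsilon>}. \<phi> \<tau> z = z \<and>
              (\<forall>s\<in>{0..t}. dist (\<phi> s z) (\<phi> s y) \<le> \<epsilon>))"
    and expansivity:
      "0 < \<nu> \<Longrightarrow>
         \<exists>\<epsilon>>0. \<forall>x y.
           (\<exists>s :: real \<Rightarrow> real. continuous_on UNIV s \<and> s 0 = 0 \<and>
              (\<forall>t. dist (\<phi> t x) (\<phi> (s t) y) \<le> \<epsilon>)) \<longrightarrow>
           (\<exists>\<tau>\<in>{-\<nu>..\<nu>}. y = \<phi> \<tau> x)"


section \<open>Periodic orbits and Gurevic entropies\<close>

text \<open>A periodic orbit is a pair of the orbit as a set and a period, not necessarily the least one.\<close>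

definition periodic_orbits :: "(real \<Rightarrow> 'a \<Rightarrow> 'a) \<Rightarrow> ('a set \<times> real) set" where
  "periodic_orbits \<phi> = {(range (\<lambda>t. \<phi> t x), T) |x T. 0 < T \<and> \<phi> T x = x}"

text \<open>The time \<open>\<ell>(\<gamma> \<inter> A)\<close>; it does not depend on the chosen base point of the orbit.\<close>

definition time_in :: "(real \<Rightarrow> 'a \<Rightarrow> 'a) \<Rightarrow> 'a set \<times> real \<Rightarrow> 'a set \<Rightarrow> real" where
  "time_in \<phi> \<gamma> A = measure lebesgue {t\<in>{0..snd \<gamma>}. \<phi> t (SOME x. x \<in> fst \<gamma>) \<in> A}"

definition PK :: "(real \<Rightarrow> 'a \<Rightarrow> 'a) \<Rightarrow> 'a set \<Rightarrow> real \<Rightarrow> real \<Rightarrow> ('a set \<times> real) set" where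
  "PK \<phi> K T\<^sub>0 T\<^sub>1 = {\<gamma>\<in>periodic_orbits \<phi>. snd \<gamma> \<in> {T\<^sub>0..T\<^sub>1} \<and> fst \<gamma> \<inter> K \<noteq> {}}"

definition PK_alpha ::
  "(real \<Rightarrow> 'a \<Rightarrow> 'a) \<Rightarrow> 'a set \<Rightarrow> real \<Rightarrow> real \<Rightarrow> real \<Rightarrow> ('a set \<times> real) set" where
  "PK_alpha \<phi> K \<alpha> T\<^sub>0 T\<^sub>1 = {\<gamma>\<in>PK \<phi> K T\<^sub>0 T\<^sub>1. time_in \<phi> \<gamma> K < \<alpha> * snd \<gamma>}"

definition tau_K :: "(real \<Rightarrow> 'a \<Rightarrow> 'a) \<Rightarrow> 'a set \<Rightarrow> real" where
  "tau_K \<phi> K = Inf {snd \<gamma> |\<gamma>. \<gamma> \<in> periodic_orbits \<phi> \<and> 1 \<le> snd \<gamma> \<and> fst \<gamma> \<inter> K \<noteq> {}}"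

text \<open>\<open>log #S\<close> with \<open>log 0 = -\<infinity>\<close> and \<open>log \<infinity> = \<infinity>\<close>; note that \<open>ln 0 = 0\<close> and \<open>card S = 0\<close> for
  infinite \<open>S\<close> in HOL.\<close>

definition log_card :: "'b set \<Rightarrow> ereal" where
  "log_card S =
     (if infinite S then \<infinity> else if S = {} then -\<infinity> else ereal (ln (real (card S))))"

text \<open>The Gurevic entropy is the common value of the limsups for all compact sets with nonempty
  interior and all window lengths; likewise below for all window lengths.\<close>

definition h_Gur :: "(real \<Rightarrow> 'a::topological_space \<Rightarrow> 'a) \<Rightarrow> ereal" where
  "h_Gur \<phi> = (THE h. \<forall>K \<sigma>. compact K \<and> interior K \<noteq> {} \<and> 0 < \<sigma> \<longrightarrow>
     Limsup at_top (\<lambda>L::real. log_card (PK \<phi> K L (L + \<sigma>)) / ereal L) = h)"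

definition h_Gur_K_alpha :: "(real \<Rightarrow> 'a \<Rightarrow> 'a) \<Rightarrow> 'a set \<Rightarrow> real \<Rightarrow> ereal" where
  "h_Gur_K_alpha \<phi> K \<alpha> = (THE h. \<forall>\<sigma>>0.
     Limsup at_top (\<lambda>L::real. log_card (PK_alpha \<phi> K \<alpha> L (L + \<sigma>)) / ereal L) = h)"

definition h_Gur_infinity :: "(real \<Rightarrow> 'a::topological_space \<Rightarrow> 'a) \<Rightarrow> ereal" where
  "h_Gur_infinity \<phi> =
     (INF K\<in>{K. compact K \<and> interior K \<noteq> {}}. Lim (at_right 0) (h_Gur_K_alpha \<phi> K))"


section \<open>Measures on periodic orbits and vague convergence\<close>

definition mu_orbit :: "(real \<Rightarrow> 'a::topological_space \<Rightarrow> 'a) \<Rightarrow> 'a set \<times> real \<Rightarrow> 'a measure" where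
  "mu_orbit \<phi> \<gamma> =
     distr (uniform_measure lborel {0..snd \<gamma>}) borel (\<lambda>t. \<phi> t (SOME x. x \<in> fst \<gamma>))"

definition m_KL :: "(real \<Rightarrow> 'a::topological_space \<Rightarrow> 'a) \<Rightarrow> 'a set \<Rightarrow> real \<Rightarrow> 'a measure" where
  "m_KL \<phi> K L =
     (let P = PK \<phi> K L (L + 5 * tau_K \<phi> K)
      in measure_of UNIV (sets borel)
           (\<lambda>A. (\<Sum>\<gamma>\<in>P. emeasure (mu_orbit \<phi> \<gamma>) A) / of_nat (card P)))"

definition Cc :: "('a::topological_space \<Rightarrow> real) set" where
  "Cc = {f. continuous_on UNIV f \<and> (\<exists>C. compact C \<and> (\<forall>x. x \<notin> C \<longrightarrow> f x = 0))}"

definition radon_measure :: "'a::topological_space measure \<Rightarrow> bool" where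
  "radon_measure m \<longleftrightarrow> sets m = sets borel \<and> (\<forall>C. compact C \<longrightarrow> emeasure m C < \<infinity>)"

definition vague_limit :: "(nat \<Rightarrow> 'a::topological_space measure) \<Rightarrow> 'a measure \<Rightarrow> bool" where
  "vague_limit ms m \<longleftrightarrow> (\<forall>f\<in>Cc. (\<lambda>k. integral\<^sup>L (ms k) f) \<longlonglongrightarrow> integral\<^sup>L m f)"

text \<open>Every basic vague neighbourhood of \<open>m\<close> contains \<open>ms L\<close> for arbitrarily large \<open>L\<close>.\<close>

definition vague_accumulation_point ::
  "(real \<Rightarrow> 'a::topological_space measure) \<Rightarrow> 'a measure \<Rightarrow> bool" where
  "vague_accumulation_point ms m \<longleftrightarrow> radon_measure m \<and>
     (\<forall>F e. finite F \<and> F \<subseteq> Cc \<and> 0 < e \<longrightarrow>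
        (\<exists>\<^sub>F L in at_top. \<forall>f\<in>F. \<bar>integral\<^sup>L (ms L) f - integral\<^sup>L m f\<bar> < e))"


section \<open>Chords\<close>

definition dyn_ball :: "(real \<Rightarrow> 'a::metric_space \<Rightarrow> 'a) \<Rightarrow> 'a \<Rightarrow> real \<Rightarrow> real \<Rightarrow> 'a set" where
  "dyn_ball \<phi> z \<delta> T = {y. \<forall>t\<in>{0..T}. dist (\<phi> t z) (\<phi> t y) < \<delta>}"

definition chords ::
  "(real \<Rightarrow> 'a::metric_space \<Rightarrow> 'a) \<Rightarrow> 'a \<Rightarrow> 'a \<Rightarrow> real \<Rightarrow> real \<Rightarrow> real \<Rightarrow> 'a set" where
  "chords \<phi> x y \<eta> T\<^sub>m T\<^sub>p =
     {z\<in>ball x \<eta>. (\<lambda>t. \<phi> t z) ` {T\<^sub>m..T\<^sub>p} \<inter> ball y \<eta> \<noteq> {}}"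

definition separating :: "(real \<Rightarrow> 'a::metric_space \<Rightarrow> 'a) \<Rightarrow> real \<Rightarrow> real \<Rightarrow> 'a set \<Rightarrow> bool" where
  "separating \<phi> \<delta> T E \<longleftrightarrow>
     (\<forall>p\<in>E. \<forall>q\<in>E. p \<noteq> q \<longrightarrow> (\<exists>t\<in>{0..T}. \<delta> \<le> dist (\<phi> t p) (\<phi> t q)))"

text \<open>\<open>emeasure (count_space UNIV) E\<close> is the number of elements of \<open>E\<close>, being \<open>\<infinity>\<close> for infinite \<open>E\<close>.\<close>

definition N_chords ::
  "(real \<Rightarrow> 'a::metric_space \<Rightarrow> 'a) \<Rightarrow> 'a \<Rightarrow> 'a \<Rightarrow> real \<Rightarrow> real \<Rightarrow> real \<Rightarrow> real \<Rightarrow> ennreal" where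
  "N_chords \<phi> x y \<eta> T\<^sub>m T\<^sub>p \<delta> =
     (SUP E\<in>{E. E \<subseteq> chords \<phi> x y \<eta> T\<^sub>m T\<^sub>p \<and> separating \<phi> \<delta> T\<^sub>m E \<and>
                chords \<phi> x y \<eta> T\<^sub>m T\<^sub>p \<subseteq> (\<Union>z\<in>E. dyn_ball \<phi> z \<delta> T\<^sub>m)}.
        emeasure (count_space UNIV) E)"

end

theory Submission
  imports Defs
begin

text \<open>
  The measure \<open>m_KL \<phi> K\<^sub>0 L\<close> of the dynamical ball of \<open>x\<close> is, up to constants, the number of visits
  to this ball by the periodic orbits of length about \<open>L\<close>, divided by \<open>L\<close> times the number of these
  orbits. Both estimates compare these visits with the chords from \<open>x\<close> to \<open>y\<^sub>0\<close> of length about \<open>T\<close> by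
  cutting and gluing orbits, for a fixed \<open>T\<close> and all large \<open>L\<close>, with constants that depend neither
  on \<open>T\<close> nor on \<open>L\<close>.

  Upper estimate (\<open>upper_count\<close>): in a periodic orbit that visits the dynamical ball, the passage
  near the segment from \<open>x\<close> to \<open>\<phi> T x\<close> can be replaced by any chord. The number of visits times the
  number of separated chords is therefore at most a constant times \<open>L\<close>, for the position of the chord
  on the new orbit, times the number of periodic orbits of length about \<open>L\<close>.

  Lower estimate (\<open>lower_count\<close>): a periodic orbit that is in \<open>K\<close> at two times \<open>T + S\<close> apart splits into
  two pieces, one of which is turned into a chord from \<open>x\<close> to \<open>y\<^sub>0\<close>, while the other one is closed up
  through the segment from \<open>x\<close> to \<open>\<phi> T x\<close>. So the number of such pairs of times is at most a constant
  times the number of chords times the number of visits. A positive proportion of the times qualifies: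
  the vague limit is flow invariant, hence the set of points of \<open>interior K\<close> that are in \<open>interior K\<close>
  again after the time \<open>T + S\<close> has at least half of the total mass.

  Gluing (\<open>closed_gluing\<close>) combines transitivity, which connects points of a compact set in bounded
  time, finite exact shadowing for a bounded number of segments, and the closing lemma; the length of
  the glued orbit is adjusted by turns around a short periodic orbit. That the glued orbit determines the
  given ones up to bounded multiplicity follows from expansivity for periodic orbits, applied with the
  linear reparametrisation.

  The counts only apply to primitive orbits, since a multiply covered orbit visits the ball repeatedly
  at the same points. If there are two distinct periodic orbits, then the non-primitive ones are
  negligible (\<open>nonprimitive_count\<close>): such an orbit can be followed for a single turn, and the time left,
  at least about half of \<open>L\<close>, can be filled with turns around the two orbits in about \<open>L\<^sup>2\<close> ways. If
  there is only one periodic orbit, then it is the whole manifold, and both estimates are elementary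
  (\<open>bounds_one_orbit\<close>).
\<close>

section \<open>Flow, compactness and expansivity\<close>

lemma compact_nbhd_of_locally_compact:
  fixes K :: "'a::metric_space set"
  assumes lc: "\<And>x::'a. \<exists>r>0. \<exists>C. compact C \<and> ball x r \<subseteq> C"
    and K: "compact K"
  obtains r C where "0 < r" "compact C" "\<And>x. x \<in> K \<Longrightarrow> ball x r \<subseteq> C"
proof -
  obtain r C where rC: "\<And>x::'a. 0 < r x" "\<And>x. compact (C x)" "\<And>x. ball x (r x) \<subseteq> C x"
    using lc by metis
  have "K \<subseteq> (\<Union>x\<in>K. ball x (r x / 2))"
    using rC(1) by force
  then obtain D where D: "D \<subseteq> K" "finite D" "K \<subseteq> (\<Union>x\<in>D. ball x (r x / 2))"
    using compactE_image[OF K, of K "\<lambda>x. ball x (r x / 2)"] by auto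
  define \<rho> where "\<rho> = Min (insert 1 ((\<lambda>x. r x / 2) ` D))"
  have \<rho>: "0 < \<rho>"
    unfolding \<rho>_def using D(2) rC(1) by (subst Min_gr_iff) auto
  have \<rho>_le: "\<rho> \<le> r x / 2" if "x \<in> D" for x
    unfolding \<rho>_def by (rule Min_le) (use D(2) that in auto)
  have "ball x \<rho> \<subseteq> (\<Union>x\<in>D. C x)" if "x \<in> K" for x
  proof -
    obtain c where c: "c \<in> D" "dist c x < r c / 2" using D(3) \<open>x \<in> K\<close> by auto
    have "ball x \<rho> \<subseteq> ball c (r c)"
    proof
      fix y assume "y \<in> ball x \<rho>"
      then show "y \<in> ball c (r c)"
        using c \<rho>_le[OF c(1)] dist_triangle[of c y x] by (simp add: dist_commute)
    qed
    then show ?thesis using rC(3)[of c] c(1) by blast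
  qed
  moreover have "compact (\<Union>x\<in>D. C x)" using D(2) rC(2) by auto
  ultimately show ?thesis using that \<rho> by blast
qed

context H_flow
begin

abbreviation orbit :: "'a \<Rightarrow> 'a set" where
  "orbit x \<equiv> range (\<lambda>t. \<phi> t x)"

lemma flow_0 [simp]: "\<phi> 0 x = x"
  using C1_flow by (simp add: C1_flow_def)

lemma flow_add: "\<phi> (s + t) x = \<phi> s (\<phi> t x)"
  using C1_flow by (simp add: C1_flow_def)

lemma flow_flow: "\<phi> s (\<phi> t x) = \<phi> (s + t) x"
  by (simp add: flow_add)

lemma flow_minus [simp]: "\<phi> (- t) (\<phi> t x) = x" "\<phi> t (\<phi> (- t) x) = x"
  by (simp_all add: flow_flow)

lemma continuous_flow: "continuous_on UNIV (\<lambda>(t, x). \<phi> t x)"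
  using C1_flow by (simp add: C1_flow_def)

lemma continuous_on_flow [continuous_intros]:
  assumes "continuous_on S f" "continuous_on S h"
  shows "continuous_on S (\<lambda>z. \<phi> (f z) (h z))"
  using continuous_on_compose2[OF continuous_flow continuous_on_Pair[OF assms]] by simp

lemma flow_period_of_nat:
  assumes "\<phi> T x = x" shows "\<phi> (real n * T) x = x"
proof (induction n)
  case (Suc n)
  have "\<phi> (real (Suc n) * T) x = \<phi> T (\<phi> (real n * T) x)"
    by (simp add: flow_flow algebra_simps)
  then show ?case using Suc assms by simp
qed simp

lemma flow_period_of_int:
  assumes "\<phi> T x = x" shows "\<phi> (of_int k * T) x = x"
proof (cases "0 \<le> k")
  case True
  then show ?thesis using flow_period_of_nat[OF assms, of "nat k"] by simp
next
  case False
  have "\<phi> (- of_int k * T) x = x"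
    using flow_period_of_nat[OF assms, of "nat (- k)"] False by simp
  then have "\<phi> (of_int k * T) (\<phi> (- of_int k * T) x) = \<phi> (of_int k * T) x" by simp
  then show ?thesis by (simp add: flow_flow)
qed

lemma flow_period_shift:
  assumes "\<phi> T x = x" shows "\<phi> T (\<phi> s x) = \<phi> s x"
  by (metis add.commute assms flow_add)

lemma flow_period_reduce:
  assumes "\<phi> T x = x" "0 < T"
  obtains k :: int and r where "t = of_int k * T + r" "0 \<le> r" "r < T" "\<phi> t x = \<phi> r x"
proof -
  define k where "k = \<lfloor>t / T\<rfloor>"
  define r where "r = t - of_int k * T"
  have "of_int k \<le> t / T" "t / T < of_int k + 1" unfolding k_def by linarith+
  then have "0 \<le> r" "r < T" using assms(2) by (auto simp: r_def field_simps)
  moreover have "\<phi> t x = \<phi> r x"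
    using flow_period_of_int[OF assms(1), of k] flow_add[of r "of_int k * T" x] by (simp add: r_def)
  ultimately show ?thesis using that[of k r] by (simp add: r_def)
qed

lemma orbit_eq: "orbit (\<phi> s x) = orbit x"
proof -
  have "\<phi> t x \<in> orbit (\<phi> s x)" for t
    by (rule range_eqI[of _ _ "t - s"]) (simp add: flow_flow)
  then show ?thesis by (auto simp: flow_flow)
qed

lemma orbit_eqI: "y \<in> orbit x \<Longrightarrow> orbit y = orbit x"
  using orbit_eq by (metis imageE)

lemma orbit_self: "x \<in> orbit x"
  by (rule range_eqI[of _ _ 0]) simp

lemma compact_periodic_orbit:
  assumes "\<phi> T x = x" "0 < T" shows "compact (orbit x)"
proof -
  have "orbit x = (\<lambda>t. \<phi> t x) ` {0..T}"
  proof
    show "orbit x \<subseteq> (\<lambda>t. \<phi> t x) ` {0..T}"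
    proof
      fix y assume "y \<in> orbit x"
      then obtain t where "y = \<phi> t x" by auto
      moreover obtain k r where "t = of_int k * T + r" "0 \<le> r" "r < T" "\<phi> t x = \<phi> r x"
        using flow_period_reduce[OF assms] by metis
      ultimately show "y \<in> (\<lambda>t. \<phi> t x) ` {0..T}" by auto
    qed
  qed auto
  moreover have "compact ((\<lambda>t. \<phi> t x) ` {0..T})"
    by (intro compact_continuous_image continuous_intros) auto
  ultimately show ?thesis by simp
qed

text \<open>The pointwise bound of \<open>bounded_speed\<close> integrates to a global Lipschitz bound along orbits.\<close>

lemma speed_bound:
  obtains b where "0 < b" "\<And>s t x. dist (\<phi> s x) (\<phi> t x) \<le> b * \<bar>s - t\<bar>"
proof -
  obtain a b where ab: "0 < a" "a \<le> b"
    and loc: "\<And>x. \<exists>\<rho>>0. \<forall>t\<in>{-\<rho>..\<rho>}. a * \<bar>t\<bar> \<le> dist x (\<phi> t x) \<and> dist x (\<phi> t x) \<le> b * \<bar>t\<bar>"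
    using bounded_speed by metis
  have pos: "dist x (\<phi> t x) \<le> b * t" if "0 \<le> t" for x t
  proof -
    define A where "A = {s\<in>{0..t}. dist x (\<phi> s x) \<le> b * s}"
    have "closed A"
      unfolding A_def by (intro continuous_on_closed_Collect_le continuous_intros; simp)
    moreover have "0 \<in> A" using that by (simp add: A_def)
    moreover have "bdd_above A" by (auto simp: A_def intro: bdd_aboveI[of _ t])
    ultimately have S: "Sup A \<in> A" using closed_contains_Sup by blast
    have "Sup A = t"
    proof (rule ccontr)
      assume "Sup A \<noteq> t"
      then have lt: "Sup A < t" using S by (auto simp: A_def)
      obtain \<rho> where \<rho>: "\<rho> > 0" "\<And>r. r \<in> {-\<rho>..\<rho>} \<Longrightarrow> dist (\<phi> (Sup A) x) (\<phi> r (\<phi> (Sup A) x)) \<le> b * \<bar>r\<bar>"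
        using loc[of "\<phi> (Sup A) x"] by blast
      define r where "r = min \<rho> (t - Sup A)"
      have r: "0 < r" "r \<le> \<rho>" "Sup A + r \<le> t" using \<rho>(1) lt by (auto simp: r_def)
      have "dist x (\<phi> (Sup A + r) x) \<le> dist x (\<phi> (Sup A) x) + dist (\<phi> (Sup A) x) (\<phi> (Sup A + r) x)"
        by (rule dist_triangle)
      also have "\<dots> \<le> b * Sup A + b * r"
        using S \<rho>(2)[of r] r by (simp add: A_def flow_flow add.commute)
      finally have "Sup A + r \<in> A" using S r by (auto simp: A_def algebra_simps)
      then have "Sup A + r \<le> Sup A" using \<open>bdd_above A\<close> by (rule cSup_upper)
      then show False using r by simp
    qed
    then show ?thesis using S by (simp add: A_def)
  qed
  have le: "dist (\<phi> s x) (\<phi> t x) \<le> b * (t - s)" if "s \<le> t" for s t x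
    using pos[of "t - s" "\<phi> s x"] that by (simp add: flow_flow)
  have "dist (\<phi> s x) (\<phi> t x) \<le> b * \<bar>s - t\<bar>" for s t x
    using le[of s t x] le[of t s x] by (cases "s \<le> t") (auto simp: dist_commute)
  then show ?thesis using that[of b] ab by simp
qed

lemma locally_compact_manifold: "\<exists>r>0. \<exists>C. compact C \<and> ball (x::'a) r \<subseteq> C"
proof -
  obtain \<kappa> where \<kappa>: "\<kappa> \<in> \<A>" "x \<in> fst \<kappa>"
    using smooth_atlas unfolding smooth_atlas_def by blast
  have op: "open (fst \<kappa>)" "open (snd \<kappa> ` fst \<kappa>)"
    and hom: "homeomorphism (fst \<kappa>) (snd \<kappa> ` fst \<kappa>) (snd \<kappa>) (chart_inv \<kappa>)"
    using smooth_atlas \<kappa>(1) unfolding smooth_atlas_def by blast+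
  obtain e where e: "0 < e" "cball (snd \<kappa> x) e \<subseteq> snd \<kappa> ` fst \<kappa>"
    using op(2) \<kappa>(2) open_contains_cball by blast
  define C where "C = chart_inv \<kappa> ` cball (snd \<kappa> x) e"
  have "compact C"
    unfolding C_def
    by (intro compact_continuous_image compact_cball continuous_on_subset[OF _ e(2)])
      (use hom in \<open>simp add: homeomorphism_def\<close>)
  moreover have "open (fst \<kappa> \<inter> snd \<kappa> -` ball (snd \<kappa> x) e)"
    using hom op(1) by (intro continuous_open_preimage) (auto simp: homeomorphism_def)
  then obtain r where r: "0 < r" "ball x r \<subseteq> fst \<kappa> \<inter> snd \<kappa> -` ball (snd \<kappa> x) e"
    using \<kappa>(2) e(1) openE[of "fst \<kappa> \<inter> snd \<kappa> -` ball (snd \<kappa> x) e" x] by auto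
  have "ball x r \<subseteq> C"
  proof
    fix y assume "y \<in> ball x r"
    then have "y \<in> fst \<kappa>" "snd \<kappa> y \<in> cball (snd \<kappa> x) e" using r by auto
    moreover from this have "chart_inv \<kappa> (snd \<kappa> y) = y" using hom by (simp add: homeomorphism_def)
    ultimately show "y \<in> C" unfolding C_def by force
  qed
  ultimately show ?thesis using r(1) by blast
qed

lemma compact_nbhd:
  fixes K :: "'a set"
  assumes "compact K"
  obtains r C where "0 < r" "compact C" "\<And>x. x \<in> K \<Longrightarrow> ball x r \<subseteq> C"
  using compact_nbhd_of_locally_compact[OF locally_compact_manifold assms] by metis

text \<open>A limit of points with periods tending to \<open>0\<close> would be a fixed point.\<close>

lemma min_period:
  assumes "compact K"
  obtains p where "0 < p" "\<And>x t. x \<in> K \<Longrightarrow> 0 < t \<Longrightarrow> \<phi> t x = x \<Longrightarrow> p \<le> t"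
proof (rule ccontr)
  assume "\<not> thesis"
  then have "\<exists>x t. x \<in> K \<and> 0 < t \<and> \<phi> t x = x \<and> t < p" if "0 < p" for p
    using that \<open>\<And>p. \<lbrakk>0 < p; \<And>x t. \<lbrakk>x \<in> K; 0 < t; \<phi> t x = x\<rbrakk> \<Longrightarrow> p \<le> t\<rbrakk> \<Longrightarrow> thesis\<close>
    by (meson not_le)
  then have "\<exists>x t. x \<in> K \<and> 0 < t \<and> \<phi> t x = x \<and> t < inverse (real (Suc n))" for n
    by simp
  then obtain x t where xt: "\<And>n. x n \<in> K" "\<And>n. 0 < t n" "\<And>n. \<phi> (t n) (x n) = x n"
    "\<And>n. t n < inverse (real (Suc n))"
    by metis
  obtain y r where y: "y \<in> K" "strict_mono r" "(x \<circ> r) \<longlonglongrightarrow> y"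
    using assms xt(1) unfolding compact_def by metis
  obtain b where b: "0 < b" "\<And>s t x. dist (\<phi> s x) (\<phi> t x) \<le> b * \<bar>s - t\<bar>"
    using speed_bound by metis
  have fixed: "\<phi> s y = y" for s
  proof -
    have "dist (\<phi> s (x n)) (x n) \<le> b * inverse (real (Suc n))" for n
    proof -
      obtain k q where q: "s = of_int k * t n + q" "0 \<le> q" "q < t n" "\<phi> s (x n) = \<phi> q (x n)"
        using flow_period_reduce[OF xt(3) xt(2)] by metis
      have "dist (\<phi> q (x n)) (x n) \<le> b * q" using b(2)[of q "x n" 0] q by simp
      also have "\<dots> \<le> b * inverse (real (Suc n))"
        using q xt(4)[of n] b(1) by (intro mult_left_mono) auto
      finally show ?thesis using q by simp
    qed
    then have le: "dist (\<phi> s (x (r n))) (x (r n)) \<le> b * inverse (real (Suc (r n)))" for n by blast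
    have "(\<lambda>n. inverse (real (Suc (r n)))) \<longlonglongrightarrow> 0"
      using LIMSEQ_subseq_LIMSEQ[OF LIMSEQ_inverse_real_of_nat y(2)] by (simp add: o_def)
    then have 1: "(\<lambda>n. b * inverse (real (Suc (r n)))) \<longlonglongrightarrow> 0"
      using tendsto_mult_right_zero by blast
    have "isCont (\<phi> s) y"
      using continuous_on_flow[OF continuous_on_const continuous_on_id, of UNIV s]
      by (simp add: continuous_on_eq_continuous_at)
    then have "(\<lambda>n. dist (\<phi> s (x (r n))) (x (r n))) \<longlonglongrightarrow> dist (\<phi> s y) y"
      using y(3) by (intro tendsto_dist isCont_tendsto_compose[of y "\<phi> s"]) (auto simp: o_def)
    then have "dist (\<phi> s y) y \<le> 0"
      using 1 le by (intro LIMSEQ_le) auto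
    then show ?thesis by simp
  qed
  obtain a c :: real where "0 < a"
    "\<And>x. \<exists>\<rho>>0. \<forall>t\<in>{-\<rho>..\<rho>}. a * \<bar>t\<bar> \<le> dist x (\<phi> t x) \<and> dist x (\<phi> t x) \<le> c * \<bar>t\<bar>"
    using bounded_speed by blast
  moreover from this(2)[of y] obtain \<rho> where \<rho>: "\<rho> > 0"
    "\<And>t. t \<in> {-\<rho>..\<rho>} \<Longrightarrow> a * \<bar>t\<bar> \<le> dist y (\<phi> t y)"
    by blast
  moreover from \<rho>(2)[of \<rho>] \<rho>(1) have "a * \<bar>\<rho>\<bar> \<le> dist y (\<phi> \<rho> y)" by simp
  ultimately have "0 < a * \<bar>\<rho>\<bar>" "a * \<bar>\<rho>\<bar> \<le> dist y (\<phi> \<rho> y)" by auto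
  then show False using fixed[of \<rho>] by simp
qed

text \<open>\<open>e\<close> is an expansivity constant for periodic points: two of them with \<open>e\<close>-close periods and
  \<open>e\<close>-close orbits over one period lie on the same orbit, at most the time \<open>1/2\<close> apart.\<close>

definition expansive_const :: "real \<Rightarrow> bool" where
  "expansive_const e \<longleftrightarrow> (\<forall>x\<^sub>1 x\<^sub>2 l\<^sub>1 l\<^sub>2. \<phi> l\<^sub>1 x\<^sub>1 = x\<^sub>1 \<and> \<phi> l\<^sub>2 x\<^sub>2 = x\<^sub>2 \<and> 0 < l\<^sub>1 \<and> 0 < l\<^sub>2 \<and> \<bar>l\<^sub>1 - l\<^sub>2\<bar> \<le> e \<and>
      (\<forall>t. 0 \<le> t \<and> t \<le> l\<^sub>1 \<and> t \<le> l\<^sub>2 \<longrightarrow> dist (\<phi> t x\<^sub>1) (\<phi> t x\<^sub>2) \<le> e) \<longrightarrow>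
      (\<exists>\<tau>. \<bar>\<tau>\<bar> \<le> 1/2 \<and> x\<^sub>2 = \<phi> \<tau> x\<^sub>1))"

text \<open>In the expansivity axiom, the linear map that takes one period to the other serves as the
  reparametrisation.\<close>

lemma expansive_const_exists:
  obtains e where "0 < e" "expansive_const e"
proof -
  obtain b where b: "0 < b" "\<And>s t x. dist (\<phi> s x) (\<phi> t x) \<le> b * \<bar>s - t\<bar>"
    using speed_bound by metis
  obtain \<epsilon> where \<epsilon>: "\<epsilon> > 0" "\<And>x y s. \<lbrakk>continuous_on UNIV s; s 0 = 0;
      \<And>t. dist (\<phi> t x) (\<phi> (s t) y) \<le> \<epsilon>\<rbrakk> \<Longrightarrow> \<exists>\<tau>\<in>{-(1/2)..1/2}. y = \<phi> \<tau> x"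
    using expansivity[of "1/2"] by (metis half_gt_zero_iff zero_less_one)
  define e where "e = \<epsilon> / (1 + b)"
  have e: "0 < e" using \<epsilon>(1) b(1) by (simp add: e_def)
  have "e * (1 + b) = \<epsilon>" using b(1) by (simp add: e_def)
  then have e_sum: "e + b * e = \<epsilon>" by (simp add: distrib_left mult.commute)
  have main: "\<exists>\<tau>. \<bar>\<tau>\<bar> \<le> 1/2 \<and> x\<^sub>2 = \<phi> \<tau> x\<^sub>1"
    if per: "\<phi> l\<^sub>1 x\<^sub>1 = x\<^sub>1" "\<phi> l\<^sub>2 x\<^sub>2 = x\<^sub>2" "0 < l\<^sub>1" "0 < l\<^sub>2" and "l\<^sub>2 - l\<^sub>1 \<le> e" "l\<^sub>1 \<le> l\<^sub>2"
      and close: "\<And>t. 0 \<le> t \<Longrightarrow> t \<le> l\<^sub>1 \<Longrightarrow> dist (\<phi> t x\<^sub>1) (\<phi> t x\<^sub>2) \<le> e" for x\<^sub>1 x\<^sub>2 l\<^sub>1 l\<^sub>2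
  proof -
    define s where "s t = t * l\<^sub>2 / l\<^sub>1" for t
    have "dist (\<phi> t x\<^sub>1) (\<phi> (s t) x\<^sub>2) \<le> \<epsilon>" for t
    proof -
      obtain k q where q: "t = of_int k * l\<^sub>1 + q" "0 \<le> q" "q < l\<^sub>1" "\<phi> t x\<^sub>1 = \<phi> q x\<^sub>1"
        using flow_period_reduce[OF per(1,3)] by metis
      have "s t = s q + of_int k * l\<^sub>2" using per(3) by (simp add: s_def q(1) field_simps)
      then have "\<phi> (s t) x\<^sub>2 = \<phi> (s q) x\<^sub>2"
        using flow_period_of_int[OF per(2), of k] by (simp add: flow_add)
      moreover have "\<bar>q - s q\<bar> \<le> e"
      proof -
        have "s q - q = (l\<^sub>2 - l\<^sub>1) * (q / l\<^sub>1)" using per(3) by (simp add: s_def field_simps)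
        moreover have "0 \<le> q / l\<^sub>1" "q / l\<^sub>1 \<le> 1" using q by auto
        then have "0 \<le> (l\<^sub>2 - l\<^sub>1) * (q / l\<^sub>1)" "(l\<^sub>2 - l\<^sub>1) * (q / l\<^sub>1) \<le> l\<^sub>2 - l\<^sub>1"
          using that(6) by (intro mult_nonneg_nonneg mult_left_le; simp)+
        ultimately have "0 \<le> s q - q" "s q - q \<le> l\<^sub>2 - l\<^sub>1"
          by linarith+
        then show ?thesis using that(5) by linarith
      qed
      then have "dist (\<phi> q x\<^sub>2) (\<phi> (s q) x\<^sub>2) \<le> b * e"
        using b(1) by (intro order_trans[OF b(2)]) (simp add: mult_left_mono)
      moreover have "dist (\<phi> q x\<^sub>1) (\<phi> q x\<^sub>2) \<le> e" using close q by simp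
      ultimately show ?thesis
        using e_sum q(4) dist_triangle[of "\<phi> q x\<^sub>1" "\<phi> (s q) x\<^sub>2" "\<phi> q x\<^sub>2"] by simp
    qed
    with per(3) have "\<exists>\<tau>\<in>{-(1/2)..1/2}. x\<^sub>2 = \<phi> \<tau> x\<^sub>1"
      by (intro \<epsilon>(2)[of s]) (auto simp: s_def intro!: continuous_intros)
    then obtain \<tau> where "- (1/2) \<le> \<tau>" "\<tau> \<le> 1/2" "x\<^sub>2 = \<phi> \<tau> x\<^sub>1" by auto
    then show ?thesis by (intro exI[of _ \<tau>]) (simp add: abs_le_iff)
  qed
  have both: "\<exists>\<tau>. \<bar>\<tau>\<bar> \<le> 1/2 \<and> x\<^sub>2 = \<phi> \<tau> x\<^sub>1"
    if per: "\<phi> l\<^sub>1 x\<^sub>1 = x\<^sub>1" "\<phi> l\<^sub>2 x\<^sub>2 = x\<^sub>2" "0 < l\<^sub>1" "0 < l\<^sub>2" and "\<bar>l\<^sub>1 - l\<^sub>2\<bar> \<le> e"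
      and close: "\<And>t. 0 \<le> t \<Longrightarrow> t \<le> l\<^sub>1 \<Longrightarrow> t \<le> l\<^sub>2 \<Longrightarrow> dist (\<phi> t x\<^sub>1) (\<phi> t x\<^sub>2) \<le> e"
    for x\<^sub>1 x\<^sub>2 l\<^sub>1 l\<^sub>2
  proof (cases "l\<^sub>1 \<le> l\<^sub>2")
    case True
    then show ?thesis using main[of l\<^sub>1 x\<^sub>1 l\<^sub>2 x\<^sub>2] that by auto
  next
    case False
    then have "\<exists>\<tau>. \<bar>\<tau>\<bar> \<le> 1/2 \<and> x\<^sub>1 = \<phi> \<tau> x\<^sub>2"
      using that by (intro main[of l\<^sub>2 x\<^sub>2 l\<^sub>1 x\<^sub>1]) (auto simp: dist_commute)
    then obtain \<tau> where "\<bar>\<tau>\<bar> \<le> 1/2" "x\<^sub>1 = \<phi> \<tau> x\<^sub>2" by blast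
    then show ?thesis by (intro exI[of _ "- \<tau>"]) simp
  qed
  show ?thesis
    by (rule that[OF e]) (unfold expansive_const_def, use both in blast)
qed

end

section \<open>Gluing orbit segments\<close>

text \<open>An orbit segment is a pair of its starting point and its duration. The point \<open>y\<close> tracks a list
  of segments if its orbit stays \<open>\<delta>\<close>-close to the segments in turn; between a segment that ends in
  \<open>p\<close> and one that starts in \<open>q\<close> it spends the time \<open>ct p q\<close>.\<close>

fun tracks ::
  "(real \<Rightarrow> 'a::metric_space \<Rightarrow> 'a) \<Rightarrow> ('a \<Rightarrow> 'a \<Rightarrow> real) \<Rightarrow> real \<Rightarrow> 'a \<Rightarrow> ('a \<times> real) list \<Rightarrow> bool" where
  "tracks \<phi> ct \<delta> y [] \<longleftrightarrow> True"
| "tracks \<phi> ct \<delta> y [(x, t)] \<longleftrightarrow> (\<forall>s\<in>{0..t}. dist (\<phi> s y) (\<phi> s x) \<le> \<delta>)"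
| "tracks \<phi> ct \<delta> y ((x, t) # (x', t') # ps) \<longleftrightarrow>
     (\<forall>s\<in>{0..t}. dist (\<phi> s y) (\<phi> s x) \<le> \<delta>) \<and>
     tracks \<phi> ct \<delta> (\<phi> (t + ct (\<phi> t x) x') y) ((x', t') # ps)"

text \<open>The time at which a tracking point has reached the start of the last segment.\<close>

fun last_start ::
  "(real \<Rightarrow> 'a \<Rightarrow> 'a) \<Rightarrow> ('a \<Rightarrow> 'a \<Rightarrow> real) \<Rightarrow> ('a \<times> real) list \<Rightarrow> real" where
  "last_start \<phi> ct ((x, t) # (x', t') # ps) =
     t + ct (\<phi> t x) x' + last_start \<phi> ct ((x', t') # ps)"
| "last_start \<phi> ct ps = 0"

text \<open>Each segment of the list ends \<open>\<eta>\<close>-close to the start of the next one.\<close>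

fun chain :: "(real \<Rightarrow> 'a::metric_space \<Rightarrow> 'a) \<Rightarrow> real \<Rightarrow> ('a \<times> real) list \<Rightarrow> bool" where
  "chain \<phi> \<eta> ((x, t) # (x', t') # ps) \<longleftrightarrow>
     dist (\<phi> t x) x' < \<eta> \<and> chain \<phi> \<eta> ((x', t') # ps)"
| "chain \<phi> \<eta> ps \<longleftrightarrow> True"

text \<open>Insertion of the connecting segment \<open>(cp p q, ct p q)\<close> between a segment that ends in \<open>p\<close> and
  the next one, that starts in \<open>q\<close>.\<close>

fun link ::
  "(real \<Rightarrow> 'a \<Rightarrow> 'a) \<Rightarrow> ('a \<Rightarrow> 'a \<Rightarrow> 'a) \<Rightarrow> ('a \<Rightarrow> 'a \<Rightarrow> real) \<Rightarrow>
   ('a \<times> real) list \<Rightarrow> ('a \<times> real) list" where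
  "link \<phi> cp ct ((x, t) # (x', t') # ps) =
     (x, t) # (cp (\<phi> t x) x', ct (\<phi> t x) x') # link \<phi> cp ct ((x', t') # ps)"
| "link \<phi> cp ct ps = ps"

lemma length_link: "length (link \<phi> cp ct ps) = 2 * length ps - 1"
  by (induction \<phi> cp ct ps rule: link.induct) auto

lemma link_Cons: "\<exists>qs. link \<phi> cp ct ((x, t) # ps) = (x, t) # qs"
  by (cases ps) auto

context H_flow
begin

text \<open>The segments have nonnegative durations, and start and end in \<open>K\<close>; they may leave it in between.\<close>

definition segments_in :: "'a set \<Rightarrow> ('a \<times> real) list \<Rightarrow> bool" where
  "segments_in K ps \<longleftrightarrow> (\<forall>(x, t)\<in>set ps. x \<in> K \<and> \<phi> t x \<in> K \<and> 0 \<le> t)"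

lemma segments_in_simps [simp]:
  "segments_in K []"
  "segments_in K ((x, t) # ps) \<longleftrightarrow> x \<in> K \<and> \<phi> t x \<in> K \<and> 0 \<le> t \<and> segments_in K ps"
  "segments_in K (ps @ qs) \<longleftrightarrow> segments_in K ps \<and> segments_in K qs"
  by (auto simp: segments_in_def)

lemma chain_link:
  assumes conn: "\<And>p q. p \<in> K \<Longrightarrow> q \<in> K \<Longrightarrow> dist p (cp p q) < \<eta> \<and> dist (\<phi> (ct p q) (cp p q)) q < \<eta>"
    and "segments_in K ps"
  shows "chain \<phi> \<eta> (link \<phi> cp ct ps)"
  using assms(2)
proof (induction ps rule: induct_list012)
  case (3 p p' ps)
  obtain x t x' t' where p: "p = (x, t)" "p' = (x', t')" by (metis surj_pair)
  obtain qs where "link \<phi> cp ct ((x', t') # ps) = (x', t') # qs" using link_Cons by metis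
  then show ?case using 3 p conn by auto
qed auto

lemma link_in:
  assumes conn: "\<And>p q. p \<in> K \<Longrightarrow> q \<in> K \<Longrightarrow> cp p q \<in> K' \<and> 0 \<le> ct p q" and "K \<subseteq> K'"
    and "segments_in K ps"
  shows "\<forall>(x, t)\<in>set (link \<phi> cp ct ps). x \<in> K' \<and> 0 \<le> t"
  using assms(3)
proof (induction ps rule: induct_list012)
  case (3 p p' ps)
  obtain x t x' t' where p: "p = (x, t)" "p' = (x', t')" by (metis surj_pair)
  show ?case using 3 p conn assms(2) by auto
qed (use assms(2) in auto)

lemma tracks_link:
  assumes "tracks \<phi> (\<lambda>_ _. 0) \<delta> y (link \<phi> cp ct ps)"
  shows "tracks \<phi> ct \<delta> y ps"
  using assms
proof (induction ps arbitrary: y rule: induct_list012)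
  case (3 p p' ps)
  obtain x t x' t' where p: "p = (x, t)" "p' = (x', t')" by (metis surj_pair)
  obtain qs where "link \<phi> cp ct ((x', t') # ps) = (x', t') # qs" using link_Cons by metis
  then show ?case using 3 p by (auto simp: flow_flow add.commute)
qed auto

lemma tracks_appendD: "tracks \<phi> ct \<delta> y (ps @ qs) \<Longrightarrow> tracks \<phi> ct \<delta> y ps"
proof (induction ps arbitrary: y rule: induct_list012)
  case (2 p)
  then show ?case by (cases p; cases qs) auto
next
  case (3 p p' ps)
  obtain x t x' t' where p: "p = (x, t)" "p' = (x', t')" by (metis surj_pair)
  then show ?case using 3 by auto
qed auto

lemma tracks_last:
  assumes "tracks \<phi> ct \<delta> y (ps @ [(x, t)])" "0 \<le> t"
  shows "dist (\<phi> (last_start \<phi> ct (ps @ [(x, t)])) y) x \<le> \<delta>"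
  using assms
proof (induction ps arbitrary: y rule: induct_list012)
  case (2 p)
  then show ?case by (cases p) (auto dest!: bspec[of _ _ 0])
next
  case (3 p p' ps)
  obtain u v u' v' where p: "p = (u, v)" "p' = (u', v')" by (metis surj_pair)
  have "dist (\<phi> (last_start \<phi> ct ((p' # ps) @ [(x, t)])) (\<phi> (v + ct (\<phi> v u) u') y)) x \<le> \<delta>"
    using 3 p by (intro "3.IH"(2)) auto
  then show ?case using p by (simp add: flow_flow add.commute)
qed (auto dest!: bspec[of _ _ 0])

lemma last_start_append:
  "last_start \<phi> ct (ps @ [(x, t), (x', t')]) =
     last_start \<phi> ct (ps @ [(x, t)]) + t + ct (\<phi> t x) x'"
proof (induction ps rule: induct_list012)
  case (2 p)
  then show ?case by (cases p) auto
next
  case (3 p p' ps)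
  obtain x t x' t' where p: "p = (x, t)" "p' = (x', t')" by (metis surj_pair)
  then show ?case using 3 by auto
qed auto

lemma last_start_nonneg:
  assumes "\<And>p q. 0 \<le> ct p q" and "segments_in K ps"
  shows "0 \<le> last_start \<phi> ct ps"
  using assms(2)
proof (induction ps rule: induct_list012)
  case (3 p p' ps)
  obtain x t x' t' where p: "p = (x, t)" "p' = (x', t')" by (metis surj_pair)
  then show ?case using 3 assms(1) by (auto intro!: add_nonneg_nonneg)
qed (auto elim: last_start.elims)

lemma last_start_le:
  assumes "\<And>p q. ct p q \<le> R"
  shows "last_start \<phi> ct (ps @ [(x, t)]) \<le> sum_list (map snd ps) + R * real (length ps)"
proof (induction ps rule: induct_list012)
  case (2 p)
  then show ?case using assms by (cases p) auto
next
  case (3 p p' ps)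
  obtain u v u' v' where p: "p = (u, v)" "p' = (u', v')" by (metis surj_pair)
  then show ?case using 3 assms[of "\<phi> v u" u'] by (auto simp: algebra_simps)
qed auto

lemma tracks_mono: "tracks \<phi> ct \<delta> y ps \<Longrightarrow> \<delta> \<le> \<delta>' \<Longrightarrow> tracks \<phi> ct \<delta>' y ps"
proof (induction ps arbitrary: y rule: induct_list012)
  case (2 p)
  then show ?case by (cases p) (auto intro: order_trans)
next
  case (3 p p' ps)
  then show ?case by (cases p; cases p') (auto intro: order_trans)
qed auto

lemma tracks_perturb:
  assumes "\<And>p q. 0 \<le> ct p q" and "segments_in K ps" and "tracks \<phi> ct \<delta> y ps"
    and "\<And>s. 0 \<le> s \<Longrightarrow> s \<le> last_start \<phi> ct ps + snd (last ps) \<Longrightarrow> dist (\<phi> s z) (\<phi> s y) \<le> \<epsilon>"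
  shows "tracks \<phi> ct (\<delta> + \<epsilon>) z ps"
  using assms(2-)
proof (induction ps arbitrary: y z rule: induct_list012)
  case (2 p)
  obtain x t where p: "p = (x, t)" by (metis surj_pair)
  show ?case
    unfolding p tracks.simps
  proof
    fix s assume "s \<in> {0..t}"
    then have "dist (\<phi> s z) (\<phi> s y) \<le> \<epsilon>" "dist (\<phi> s y) (\<phi> s x) \<le> \<delta>"
      using 2 p by auto
    then show "dist (\<phi> s z) (\<phi> s x) \<le> \<delta> + \<epsilon>"
      using dist_triangle[of "\<phi> s z" "\<phi> s x" "\<phi> s y"] by linarith
  qed
next
  case (3 p p' ps)
  obtain x t x' t' where p: "p = (x, t)" "p' = (x', t')" by (metis surj_pair)
  define c where "c = t + ct (\<phi> t x) x'"
  have c: "0 \<le> t" "t \<le> c" using 3 p assms(1) by (auto simp: c_def)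
  have "segments_in K (p' # ps)" using 3 p by auto
  then have l: "0 \<le> last_start \<phi> ct (p' # ps) + snd (last (p' # ps))"
    using last_in_set[of "p' # ps"]
    by (intro add_nonneg_nonneg last_start_nonneg[OF assms(1)])
      (fastforce simp: segments_in_def)+
  have eq: "last_start \<phi> ct (p # p' # ps) + snd (last (p # p' # ps)) =
      c + (last_start \<phi> ct (p' # ps) + snd (last (p' # ps)))"
    using p by (simp add: c_def)
  have "tracks \<phi> ct (\<delta> + \<epsilon>) (\<phi> c z) (p' # ps)"
  proof (rule "3.IH"(2))
    show "segments_in K (p' # ps)" by fact
    show "tracks \<phi> ct \<delta> (\<phi> c y) (p' # ps)" using 3 p by (auto simp: c_def)
    fix s assume s: "0 \<le> s" "s \<le> last_start \<phi> ct (p' # ps) + snd (last (p' # ps))"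
    show "dist (\<phi> s (\<phi> c z)) (\<phi> s (\<phi> c y)) \<le> \<epsilon>"
      unfolding flow_flow by (rule "3.prems"(3)) (use s c eq in auto)
  qed
  moreover have "dist (\<phi> s z) (\<phi> s x) \<le> \<delta> + \<epsilon>" if "s \<in> {0..t}" for s
  proof -
    have "dist (\<phi> s z) (\<phi> s y) \<le> \<epsilon>"
      using that c l eq by (intro "3.prems"(3)) auto
    moreover have "dist (\<phi> s y) (\<phi> s x) \<le> \<delta>" using 3 p that by auto
    ultimately show ?thesis
      using dist_triangle[of "\<phi> s z" "\<phi> s x" "\<phi> s y"] by linarith
  qed
  ultimately show ?case using p by (auto simp: c_def)
qed auto

lemma tracks_nthI:
  assumes "\<And>i s. i < length ps \<Longrightarrow> 0 \<le> s \<Longrightarrow> s \<le> snd (ps ! i) \<Longrightarrow>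
     dist (\<phi> (s + (\<Sum>j<i. snd (ps ! j))) y) (\<phi> s (fst (ps ! i))) \<le> \<delta>"
  shows "tracks \<phi> (\<lambda>_ _. 0) \<delta> y ps"
  using assms
proof (induction ps arbitrary: y rule: induct_list012)
  case (2 p)
  show ?case using "2"[of 0] by (cases p) auto
next
  case (3 p p' ps)
  obtain x t x' t' where p: "p = (x, t)" "p' = (x', t')" by (metis surj_pair)
  have "tracks \<phi> (\<lambda>_ _. 0) \<delta> (\<phi> t y) (p' # ps)"
  proof (rule "3.IH"(2))
    fix i s assume "i < length (p' # ps)" "0 \<le> s" "s \<le> snd ((p' # ps) ! i)"
    then show "dist (\<phi> (s + (\<Sum>j<i. snd ((p' # ps) ! j))) (\<phi> t y)) (\<phi> s (fst ((p' # ps) ! i))) \<le> \<delta>"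
      using "3.prems"[of "Suc i" s] p
      by (simp add: flow_flow sum.lessThan_Suc_shift algebra_simps del: sum.lessThan_Suc)
  qed
  then show ?case using "3.prems"[of 0] p by auto
qed auto

lemma chain_nthD:
  assumes "chain \<phi> \<eta> ps" "Suc i < length ps"
  shows "dist (\<phi> (snd (ps ! i)) (fst (ps ! i))) (fst (ps ! Suc i)) < \<eta>"
  using assms
proof (induction ps arbitrary: i rule: induct_list012)
  case (3 p p' ps)
  obtain x t x' t' where p: "p = (x, t)" "p' = (x', t')" by (metis surj_pair)
  then show ?case using 3 by (cases i) auto
qed auto

text \<open>Finite exact shadowing, for lists.\<close>

lemma shadowing_list:
  assumes "compact K" "0 < \<delta>" "1 \<le> N"
  obtains \<eta> where "0 < \<eta>" "\<And>ps. \<lbrakk>length ps = N; \<forall>(x, t)\<in>set ps. x \<in> K \<and> 0 \<le> t; chain \<phi> \<eta> ps\<rbrakk> \<Longrightarrow>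
     \<exists>y. tracks \<phi> (\<lambda>_ _. 0) \<delta> y ps"
proof -
  obtain \<eta> where \<eta>: "\<eta> > 0" "\<And>(x :: nat \<Rightarrow> 'a) (t :: nat \<Rightarrow> real).
     \<lbrakk>\<forall>i\<in>{1..N}. x i \<in> K \<and> 0 \<le> t i; \<forall>i\<in>{1..N - 1}. dist (\<phi> (t i) (x i)) (x (i + 1)) < \<eta>\<rbrakk> \<Longrightarrow>
     \<exists>y. \<forall>i\<in>{1..N}. \<forall>s\<in>{0..t i}. dist (\<phi> (s + (\<Sum>j=1..i - 1. t j)) y) (\<phi> s (x i)) < \<delta>"
    using finite_exact_shadowing[OF assms] by blast
  have "\<exists>y. tracks \<phi> (\<lambda>_ _. 0) \<delta> y ps"
    if ps: "length ps = N" "\<forall>(x, t)\<in>set ps. x \<in> K \<and> 0 \<le> t" "chain \<phi> \<eta> ps" for ps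
  proof -
    have inK: "fst (ps ! i) \<in> K \<and> 0 \<le> snd (ps ! i)" if "i < N" for i
      using ps(1,2) that nth_mem[of i ps] by (force simp: case_prod_unfold)
    obtain y where y: "\<forall>i\<in>{1..N}. \<forall>s\<in>{0..snd (ps ! (i - 1))}.
       dist (\<phi> (s + (\<Sum>j=1..i - 1. snd (ps ! (j - 1)))) y) (\<phi> s (fst (ps ! (i - 1)))) < \<delta>"
    proof (rule exE[OF \<eta>(2)[of "\<lambda>i. fst (ps ! (i - 1))" "\<lambda>i. snd (ps ! (i - 1))"]])
      show "\<forall>i\<in>{1..N}. fst (ps ! (i - 1)) \<in> K \<and> 0 \<le> snd (ps ! (i - 1))"
        using inK by auto
      show "\<forall>i\<in>{1..N - 1}. dist (\<phi> (snd (ps ! (i - 1))) (fst (ps ! (i - 1)))) (fst (ps ! (i + 1 - 1))) < \<eta>"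
      proof
        fix i assume "i \<in> {1..N - 1}"
        then show "dist (\<phi> (snd (ps ! (i - 1))) (fst (ps ! (i - 1)))) (fst (ps ! (i + 1 - 1))) < \<eta>"
          using chain_nthD[OF ps(3), of "i - 1"] ps(1) by auto
      qed
    qed auto
    have "tracks \<phi> (\<lambda>_ _. 0) \<delta> y ps"
    proof (rule tracks_nthI)
      fix i s assume i: "i < length ps" "0 \<le> s" "s \<le> snd (ps ! i)"
      have "(\<Sum>j<i. snd (ps ! j)) = (\<Sum>j=1..i. snd (ps ! (j - 1)))"
        by (rule sum.reindex_bij_witness[of _ "\<lambda>j. j - 1" Suc]) auto
      then show "dist (\<phi> (s + (\<Sum>j<i. snd (ps ! j))) y) (\<phi> s (fst (ps ! i))) \<le> \<delta>"
        using y[rule_format, of "Suc i" s] i ps(1) by simp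
    qed
    then show ?thesis by blast
  qed
  then show ?thesis using that \<eta>(1) by blast
qed

text \<open>Connecting segments between the points of a compact set, from transitivity and finite nets.\<close>

lemma connectors:
  assumes "compact K" "0 < \<eta>"
  obtains cp :: "'a \<Rightarrow> 'a \<Rightarrow> 'a" and ct :: "'a \<Rightarrow> 'a \<Rightarrow> real" where
    "finite (range (case_prod ct))" "\<And>p q. 0 \<le> ct p q"
    "\<And>p q. p \<in> K \<Longrightarrow> q \<in> K \<Longrightarrow> dist p (cp p q) < \<eta> \<and> dist (\<phi> (ct p q) (cp p q)) q < \<eta>"
proof -
  obtain D where D: "finite D" "K \<subseteq> (\<Union>x\<in>D. ball x (\<eta> / 2))"
    using assms(2) compact_eq_totally_bounded[THEN iffD1, OF assms(1)] by (meson half_gt_zero)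
  have "\<exists>t u. 0 \<le> t \<and> u \<in> ball x (\<eta> / 2) \<and> \<phi> t u \<in> ball y (\<eta> / 2)" for x y
    using transitivity[of "ball x (\<eta> / 2)" "ball y (\<eta> / 2)" 1] assms(2) by force
  then obtain t u where tu: "\<And>x y. 0 \<le> t x y" "\<And>x y. u x y \<in> ball x (\<eta> / 2)"
      "\<And>x y. \<phi> (t x y) (u x y) \<in> ball y (\<eta> / 2)"
    by metis
  obtain n where n: "\<And>x. x \<in> K \<Longrightarrow> n x \<in> D \<and> dist (n x) x < \<eta> / 2"
    using D(2) unfolding subset_iff UN_iff mem_ball by metis
  define ct where "ct p q = (if p \<in> K \<and> q \<in> K then t (n p) (n q) else 0)" for p q
  define cp where "cp p q = u (n p) (n q)" for p q
  have "range (case_prod ct) \<subseteq> insert 0 (case_prod t ` (D \<times> D))"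
    using n by (force simp: ct_def)
  then have "finite (range (case_prod ct))"
    using D(1) by (auto intro: finite_subset)
  moreover have "dist p (cp p q) < \<eta> \<and> dist (\<phi> (ct p q) (cp p q)) q < \<eta>" if "p \<in> K" "q \<in> K" for p q
  proof -
    have "dist (n p) p < \<eta> / 2" "dist (n q) q < \<eta> / 2" using n that by auto
    moreover have "dist (n p) (cp p q) < \<eta> / 2" "dist (n q) (\<phi> (ct p q) (cp p q)) < \<eta> / 2"
      using tu that by (auto simp: ct_def cp_def)
    ultimately show ?thesis
      using dist_triangle3[of p "cp p q" "n p"] dist_triangle3[of "\<phi> (ct p q) (cp p q)" q "n q"] by linarith
  qed
  moreover have "0 \<le> ct p q" for p q using tu(1) by (simp add: ct_def)
  ultimately show ?thesis using that by blast
qed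

text \<open>Segments that start and end in a compact set can be followed one after the other, with
  connecting times that take finitely many values and only depend on the end points to be connected.\<close>

lemma open_gluing:
  assumes "compact K" "0 < \<delta>" "1 \<le> N"
  obtains ct :: "'a \<Rightarrow> 'a \<Rightarrow> real" where
    "finite (range (case_prod ct))" "\<And>p q. 0 \<le> ct p q"
    "\<And>ps. length ps = N \<Longrightarrow> segments_in K ps \<Longrightarrow> \<exists>y. tracks \<phi> ct \<delta> y ps"
proof -
  obtain r K' where K': "0 < r" "compact K'" "\<And>x. x \<in> K \<Longrightarrow> ball x r \<subseteq> K'"
    using compact_nbhd[OF assms(1)] by metis
  have sub: "K \<subseteq> K'" using K'(1,3) centre_in_ball by blast
  have N: "1 \<le> 2 * N - 1" using assms(3) by simp
  obtain \<eta> where \<eta>: "0 < \<eta>" "\<And>ps. \<lbrakk>length ps = 2 * N - 1; \<forall>(x, t)\<in>set ps. x \<in> K' \<and> 0 \<le> t; chain \<phi> \<eta> ps\<rbrakk> \<Longrightarrow>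
     \<exists>y. tracks \<phi> (\<lambda>_ _. 0) \<delta> y ps"
    using shadowing_list[OF K'(2) assms(2) N] by metis
  have m: "0 < min \<eta> r" using \<eta>(1) K'(1) by simp
  obtain cp ct where c: "finite (range (case_prod ct))" "\<And>p q. 0 \<le> ct p q"
    "\<And>p q. p \<in> K \<Longrightarrow> q \<in> K \<Longrightarrow> dist p (cp p q) < min \<eta> r \<and> dist (\<phi> (ct p q) (cp p q)) q < min \<eta> r"
    using connectors[OF assms(1) m] by metis
  have "\<exists>y. tracks \<phi> ct \<delta> y ps" if ps: "length ps = N" "segments_in K ps" for ps
  proof -
    have "\<exists>y. tracks \<phi> (\<lambda>_ _. 0) \<delta> y (link \<phi> cp ct ps)"
    proof (rule \<eta>(2))
      show "length (link \<phi> cp ct ps) = 2 * N - 1" by (simp add: length_link ps)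
      show "\<forall>(x, t)\<in>set (link \<phi> cp ct ps). x \<in> K' \<and> 0 \<le> t"
        using c K' by (intro link_in[OF _ sub ps(2)]) (auto simp: subset_iff)
      show "chain \<phi> \<eta> (link \<phi> cp ct ps)"
        using c(3) by (intro chain_link[OF _ ps(2)]) auto
    qed
    then show ?thesis using tracks_link by blast
  qed
  then show ?thesis using that c by blast
qed

text \<open>The constants of the closing lemma can be chosen uniformly on a compact set.\<close>

lemma uniform_closing:
  assumes "compact K" "0 < \<epsilon>"
  obtains \<delta> T where "0 < \<delta>" "0 < T"
    "\<And>x y t. \<lbrakk>x \<in> K; dist x y < \<epsilon> / 2; T \<le> t; dist (\<phi> t y) y \<le> \<delta>\<rbrakk> \<Longrightarrow>
       \<exists>z \<tau>. dist y z < \<epsilon> \<and> t - \<epsilon> \<le> \<tau> \<and> \<tau> \<le> t + \<epsilon> \<and> \<phi> \<tau> z = z \<and> (\<forall>s\<in>{0..t}. dist (\<phi> s z) (\<phi> s y) \<le> \<epsilon>)"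
proof -
  obtain d T where dT: "\<And>x::'a. d x > 0" "\<And>x::'a. T x > 0"
    "\<And>x y t. \<lbrakk>y \<in> ball x \<epsilon>; T x \<le> t; dist (\<phi> t y) y \<le> d x\<rbrakk> \<Longrightarrow>
       \<exists>z\<in>ball y \<epsilon>. \<exists>\<tau>\<in>{t - \<epsilon>..t + \<epsilon>}. \<phi> \<tau> z = z \<and> (\<forall>s\<in>{0..t}. dist (\<phi> s z) (\<phi> s y) \<le> \<epsilon>)"
    using closing_lemma[OF assms(2)] by metis
  obtain D where D: "finite D" "K \<subseteq> (\<Union>x\<in>D. ball x (\<epsilon> / 2))"
    using assms(2) compact_eq_totally_bounded[THEN iffD1, OF assms(1)] by (meson half_gt_zero)
  define d0 where "d0 = Min (insert 1 (d ` D))"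
  define T0 where "T0 = Max (insert 1 (T ` D))"
  have "0 < d0" unfolding d0_def using D(1) dT(1) by (subst Min_gr_iff) auto
  have d0: "d0 \<le> d x" if "x \<in> D" for x
    unfolding d0_def by (rule Min_le) (use D(1) that in auto)
  have "1 \<le> T0" unfolding T0_def by (rule Max_ge) (use D(1) in auto)
  have T0: "T x \<le> T0" if "x \<in> D" for x
    unfolding T0_def by (rule Max_ge) (use D(1) that in auto)
  show ?thesis
  proof (rule that)
    show "0 < d0" "0 < T0" using \<open>0 < d0\<close> \<open>1 \<le> T0\<close> by auto
    fix x y t assume *: "x \<in> K" "dist x y < \<epsilon> / 2" "T0 \<le> t" "dist (\<phi> t y) y \<le> d0"
    obtain c where c: "c \<in> D" "dist c x < \<epsilon> / 2" using D(2) *(1) by auto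
    have "y \<in> ball c \<epsilon>" using c(2) *(2) dist_triangle[of c y x] by simp
    then obtain z \<tau> where "z \<in> ball y \<epsilon>" "\<tau> \<in> {t - \<epsilon>..t + \<epsilon>}" "\<phi> \<tau> z = z"
        "\<forall>s\<in>{0..t}. dist (\<phi> s z) (\<phi> s y) \<le> \<epsilon>"
      using dT(3)[of y c t] * T0[OF c(1)] d0[OF c(1)] by force
    then show "\<exists>z \<tau>. dist y z < \<epsilon> \<and> t - \<epsilon> \<le> \<tau> \<and> \<tau> \<le> t + \<epsilon> \<and> \<phi> \<tau> z = z \<and>
        (\<forall>s\<in>{0..t}. dist (\<phi> s z) (\<phi> s y) \<le> \<epsilon>)"
      by auto
  qed
qed

text \<open>Periodic points are dense.\<close>

lemma periodic_point_near:
  assumes "0 < \<epsilon>"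
  obtains z T where "dist x z < \<epsilon>" "1 \<le> T" "\<phi> T z = z"
proof -
  obtain \<delta> T where dT: "0 < \<delta>" "0 < T" "\<And>y t. \<lbrakk>dist x y < \<epsilon> / 4; T \<le> t; dist (\<phi> t y) y \<le> \<delta>\<rbrakk> \<Longrightarrow>
       \<exists>z \<tau>. dist y z < \<epsilon> / 2 \<and> t - \<epsilon> / 2 \<le> \<tau> \<and> \<phi> \<tau> z = z"
    using uniform_closing[of "{x}" "\<epsilon> / 2"] assms by simp metis
  define r where "r = min (\<epsilon> / 4) (\<delta> / 2)"
  have "0 < r" using assms dT(1) by (simp add: r_def)
  then obtain t where "T + \<epsilon> + 1 \<le> t" "\<phi> t ` ball x r \<inter> ball x r \<noteq> {}"
    using transitivity[of "ball x r" "ball x r" "T + \<epsilon> + 1"] assms dT(2) by auto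
  then obtain y where y: "dist x y < r" "dist x (\<phi> t y) < r" by auto
  have "dist (\<phi> t y) y \<le> \<delta>" using y dist_triangle3[of "\<phi> t y" y x] by (simp add: r_def)
  then obtain z \<tau> where z: "dist y z < \<epsilon> / 2" "t - \<epsilon> / 2 \<le> \<tau>" "\<phi> \<tau> z = z"
    using dT(3)[of y t] y \<open>T + \<epsilon> + 1 \<le> t\<close> assms by (auto simp: r_def)
  show ?thesis
  proof (rule that[of z \<tau>])
    show "dist x z < \<epsilon>" using z(1) y(1) dist_triangle[of x z y] assms by (simp add: r_def)
    show "1 \<le> \<tau>" using z(2) \<open>T + \<epsilon> + 1 \<le> t\<close> assms dT(2) by simp
  qed fact
qed

text \<open>There are periods close to the infimum that defines \<open>tau_K\<close>.\<close>

lemma tau_K_approx: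
  assumes "interior K\<^sub>0 \<noteq> {}"
  shows "1 \<le> tau_K \<phi> K\<^sub>0"
    and "\<exists>z T. z \<in> K\<^sub>0 \<and> \<phi> T z = z \<and> tau_K \<phi> K\<^sub>0 \<le> T \<and> T < 2 * tau_K \<phi> K\<^sub>0"
proof -
  define S where "S = {snd \<gamma> |\<gamma>. \<gamma> \<in> periodic_orbits \<phi> \<and> 1 \<le> snd \<gamma> \<and> fst \<gamma> \<inter> K\<^sub>0 \<noteq> {}}"
  have tau: "tau_K \<phi> K\<^sub>0 = Inf S" by (simp add: tau_K_def S_def)
  obtain x where "x \<in> interior K\<^sub>0" using assms by auto
  then obtain e where e: "0 < e" "ball x e \<subseteq> K\<^sub>0" using mem_interior by blast
  obtain z T where z: "dist x z < e" "1 \<le> T" "\<phi> T z = z" using periodic_point_near[OF e(1)] by metis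
  have "(orbit z, T) \<in> periodic_orbits \<phi>" using z by (force simp: periodic_orbits_def)
  moreover have "z \<in> orbit z \<inter> K\<^sub>0" using e z orbit_self by auto
  ultimately have "T \<in> S" using z by (force simp: S_def)
  then have ne: "S \<noteq> {}" by auto
  show ge: "1 \<le> tau_K \<phi> K\<^sub>0"
    unfolding tau using ne by (rule cInf_greatest) (auto simp: S_def)
  have bdd: "bdd_below S" by (rule bdd_belowI[of _ 1]) (auto simp: S_def)
  have "Inf S < 2 * tau_K \<phi> K\<^sub>0" using ge tau by simp
  then obtain T' where T': "T' \<in> S" "T' < 2 * tau_K \<phi> K\<^sub>0"
    using cInf_lessD[OF ne] by metis
  then obtain \<gamma> where \<gamma>: "\<gamma> \<in> periodic_orbits \<phi>" "snd \<gamma> = T'" "fst \<gamma> \<inter> K\<^sub>0 \<noteq> {}"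
    unfolding S_def by blast
  obtain y where y: "fst \<gamma> = orbit y" "\<phi> T' y = y" using \<gamma>(1,2) by (auto simp: periodic_orbits_def)
  then obtain s where "\<phi> s y \<in> K\<^sub>0" using \<gamma>(3) by auto
  moreover have "\<phi> T' (\<phi> s y) = \<phi> s y" using y(2) by (rule flow_period_shift)
  moreover have "tau_K \<phi> K\<^sub>0 \<le> T'" unfolding tau using T'(1) bdd by (rule cInf_lower)
  ultimately show "\<exists>z T. z \<in> K\<^sub>0 \<and> \<phi> T z = z \<and> tau_K \<phi> K\<^sub>0 \<le> T \<and> T < 2 * tau_K \<phi> K\<^sub>0"
    using T'(2) by blast
qed

text \<open>Closed gluing: segments of total duration at most \<open>L - R\<close> are tracked by a periodic orbit
  through \<open>K\<^sub>0\<close> with period in \<open>[L, L + 5 \<tau>]\<close>. After the given segments the orbit turns around a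
  periodic orbit of period less than \<open>2 \<tau>\<close> often enough to reach the window, and then passes near an
  interior point of \<open>K\<^sub>0\<close>.\<close>

lemma closed_gluing:
  assumes "compact K\<^sub>0" "interior K\<^sub>0 \<noteq> {}" "compact K" "0 < \<delta>" "1 \<le> N"
  obtains ct :: "'a \<Rightarrow> 'a \<Rightarrow> real" and R where
    "finite (range (case_prod ct))" "\<And>p q. 0 \<le> ct p q" "\<And>p q. ct p q \<le> R" "0 < R"
    "\<And>ps L. \<lbrakk>length ps = N; segments_in K ps; sum_list (map snd ps) + R \<le> L\<rbrakk> \<Longrightarrow>
       \<exists>y l. \<phi> l y = y \<and> L \<le> l \<and> l \<le> L + 5 * tau_K \<phi> K\<^sub>0 \<and> orbit y \<inter> K\<^sub>0 \<noteq> {} \<and> tracks \<phi> ct \<delta> y ps"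
proof -
  define \<tau> where "\<tau> = tau_K \<phi> K\<^sub>0"
  obtain p \<tau>' where p: "p \<in> K\<^sub>0" "\<phi> \<tau>' p = p" "\<tau> \<le> \<tau>'" "\<tau>' < 2 * \<tau>"
    using tau_K_approx(2)[OF assms(2)] \<tau>_def by metis
  have \<tau>: "1 \<le> \<tau>" using tau_K_approx(1)[OF assms(2)] \<tau>_def by metis
  obtain c where "c \<in> interior K\<^sub>0" using assms(2) by auto
  then obtain r where r: "0 < r" "ball c r \<subseteq> K\<^sub>0" using mem_interior by blast
  have c: "c \<in> K\<^sub>0" using r by auto
  define \<epsilon> where "\<epsilon> = min (\<delta> / 2) (min (r / 4) 1)"
  have \<epsilon>: "0 < \<epsilon>" "\<epsilon> \<le> \<delta> / 2" "\<epsilon> \<le> r / 4" "\<epsilon> \<le> 1" using assms(4) r(1) by (auto simp: \<epsilon>_def)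
  have K': "compact (K \<union> K\<^sub>0)" using assms by auto
  obtain \<delta>c Tc where cl: "0 < \<delta>c" "0 < Tc"
    "\<And>x y t. \<lbrakk>x \<in> K \<union> K\<^sub>0; dist x y < \<epsilon> / 2; Tc \<le> t; dist (\<phi> t y) y \<le> \<delta>c\<rbrakk> \<Longrightarrow>
       \<exists>z l. dist y z < \<epsilon> \<and> t - \<epsilon> \<le> l \<and> l \<le> t + \<epsilon> \<and> \<phi> l z = z \<and> (\<forall>s\<in>{0..t}. dist (\<phi> s z) (\<phi> s y) \<le> \<epsilon>)"
    using uniform_closing[OF K' \<epsilon>(1)] by metis
  define \<delta>' where "\<delta>' = min (\<epsilon> / 4) (\<delta>c / 2)"
  have \<delta>': "0 < \<delta>'" "\<delta>' \<le> \<epsilon> / 4" "\<delta>' \<le> \<delta>c / 2" using cl(1) \<epsilon>(1) by (auto simp: \<delta>'_def)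
  have N: "1 \<le> N + 3" by simp
  obtain ct where ct: "finite (range (case_prod ct))" "\<And>p q. 0 \<le> ct p q"
    "\<And>ps. length ps = N + 3 \<Longrightarrow> segments_in (K \<union> K\<^sub>0) ps \<Longrightarrow> \<exists>y. tracks \<phi> ct \<delta>' y ps"
    using open_gluing[OF K' \<delta>'(1) N] by metis
  define B where "B = Max (range (case_prod ct))"
  have B: "ct p q \<le> B" for p q unfolding B_def using ct(1) by (intro Max_ge) auto
  have "0 \<le> B" using ct(2)[of c c] B[of c c] by linarith
  define R where "R = B * real (N + 3) + Tc + B + 1"
  have R: "0 < R" "B \<le> R" "Tc \<le> R" "B * real (N + 2) \<le> R"
  proof -
    have "0 \<le> B * real N" using \<open>0 \<le> B\<close> by simp
    moreover have "R = B * real N + 4 * B + Tc + 1" "B * real (N + 2) = B * real N + 2 * B"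
      by (simp_all add: R_def algebra_simps)
    ultimately show "0 < R" "B \<le> R" "Tc \<le> R" "B * real (N + 2) \<le> R"
      using \<open>0 \<le> B\<close> cl(2) by linarith+
  qed
  have glue: "\<exists>y l. \<phi> l y = y \<and> L \<le> l \<and> l \<le> L + 5 * \<tau> \<and> orbit y \<inter> K\<^sub>0 \<noteq> {} \<and> tracks \<phi> ct \<delta> y ps"
    if ps: "length ps = N" "segments_in K ps" and L: "sum_list (map snd ps) + R \<le> L" for ps L
  proof -
    obtain x t qs where x: "ps = (x, t) # qs" using ps(1) assms(5) by (cases ps) auto
    have xK: "x \<in> K" using ps(2) x by auto
    \<comment> \<open>The time that the glued orbit takes without the turns around the short periodic orbit.\<close>
    define base where "base = last_start \<phi> ct (ps @ [(p, 0)]) + ct p c + ct c x"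
    have "base \<le> (sum_list (map snd ps) + B * real N) + B + B"
      unfolding base_def using last_start_le[where ct = ct and R = B, OF B, of ps p 0] B[of p c] B[of c x]
      by (simp add: ps(1))
    then have base: "base \<le> L" using L R(4) by (simp add: algebra_simps)
    define n where "n = nat \<lceil>(L + 1 - base) / \<tau>'\<rceil>"
    have n: "(L + 1 - base) / \<tau>' \<le> real n" "real n < (L + 1 - base) / \<tau>' + 1"
    proof -
      have "0 \<le> (L + 1 - base) / \<tau>'" using base p \<tau> by simp
      then show "(L + 1 - base) / \<tau>' \<le> real n" "real n < (L + 1 - base) / \<tau>' + 1"
        unfolding n_def by linarith+
    qed
    define tot where "tot = base + real n * \<tau>'"
    have tot: "L + 1 \<le> tot" "tot \<le> L + 1 + 2 * \<tau>"
      using n p \<tau> by (auto simp: tot_def field_simps)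
    have pn: "\<phi> (real n * \<tau>') p = p" using p(2) by (rule flow_period_of_nat)
    define ps' where "ps' = ps @ [(p, real n * \<tau>'), (c, 0), (x, 0)]"
    have ps': "length ps' = N + 3" "segments_in (K \<union> K\<^sub>0) ps'"
      using ps p c pn xK \<tau> by (auto simp: ps'_def segments_in_def)
    have ls1: "last_start \<phi> ct (ps @ [(p, s)]) = last_start \<phi> ct (ps @ [(p, 0)])" for s
    proof (induction ps rule: induct_list012)
      case (2 p)
      then show ?case by (cases p) auto
    next
      case (3 p p' ps)
      then show ?case by (cases p; cases p') auto
    qed auto
    have ls2: "last_start \<phi> ct (ps @ [(p, real n * \<tau>'), (c, 0)]) =
        last_start \<phi> ct (ps @ [(p, 0)]) + real n * \<tau>' + ct p c"
      using ls1 last_start_append[of ct ps p "real n * \<tau>'" c 0] pn by simp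
    have ls3: "last_start \<phi> ct ps' = tot"
      using ls2 last_start_append[of ct "ps @ [(p, real n * \<tau>')]" c 0 x 0]
      by (simp add: ps'_def tot_def base_def)
    obtain y where y: "tracks \<phi> ct \<delta>' y ps'" using ct(3)[OF ps'] by blast
    have yx: "dist y x \<le> \<delta>'"
      using y ps(2) by (cases qs) (auto simp: ps'_def x dest!: bspec[of _ _ 0])
    have "dist (\<phi> tot y) x \<le> \<delta>'"
      using tracks_last[of ct \<delta>' y "ps @ [(p, real n * \<tau>'), (c, 0)]" x 0] y ls3 by (simp add: ps'_def)
    then have "dist (\<phi> tot y) y \<le> \<delta>c"
      using yx dist_triangle2[of "\<phi> tot y" y x] \<delta>' by linarith
    moreover have "dist x y < \<epsilon> / 2" using yx \<delta>' \<epsilon>(1) by (simp add: dist_commute)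
    moreover have "0 \<le> sum_list (map snd ps)"
      using ps(2) by (intro sum_list_nonneg) (auto simp: segments_in_def)
    then have "Tc \<le> tot" using tot L R by linarith
    ultimately obtain z l where z: "tot - \<epsilon> \<le> l" "l \<le> tot + \<epsilon>" "\<phi> l z = z"
        "\<forall>s\<in>{0..tot}. dist (\<phi> s z) (\<phi> s y) \<le> \<epsilon>"
      using cl(3)[of x y tot] xK by blast
    have tz: "tracks \<phi> ct (\<delta>' + \<epsilon>) z ps'"
      by (rule tracks_perturb[OF ct(2) ps'(2) y]) (use z(4) ls3 in \<open>auto simp: ps'_def\<close>)
    have "tracks \<phi> ct (\<delta>' + \<epsilon>) z (ps @ [(p, real n * \<tau>'), (c, 0)])"
      using tz tracks_appendD[of ct "\<delta>' + \<epsilon>" z "ps @ [(p, real n * \<tau>'), (c, 0)]" "[(x, 0)]"] by (simp add: ps'_def)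
    then have "dist (\<phi> (last_start \<phi> ct (ps @ [(p, real n * \<tau>'), (c, 0)])) z) c \<le> \<delta>' + \<epsilon>"
      using tracks_last[of ct "\<delta>' + \<epsilon>" z "ps @ [(p, real n * \<tau>')]" c 0] by simp
    then have "dist c (\<phi> (last_start \<phi> ct (ps @ [(p, real n * \<tau>'), (c, 0)])) z) < r"
      using \<delta>' \<epsilon> r(1) by (simp add: dist_commute)
    then have "orbit z \<inter> K\<^sub>0 \<noteq> {}" using r(2) by (auto simp: subset_iff)
    moreover have "tracks \<phi> ct (\<delta>' + \<epsilon>) z ps"
      using tz unfolding ps'_def by (rule tracks_appendD)
    then have "tracks \<phi> ct \<delta> z ps" by (rule tracks_mono) (use \<delta>' \<epsilon> in linarith)
    moreover have "L \<le> l" "l \<le> L + 5 * \<tau>" using z tot \<epsilon> \<tau> by linarith+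
    ultimately show ?thesis using z(3) by blast
  qed
  show ?thesis
    by (rule that[OF ct(1,2) _ R(1) glue[unfolded \<tau>_def]]) (use B R(2) in \<open>auto intro: order_trans\<close>)
qed

end

section \<open>Counting periodic orbits\<close>

lemma card_le_by_relation:
  assumes "finite B" "\<And>x. x \<in> A \<Longrightarrow> \<exists>y\<in>B. R x y"
    and "\<And>x x' y. \<lbrakk>x \<in> A; x' \<in> A; y \<in> B; R x y; R x' y\<rbrakk> \<Longrightarrow> x = x'"
  shows "card A \<le> card B"
proof -
  obtain f where f: "\<And>x. x \<in> A \<Longrightarrow> f x \<in> B \<and> R x (f x)" using assms(2) by metis
  have "inj_on f A" using f assms(3) by (metis inj_onI)
  then show ?thesis using f assms(1) by (intro card_inj_on_le[of f]) auto
qed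

text \<open>The points of \<open>X\<close> are covered by those of a maximal set of pairwise \<open>R\<close>-related points, by Zorn.\<close>

lemma maximal_separated_set:
  assumes "\<And>x y. R x y \<Longrightarrow> R y x"
  obtains S where "S \<subseteq> X" "\<And>x y. x \<in> S \<Longrightarrow> y \<in> S \<Longrightarrow> x \<noteq> y \<Longrightarrow> R x y"
    "\<And>x. x \<in> X \<Longrightarrow> \<exists>s\<in>S. x = s \<or> \<not> R x s"
proof -
  define Z where "Z = {S. S \<subseteq> X \<and> (\<forall>x\<in>S. \<forall>y\<in>S. x \<noteq> y \<longrightarrow> R x y)}"
  have "\<exists>M\<in>Z. \<forall>S\<in>Z. M \<subseteq> S \<longrightarrow> S = M"
  proof (rule subset_Zorn')
    fix C assume C: "subset.chain Z C"
    show "\<Union>C \<in> Z"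
      unfolding Z_def mem_Collect_eq
    proof (intro conjI ballI impI)
      show "\<Union>C \<subseteq> X" using C by (auto simp: subset_chain_def Z_def)
      fix x y assume xy: "x \<in> \<Union>C" "y \<in> \<Union>C" "x \<noteq> y"
      then obtain A B where "A \<in> C" "B \<in> C" "x \<in> A" "y \<in> B" by auto
      moreover from this have "A \<subseteq> B \<or> B \<subseteq> A" using C by (auto simp: subset_chain_def)
      ultimately obtain D where "D \<in> C" "x \<in> D" "y \<in> D" by blast
      then show "R x y" using C xy(3) by (auto simp: subset_chain_def Z_def)
    qed
  qed
  then obtain M where M: "M \<in> Z" "\<And>S. S \<in> Z \<Longrightarrow> M \<subseteq> S \<Longrightarrow> S = M" by blast
  have "\<exists>s\<in>M. x = s \<or> \<not> R x s" if "x \<in> X" for x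
  proof (rule ccontr)
    assume "\<not> ?thesis"
    then have "insert x M \<in> Z" "x \<notin> M" using M(1) that assms by (auto simp: Z_def)
    then show False using M(2) by blast
  qed
  then show ?thesis using that[of M] M(1) by (auto simp: Z_def)
qed

text \<open>Sets of times are discretised by maximal separated subsets.\<close>

lemma separated_times:
  fixes A :: "real set"
  assumes "A \<subseteq> {0..l}" "0 < \<kappa>"
  shows "\<exists>S. finite S \<and> S \<subseteq> A \<and> (\<forall>s\<in>S. \<forall>s'\<in>S. \<bar>s - s'\<bar> < \<kappa> \<longrightarrow> s = s') \<and>
    (\<forall>a\<in>A. \<exists>s\<in>S. \<bar>a - s\<bar> < \<kappa>)"
proof -
  obtain S where S: "S \<subseteq> A" "\<And>x y. x \<in> S \<Longrightarrow> y \<in> S \<Longrightarrow> x \<noteq> y \<Longrightarrow> \<kappa> \<le> \<bar>x - y\<bar>"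
    "\<And>x. x \<in> A \<Longrightarrow> \<exists>s\<in>S. x = s \<or> \<not> \<kappa> \<le> \<bar>x - s\<bar>"
    by (rule maximal_separated_set[of "\<lambda>x y. \<kappa> \<le> \<bar>x - y\<bar>" A]) (auto simp: abs_minus_commute)
  have "inj_on (\<lambda>s. \<lfloor>s / \<kappa>\<rfloor>) S"
  proof (rule inj_onI, rule ccontr)
    fix x y assume *: "x \<in> S" "y \<in> S" "\<lfloor>x / \<kappa>\<rfloor> = \<lfloor>y / \<kappa>\<rfloor>" "x \<noteq> y"
    have "\<bar>x / \<kappa> - y / \<kappa>\<bar> < 1" using *(3) by linarith
    then have "\<bar>x - y\<bar> < \<kappa>" using assms(2) by (simp add: diff_divide_distrib[symmetric] abs_divide)
    then show False using S(2) * by fastforce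
  qed
  moreover have "(\<lambda>s. \<lfloor>s / \<kappa>\<rfloor>) ` S \<subseteq> {0..\<lfloor>l / \<kappa>\<rfloor>}"
  proof
    fix k assume "k \<in> (\<lambda>s. \<lfloor>s / \<kappa>\<rfloor>) ` S"
    then obtain s where "k = \<lfloor>s / \<kappa>\<rfloor>" "0 \<le> s" "s \<le> l" using S(1) assms(1) by force
    then show "k \<in> {0..\<lfloor>l / \<kappa>\<rfloor>}" using assms(2) by (auto intro!: floor_mono divide_right_mono)
  qed
  ultimately have "finite S" by (meson finite_atLeastAtMost_int finite_imageD finite_subset)
  moreover have "s = s'" if "s \<in> S" "s' \<in> S" "\<bar>s - s'\<bar> < \<kappa>" for s s' using S(2)[of s s'] that by fastforce
  moreover have "\<exists>s\<in>S. \<bar>a - s\<bar> < \<kappa>" if "a \<in> A" for a using S(3)[OF that] assms(2) by force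
  ultimately show ?thesis using S(1) by (intro exI[of _ S]) simp
qed

lemma fmeasurable_interval [simp]:
  "{a..b::real} \<in> fmeasurable lborel" "{a<..<b::real} \<in> fmeasurable lborel"
  by (cases "a \<le> b"; auto intro: fmeasurableI)+

lemma measure_le_card_net:
  assumes "finite S" "A \<in> sets lborel" "\<And>a. a \<in> A \<Longrightarrow> \<exists>s\<in>S. \<bar>a - s\<bar> < \<kappa>" "0 \<le> \<kappa>"
  shows "measure lborel A \<le> 2 * \<kappa> * real (card S)"
proof -
  have fin: "(\<Union>s\<in>S. {s - \<kappa>..s + \<kappa>}) \<in> fmeasurable lborel"
    using assms(1) by (intro fmeasurable.finite_UN) auto
  have "measure lborel A \<le> measure lborel (\<Union>s\<in>S. {s - \<kappa>..s + \<kappa>})"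
    using assms(2,3) by (intro measure_mono_fmeasurable[OF _ _ fin]) (force simp: abs_less_iff)+
  also have "\<dots> \<le> (\<Sum>s\<in>S. measure lborel {s - \<kappa>..s + \<kappa>})"
    using assms(1) by (intro measure_UNION_le) auto
  also have "\<dots> = 2 * \<kappa> * real (card S)" using assms(4) by simp
  finally show ?thesis .
qed

lemma card_separated_le_measure:
  assumes "finite S" "S \<subseteq> {0..l}" "\<And>s s'. s \<in> S \<Longrightarrow> s' \<in> S \<Longrightarrow> \<bar>s - s'\<bar> < \<kappa> \<Longrightarrow> s = s'"
    and "0 < \<kappa>" "\<kappa> \<le> l" "A \<in> sets lborel" "A \<subseteq> {0..l}"
    and "\<And>s t. s \<in> S \<Longrightarrow> t \<in> {0..l} \<Longrightarrow> \<bar>t - s\<bar> < \<kappa> / 2 \<Longrightarrow> t \<in> A"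
  shows "real (card S) * (\<kappa> / 2) \<le> measure lborel A"
proof -
  define I where "I s = (if s \<le> l - \<kappa> / 2 then {s<..<s + \<kappa> / 2} else {s - \<kappa> / 2<..<s})" for s
  have I: "I s \<subseteq> {0..l}" "\<And>t. t \<in> I s \<Longrightarrow> \<bar>t - s\<bar> < \<kappa> / 2" if "s \<in> S" for s
    using that assms(2,4,5) unfolding I_def by (auto split: if_splits)
  have m: "measure lborel (I s) = \<kappa> / 2" "I s \<in> fmeasurable lborel" for s
    using assms(4) by (auto simp: I_def)
  have "disjoint_family_on I S"
    unfolding disjoint_family_on_def
  proof (intro ballI impI equals0I)
    fix s s' t assume "s \<in> S" "s' \<in> S" "s \<noteq> s'" "t \<in> I s \<inter> I s'"
    then have "\<bar>t - s\<bar> < \<kappa> / 2" "\<bar>t - s'\<bar> < \<kappa> / 2" using I(2) by auto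
    then have "\<bar>s - s'\<bar> < \<kappa>" by linarith
    then show False using assms(3) \<open>s \<in> S\<close> \<open>s' \<in> S\<close> \<open>s \<noteq> s'\<close> by blast
  qed
  then have "measure lborel (\<Union>s\<in>S. I s) = (\<Sum>s\<in>S. measure lborel (I s))"
    using assms(1) m(2) by (intro measure_finite_Union) (auto simp: fmeasurable_def less_top)
  then have "real (card S) * (\<kappa> / 2) = measure lborel (\<Union>s\<in>S. I s)" by (simp add: m)
  also have "\<dots> \<le> measure lborel A"
  proof (rule measure_mono_fmeasurable)
    show "A \<in> fmeasurable lborel"
      by (rule fmeasurableI2[of "{0..l}"]) (use assms(6,7) in auto)
    show "(\<Union>s\<in>S. I s) \<subseteq> A" using I assms(8) by blast
    show "(\<Union>s\<in>S. I s) \<in> sets lborel" using fmeasurableD[OF m(2)] assms(1) by (intro sets.finite_UN) auto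
  qed
  finally show ?thesis .
qed

text \<open>The code of a real number up to an error less than \<open>\<kappa>\<close>.\<close>

definition bin :: "real \<Rightarrow> real \<Rightarrow> nat" where
  "bin \<kappa> v = nat \<lfloor>v / \<kappa>\<rfloor>"

lemma bin_le: "0 < \<kappa> \<Longrightarrow> v \<le> V \<Longrightarrow> bin \<kappa> v \<le> bin \<kappa> V"
  unfolding bin_def by (intro nat_mono floor_mono divide_right_mono) auto

lemma bin_eqD:
  assumes "bin \<kappa> v = bin \<kappa> v'" "0 < \<kappa>" "0 \<le> v" "0 \<le> v'"
  shows "\<bar>v - v'\<bar> < \<kappa>"
proof -
  have "0 \<le> \<lfloor>v / \<kappa>\<rfloor>" "0 \<le> \<lfloor>v' / \<kappa>\<rfloor>" using assms by auto
  then have "\<lfloor>v / \<kappa>\<rfloor> = \<lfloor>v' / \<kappa>\<rfloor>" using assms(1) unfolding bin_def by linarith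
  then have "\<bar>v / \<kappa> - v' / \<kappa>\<bar> < 1" by linarith
  then show ?thesis using assms(2) by (simp add: diff_divide_distrib[symmetric] abs_divide)
qed

text \<open>A resolution \<open>\<kappa>\<close> that is fine compared with finitely many scales.\<close>

lemma fine_scale:
  fixes b e m p :: real
  assumes "0 < b" "0 < e" "0 < m" "0 < p"
  obtains \<kappa> where "0 < \<kappa>" "\<kappa> \<le> 1" "\<kappa> \<le> p" "\<kappa> \<le> e" "b * \<kappa> \<le> m / 8"
proof (rule that[of "min (min 1 p) (min e (m / (8 * b)))"])
  have "b * min (min 1 p) (min e (m / (8 * b))) \<le> b * (m / (8 * b))"
    using assms(1) by (intro mult_left_mono) auto
  then show "b * min (min 1 p) (min e (m / (8 * b))) \<le> m / 8" using assms(1) by simp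
qed (use assms in auto)

lemma dist_triangle_four:
  fixes a b c d :: "'b::metric_space"
  assumes "dist a b \<le> x" "dist b c \<le> y" "dist c d \<le> z"
  shows "dist a d \<le> x + y + z"
  using assms dist_triangle[of a d b] dist_triangle[of b d c] by linarith

context H_flow
begin

text \<open>The base point from which time is counted on a periodic orbit.\<close>

definition pt :: "'a set \<times> real \<Rightarrow> 'a" where
  "pt \<gamma> = (SOME x. x \<in> fst \<gamma>)"

text \<open>The time that a periodic orbit spends in \<open>A\<close> during its period \<open>snd \<gamma>\<close>; for a multiply covered
  orbit every turn counts.\<close>

definition occ :: "'a set \<times> real \<Rightarrow> 'a set \<Rightarrow> real" where
  "occ \<gamma> A = measure lborel {t\<in>{0..snd \<gamma>}. \<phi> t (pt \<gamma>) \<in> A}"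

text \<open>The period is the least one, so that the orbit is covered once.\<close>

definition primitive :: "'a set \<times> real \<Rightarrow> bool" where
  "primitive \<gamma> \<longleftrightarrow> (\<forall>t. 0 < t \<and> t < snd \<gamma> \<longrightarrow> \<phi> t (pt \<gamma>) \<noteq> pt \<gamma>)"

lemma periodic_orbitsI: "\<phi> l y = y \<Longrightarrow> 0 < l \<Longrightarrow> (orbit y, l) \<in> periodic_orbits \<phi>"
  by (auto simp: periodic_orbits_def)

lemma periodic_orbitsD:
  assumes "\<gamma> \<in> periodic_orbits \<phi>"
  shows "fst \<gamma> = orbit (pt \<gamma>)" "\<phi> (snd \<gamma>) (pt \<gamma>) = pt \<gamma>" "0 < snd \<gamma>"
proof -
  obtain x T where x: "\<gamma> = (orbit x, T)" "0 < T" "\<phi> T x = x" using assms by (auto simp: periodic_orbits_def)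
  have "pt \<gamma> \<in> fst \<gamma>" unfolding pt_def by (rule someI[of _ x]) (simp add: x orbit_self)
  then obtain s where s: "pt \<gamma> = \<phi> s x" using x by auto
  show "fst \<gamma> = orbit (pt \<gamma>)" unfolding s orbit_eq by (simp add: x(1))
  show "\<phi> (snd \<gamma>) (pt \<gamma>) = pt \<gamma>" unfolding s by (simp add: x(1) flow_period_shift[OF x(3)])
  show "0 < snd \<gamma>" by (simp add: x)
qed

lemma periodic_orbit_period:
  assumes "\<gamma> \<in> periodic_orbits \<phi>" "y \<in> fst \<gamma>" shows "\<phi> (snd \<gamma>) y = y"
proof -
  obtain t where "y = \<phi> t (pt \<gamma>)" using periodic_orbitsD(1)[OF assms(1)] assms(2) by auto
  then show ?thesis using flow_period_shift periodic_orbitsD(2)[OF assms(1)] by simp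
qed

lemma periodic_orbit_point:
  assumes "\<gamma> \<in> periodic_orbits \<phi>" "y \<in> fst \<gamma>"
  obtains v where "0 \<le> v" "v \<le> snd \<gamma>" "y = \<phi> v (pt \<gamma>)"
proof -
  obtain t where "y = \<phi> t (pt \<gamma>)" using periodic_orbitsD(1)[OF assms(1)] assms(2) by auto
  moreover obtain k r where "0 \<le> r" "r < snd \<gamma>" "\<phi> t (pt \<gamma>) = \<phi> r (pt \<gamma>)"
    using flow_period_reduce[OF periodic_orbitsD(2,3)[OF assms(1)]] by metis
  ultimately show ?thesis using that[of r] by auto
qed

lemma PK_D:
  assumes "\<gamma> \<in> PK \<phi> K a b"
  shows "\<gamma> \<in> periodic_orbits \<phi>" "a \<le> snd \<gamma>" "snd \<gamma> \<le> b" "fst \<gamma> \<inter> K \<noteq> {}"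
  using assms by (auto simp: PK_def)

text \<open>Two periodic orbits that share a point and whose periods differ by less than every period of that
  point are equal.\<close>

lemma periodic_orbits_eqI:
  assumes "\<gamma>\<^sub>1 \<in> periodic_orbits \<phi>" "\<gamma>\<^sub>2 \<in> periodic_orbits \<phi>" "x\<^sub>1 \<in> fst \<gamma>\<^sub>1" "x\<^sub>2 \<in> fst \<gamma>\<^sub>2"
    and "x\<^sub>2 = \<phi> \<tau> x\<^sub>1" "\<And>t. 0 < t \<Longrightarrow> \<phi> t x\<^sub>1 = x\<^sub>1 \<Longrightarrow> p \<le> t" "\<bar>snd \<gamma>\<^sub>1 - snd \<gamma>\<^sub>2\<bar> < p"
  shows "\<gamma>\<^sub>1 = \<gamma>\<^sub>2"
proof -
  have f: "fst \<gamma>\<^sub>1 = orbit x\<^sub>1" "fst \<gamma>\<^sub>2 = orbit x\<^sub>2"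
    using periodic_orbitsD(1) assms(1-4) orbit_eqI by metis+
  then have eq: "fst \<gamma>\<^sub>1 = fst \<gamma>\<^sub>2" using assms(5) orbit_eq by simp
  have per: "\<phi> (snd \<gamma>\<^sub>1) x\<^sub>1 = x\<^sub>1" "\<phi> (snd \<gamma>\<^sub>2) x\<^sub>1 = x\<^sub>1"
    using assms(1-3) periodic_orbit_period eq by auto
  have "\<phi> (snd \<gamma>\<^sub>1 - snd \<gamma>\<^sub>2) x\<^sub>1 = x\<^sub>1"
    using flow_add[of "- snd \<gamma>\<^sub>2" "snd \<gamma>\<^sub>1" x\<^sub>1] flow_minus(1)[of "snd \<gamma>\<^sub>2" x\<^sub>1] per by simp
  moreover have "\<phi> (snd \<gamma>\<^sub>2 - snd \<gamma>\<^sub>1) x\<^sub>1 = x\<^sub>1"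
    using flow_add[of "- snd \<gamma>\<^sub>1" "snd \<gamma>\<^sub>2" x\<^sub>1] flow_minus(1)[of "snd \<gamma>\<^sub>1" x\<^sub>1] per by simp
  ultimately have "\<not> 0 < snd \<gamma>\<^sub>1 - snd \<gamma>\<^sub>2" "\<not> 0 < snd \<gamma>\<^sub>2 - snd \<gamma>\<^sub>1"
    using assms(6)[of "snd \<gamma>\<^sub>1 - snd \<gamma>\<^sub>2"] assms(6)[of "snd \<gamma>\<^sub>2 - snd \<gamma>\<^sub>1"] assms(7) by linarith+
  then have "snd \<gamma>\<^sub>1 = snd \<gamma>\<^sub>2" by simp
  then show ?thesis using eq by (simp add: prod_eq_iff)
qed

text \<open>On a primitive orbit, two times in the same half of the period that lead to points at most the
  time \<open>1/2\<close> apart on the orbit are themselves at most \<open>1/2\<close> apart. The halves exclude that the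
  times differ by about one period.\<close>

lemma primitive_positions:
  assumes "\<gamma> \<in> periodic_orbits \<phi>" "primitive \<gamma>" "1 < snd \<gamma>"
    and "0 \<le> t\<^sub>1" "t\<^sub>1 \<le> snd \<gamma>" "0 \<le> t\<^sub>2" "t\<^sub>2 \<le> snd \<gamma>" "t\<^sub>1 < snd \<gamma> / 2 \<longleftrightarrow> t\<^sub>2 < snd \<gamma> / 2"
    and "\<phi> t\<^sub>2 (pt \<gamma>) = \<phi> \<tau> (\<phi> t\<^sub>1 (pt \<gamma>))" "\<bar>\<tau>\<bar> \<le> 1/2"
  shows "\<bar>t\<^sub>1 - t\<^sub>2\<bar> \<le> 1/2"
proof -
  define r where "r = t\<^sub>2 - t\<^sub>1 - \<tau>"
  have "\<phi> (- (\<tau> + t\<^sub>1)) (\<phi> t\<^sub>2 (pt \<gamma>)) = pt \<gamma>"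
    using assms(9) flow_minus(1)[of "\<tau> + t\<^sub>1"] by (simp only: flow_flow)
  then have r: "\<phi> r (pt \<gamma>) = pt \<gamma>" by (simp add: flow_flow r_def algebra_simps)
  then have r': "\<phi> (- r) (pt \<gamma>) = pt \<gamma>" using flow_minus(1)[of r "pt \<gamma>"] by simp
  have "\<bar>t\<^sub>2 - t\<^sub>1\<bar> \<le> snd \<gamma> / 2" using assms(4-8) by linarith
  then have "\<bar>r\<bar> < snd \<gamma>" using assms(3,10) unfolding r_def by linarith
  then have "\<not> 0 < r" "\<not> 0 < - r"
    using r r' assms(2) unfolding primitive_def abs_less_iff by blast+
  then have "r = 0" by simp
  then have "t\<^sub>2 - t\<^sub>1 = \<tau>" by (simp add: r_def)
  then show ?thesis using assms(10) by linarith
qed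

lemma continuous_orbit: "continuous_on S (\<lambda>t. \<phi> t x)"
  by (intro continuous_intros)

lemma sets_occ:
  assumes "A \<in> sets borel" shows "{t\<in>{0..l}. \<phi> t x \<in> A} \<in> sets lborel"
proof -
  have "(\<lambda>t. \<phi> t x) \<in> borel_measurable borel"
    by (intro borel_measurable_continuous_onI continuous_orbit)
  then have "(\<lambda>t. \<phi> t x) -` A \<in> sets borel" using measurable_sets_borel assms by blast
  moreover have "{t\<in>{0..l}. \<phi> t x \<in> A} = {0..l} \<inter> (\<lambda>t. \<phi> t x) -` A" by auto
  ultimately show ?thesis by simp
qed

lemma occ_bounds:
  assumes "0 \<le> snd \<gamma>" shows "0 \<le> occ \<gamma> A" "occ \<gamma> A \<le> snd \<gamma>"
proof -
  show "0 \<le> occ \<gamma> A" by (simp add: occ_def)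
  show "occ \<gamma> A \<le> snd \<gamma>"
  proof (cases "{t\<in>{0..snd \<gamma>}. \<phi> t (pt \<gamma>) \<in> A} \<in> sets lborel")
    case True
    then have "occ \<gamma> A \<le> measure lborel {0..snd \<gamma>}"
      unfolding occ_def by (intro measure_mono_fmeasurable) auto
    then show ?thesis using assms by simp
  next
    case False
    then show ?thesis using assms by (simp add: occ_def measure_notin_sets)
  qed
qed

lemma occ_mono:
  assumes "A \<in> sets borel" "B \<in> sets borel" "A \<subseteq> B" shows "occ \<gamma> A \<le> occ \<gamma> B"
proof -
  have "{t\<in>{0..snd \<gamma>}. \<phi> t (pt \<gamma>) \<in> B} \<in> fmeasurable lborel"
    by (rule fmeasurableI2[of "{0..snd \<gamma>}"]) (use sets_occ[OF assms(2)] in auto)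
  then show ?thesis
    unfolding occ_def by (rule measure_mono_fmeasurable[rotated 2]) (use sets_occ[OF assms(1)] assms(3) in auto)
qed

lemma expansive_constD:
  assumes "expansive_const e" "\<phi> l\<^sub>1 x\<^sub>1 = x\<^sub>1" "\<phi> l\<^sub>2 x\<^sub>2 = x\<^sub>2" "0 < l\<^sub>1" "0 < l\<^sub>2" "\<bar>l\<^sub>1 - l\<^sub>2\<bar> \<le> e"
    and "\<And>t. 0 \<le> t \<Longrightarrow> t \<le> l\<^sub>1 \<Longrightarrow> t \<le> l\<^sub>2 \<Longrightarrow> dist (\<phi> t x\<^sub>1) (\<phi> t x\<^sub>2) \<le> e"
  obtains \<tau> where "\<bar>\<tau>\<bar> \<le> 1/2" "x\<^sub>2 = \<phi> \<tau> x\<^sub>1"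
  using assms unfolding expansive_const_def by blast

text \<open>Two positions, at the times \<open>t\<^sub>1\<close> and \<open>t\<^sub>2\<close> of the same half of the period, from which two
  periodic orbits with close periods, the first one primitive, stay \<open>e\<close>-close over a whole period, are close positions on one orbit.\<close>

lemma same_visit:
  assumes "expansive_const e" "\<gamma>\<^sub>1 \<in> periodic_orbits \<phi>" "\<gamma>\<^sub>2 \<in> periodic_orbits \<phi>" "primitive \<gamma>\<^sub>1" "1 < snd \<gamma>\<^sub>1"
    and t: "0 \<le> t\<^sub>1" "t\<^sub>1 \<le> snd \<gamma>\<^sub>1" "0 \<le> t\<^sub>2" "t\<^sub>2 \<le> snd \<gamma>\<^sub>2" "t\<^sub>1 < snd \<gamma>\<^sub>1 / 2 \<longleftrightarrow> t\<^sub>2 < snd \<gamma>\<^sub>2 / 2"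
    and l: "\<bar>snd \<gamma>\<^sub>1 - snd \<gamma>\<^sub>2\<bar> < \<kappa>" "\<kappa> \<le> e" "\<kappa> \<le> p"
    and p: "\<And>t. 0 < t \<Longrightarrow> \<phi> t (\<phi> t\<^sub>1 (pt \<gamma>\<^sub>1)) = \<phi> t\<^sub>1 (pt \<gamma>\<^sub>1) \<Longrightarrow> p \<le> t"
    and close: "\<And>r. 0 \<le> r \<Longrightarrow> r \<le> snd \<gamma>\<^sub>1 \<Longrightarrow> r \<le> snd \<gamma>\<^sub>2 \<Longrightarrow>
      dist (\<phi> r (\<phi> t\<^sub>1 (pt \<gamma>\<^sub>1))) (\<phi> r (\<phi> t\<^sub>2 (pt \<gamma>\<^sub>2))) \<le> e"
  shows "\<gamma>\<^sub>1 = \<gamma>\<^sub>2 \<and> \<bar>t\<^sub>1 - t\<^sub>2\<bar> \<le> 1/2"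
proof -
  define x\<^sub>1 where "x\<^sub>1 = \<phi> t\<^sub>1 (pt \<gamma>\<^sub>1)"
  define x\<^sub>2 where "x\<^sub>2 = \<phi> t\<^sub>2 (pt \<gamma>\<^sub>2)"
  have in_fst: "x\<^sub>1 \<in> fst \<gamma>\<^sub>1" "x\<^sub>2 \<in> fst \<gamma>\<^sub>2"
    using periodic_orbitsD(1) assms(2,3) by (auto simp: x\<^sub>1_def x\<^sub>2_def)
  note per = periodic_orbit_period[OF assms(2) in_fst(1)] periodic_orbit_period[OF assms(3) in_fst(2)]
  have "\<bar>snd \<gamma>\<^sub>1 - snd \<gamma>\<^sub>2\<bar> \<le> e" using l by linarith
  from expansive_constD[OF assms(1) per periodic_orbitsD(3)[OF assms(2)] periodic_orbitsD(3)[OF assms(3)] this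
      close[folded x\<^sub>1_def x\<^sub>2_def]]
  obtain r where r: "\<bar>r\<bar> \<le> 1/2" "x\<^sub>2 = \<phi> r x\<^sub>1" .
  have \<gamma>: "\<gamma>\<^sub>1 = \<gamma>\<^sub>2"
    using p[folded x\<^sub>1_def] less_le_trans[OF l(1,3)]
    by (intro periodic_orbits_eqI[OF assms(2,3) in_fst r(2), of p]) auto
  have "\<bar>t\<^sub>1 - t\<^sub>2\<bar> \<le> 1/2"
    using primitive_positions[OF assms(2,4,5) t(1,2), of t\<^sub>2 r] t r \<gamma> unfolding x\<^sub>1_def x\<^sub>2_def by auto
  then show ?thesis using \<gamma> by simp
qed

text \<open>A periodic point as produced by the closed gluing is at some position on one of the orbits that
  are counted.\<close>

lemma glued_orbit_position:
  assumes "\<phi> l y = y" "0 < L" "L \<le> l" "l \<le> L + c" "orbit y \<inter> K \<noteq> {}"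
  obtains v where "(orbit y, l) \<in> PK \<phi> K L (L + c)" "0 \<le> v" "v \<le> l" "y = \<phi> v (pt (orbit y, l))"
proof -
  have "(orbit y, l) \<in> periodic_orbits \<phi>" using assms by (intro periodic_orbitsI) auto
  then show ?thesis
    using that periodic_orbit_point[of "(orbit y, l)" y] orbit_self[of y] assms by (auto simp: PK_def)
qed

text \<open>The dynamical ball defined by a non-strict inequality, which is a closed set.\<close>

definition cdyn_ball :: "'a \<Rightarrow> real \<Rightarrow> real \<Rightarrow> 'a set" where
  "cdyn_ball x \<epsilon> T = {y. \<forall>t\<in>{0..T}. dist (\<phi> t x) (\<phi> t y) \<le> \<epsilon>}"

lemma closed_cdyn_ball: "closed (cdyn_ball x \<epsilon> T)"
proof -
  have "cdyn_ball x \<epsilon> T = (\<Inter>t\<in>{0..T}. {y. dist (\<phi> t x) (\<phi> t y) \<le> \<epsilon>})"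
    by (auto simp: cdyn_ball_def)
  moreover have "closed {y. dist (\<phi> t x) (\<phi> t y) \<le> \<epsilon>}" for t
    by (intro closed_Collect_le continuous_intros)
  ultimately show ?thesis by auto
qed

lemma open_dyn_ball: "open (dyn_ball \<phi> x \<epsilon> T)"
proof -
  have "closed (- dyn_ball \<phi> x \<epsilon> T)"
    unfolding closed_sequential_limits
  proof safe
    fix f y assume f: "\<forall>n. f n \<in> - dyn_ball \<phi> x \<epsilon> T" "f \<longlonglongrightarrow> y" and "y \<in> dyn_ball \<phi> x \<epsilon> T"
    have "\<forall>n. \<exists>t\<in>{0..T}. \<epsilon> \<le> dist (\<phi> t x) (\<phi> t (f n))"
      using f(1) by (auto simp: dyn_ball_def not_less)
    then obtain t where t: "\<And>n. t n \<in> {0..T}" "\<And>n. \<epsilon> \<le> dist (\<phi> (t n) x) (\<phi> (t n) (f n))" by metis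
    obtain s r where s: "s \<in> {0..T}" "strict_mono r" "(t \<circ> r) \<longlonglongrightarrow> s"
      using compact_Icc[of 0 T] t(1) unfolding compact_def by metis
    have "continuous_on UNIV (\<lambda>(s, y). dist (\<phi> s x) (\<phi> s y))"
      unfolding case_prod_unfold by (intro continuous_intros)
    then have "isCont (\<lambda>(s, y). dist (\<phi> s x) (\<phi> s y)) (s, y)"
      by (simp add: continuous_on_eq_continuous_at)
    moreover have "(\<lambda>n. (t (r n), f (r n))) \<longlonglongrightarrow> (s, y)"
      using s(3) LIMSEQ_subseq_LIMSEQ[OF f(2) s(2)] by (intro tendsto_Pair) (auto simp: o_def)
    ultimately have "(\<lambda>n. (\<lambda>(s, y). dist (\<phi> s x) (\<phi> s y)) (t (r n), f (r n))) \<longlonglongrightarrow>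
        (\<lambda>(s, y). dist (\<phi> s x) (\<phi> s y)) (s, y)"
      by (rule isCont_tendsto_compose)
    then have "(\<lambda>n. dist (\<phi> (t (r n)) x) (\<phi> (t (r n)) (f (r n)))) \<longlonglongrightarrow> dist (\<phi> s x) (\<phi> s y)"
      by simp
    then have "\<epsilon> \<le> dist (\<phi> s x) (\<phi> s y)"
      using t(2) by (intro LIMSEQ_le_const) auto
    then show False using \<open>y \<in> dyn_ball \<phi> x \<epsilon> T\<close> s(1) by (force simp: dyn_ball_def)
  qed
  then show ?thesis by (simp add: open_closed)
qed

lemma dyn_ball_subset_ball: "0 \<le> T \<Longrightarrow> dyn_ball \<phi> x \<epsilon> T \<subseteq> ball x \<epsilon>"
  by (auto simp: dyn_ball_def dest: bspec[of _ _ 0])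

lemma cdyn_ball_subset_dyn_ball: "\<epsilon> < \<epsilon>' \<Longrightarrow> cdyn_ball x \<epsilon> T \<subseteq> dyn_ball \<phi> x \<epsilon>' T"
  by (force simp: dyn_ball_def cdyn_ball_def)

text \<open>Up to a factor, the time that the orbits of \<open>P\<close> spend in \<open>A\<close> is at most the number of pairs of an
  orbit and a time of a \<open>1\<close>-separated set.\<close>

lemma discretise_occ:
  assumes "finite P" "A \<in> sets borel"
  obtains S where "\<And>\<gamma>. finite (S \<gamma>)" "\<And>\<gamma> t. t \<in> S \<gamma> \<Longrightarrow> 0 \<le> t \<and> t \<le> snd \<gamma> \<and> \<phi> t (pt \<gamma>) \<in> A"
    "\<And>\<gamma> s s'. s \<in> S \<gamma> \<Longrightarrow> s' \<in> S \<gamma> \<Longrightarrow> \<bar>s - s'\<bar> < 1 \<Longrightarrow> s = s'"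
    "(\<Sum>\<gamma>\<in>P. occ \<gamma> A) \<le> 2 * real (card (Sigma P S))"
proof -
  define A' where "A' \<gamma> = {t\<in>{0..snd \<gamma>}. \<phi> t (pt \<gamma>) \<in> A}" for \<gamma>
  define net where "net \<gamma> S \<longleftrightarrow> finite S \<and> S \<subseteq> A' \<gamma> \<and> (\<forall>s\<in>S. \<forall>s'\<in>S. \<bar>s - s'\<bar> < 1 \<longrightarrow> s = s') \<and>
      (\<forall>a\<in>A' \<gamma>. \<exists>s\<in>S. \<bar>a - s\<bar> < 1)" for \<gamma> S
  have "\<exists>S. net \<gamma> S" for \<gamma>
    unfolding net_def by (rule separated_times[of _ "snd \<gamma>"]) (auto simp: A'_def)
  then obtain S where net: "\<And>\<gamma>. net \<gamma> (S \<gamma>)" by metis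
  then have S: "finite (S \<gamma>)" "S \<gamma> \<subseteq> A' \<gamma>" "\<forall>s\<in>S \<gamma>. \<forall>s'\<in>S \<gamma>. \<bar>s - s'\<bar> < 1 \<longrightarrow> s = s'"
    "\<forall>a\<in>A' \<gamma>. \<exists>s\<in>S \<gamma>. \<bar>a - s\<bar> < 1" for \<gamma>
    by (simp_all add: net_def)
  have "(\<Sum>\<gamma>\<in>P. occ \<gamma> A) \<le> (\<Sum>\<gamma>\<in>P. 2 * real (card (S \<gamma>)))"
  proof (rule sum_mono)
    fix \<gamma> assume "\<gamma> \<in> P"
    then show "occ \<gamma> A \<le> 2 * real (card (S \<gamma>))"
      unfolding occ_def using measure_le_card_net[OF S(1) sets_occ, of A "snd \<gamma>" "pt \<gamma>" \<gamma> 1] assms(2) S(4)[of \<gamma>]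
      by (simp add: A'_def)
  qed
  also have "\<dots> = 2 * real (card (Sigma P S))"
    using assms(1) S(1) by (simp add: card_SigmaI sum_distrib_left)
  finally have "(\<Sum>\<gamma>\<in>P. occ \<gamma> A) \<le> 2 * real (card (Sigma P S))" .
  moreover have "0 \<le> t \<and> t \<le> snd \<gamma> \<and> \<phi> t (pt \<gamma>) \<in> A" if "t \<in> S \<gamma>" for \<gamma> t
    using S(2)[of \<gamma>] that by (auto simp: A'_def)
  moreover have "s = s'" if "s \<in> S \<gamma>" "s' \<in> S \<gamma>" "\<bar>s - s'\<bar> < 1" for \<gamma> s s'
    using S(3)[of \<gamma>] that by simp
  ultimately show ?thesis using S(1) by (intro that[of S])
qed

text \<open>A finite net of positions on each periodic orbit, with as many points as its period allows.\<close>

lemma position_nets: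
  assumes "0 < \<kappa>"
  obtains Q where "\<And>\<gamma>. finite (Q \<gamma>)"
    "\<And>\<gamma> v. 0 \<le> v \<Longrightarrow> v \<le> snd \<gamma> \<Longrightarrow> \<exists>u\<in>Q \<gamma>. \<bar>v - u\<bar> < \<kappa>"
    "\<And>\<gamma>. \<kappa> \<le> snd \<gamma> \<Longrightarrow> real (card (Q \<gamma>)) \<le> 2 * snd \<gamma> / \<kappa>"
proof -
  define net where "net l S \<longleftrightarrow> finite S \<and> S \<subseteq> {0..l} \<and> (\<forall>s\<in>S. \<forall>s'\<in>S. \<bar>s - s'\<bar> < \<kappa> \<longrightarrow> s = s') \<and>
      (\<forall>a\<in>{0..l}. \<exists>s\<in>S. \<bar>a - s\<bar> < \<kappa>)" for l S
  have "\<exists>S. net l S" for l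
    unfolding net_def by (rule separated_times[of _ l]) (use assms in auto)
  then obtain S where net: "\<And>l. net l (S l)" by metis
  then have S: "finite (S l)" "S l \<subseteq> {0..l}" "\<forall>s\<in>S l. \<forall>s'\<in>S l. \<bar>s - s'\<bar> < \<kappa> \<longrightarrow> s = s'"
    "\<forall>a\<in>{0..l}. \<exists>s\<in>S l. \<bar>a - s\<bar> < \<kappa>" for l
    by (simp_all add: net_def)
  show ?thesis
  proof (rule that[of "\<lambda>\<gamma>. S (snd \<gamma>)"])
    fix \<gamma> :: "'c \<times> real" assume "\<kappa> \<le> snd \<gamma>"
    moreover from this have "real (card (S (snd \<gamma>))) * (\<kappa> / 2) \<le> measure lborel {0..snd \<gamma>}"
      using S assms by (intro card_separated_le_measure) auto
    ultimately show "real (card (S (snd \<gamma>))) \<le> 2 * snd \<gamma> / \<kappa>"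
      using assms by (simp add: field_simps)
  qed (use S in auto)
qed

lemma card_positions_le:
  assumes "finite P" "P = PK \<phi> K L (L + c)" "\<And>\<gamma>. finite (Q \<gamma>)"
    and Q: "\<And>\<gamma>. \<kappa> \<le> snd \<gamma> \<Longrightarrow> real (card (Q \<gamma>)) \<le> 2 * snd \<gamma> / \<kappa>"
    and "0 < \<kappa>" "\<kappa> \<le> L" "c \<le> L"
  shows "real (card (Sigma P Q)) \<le> (4 * L / \<kappa>) * real (card P)"
proof -
  have "real (card (Sigma P Q)) = (\<Sum>\<gamma>\<in>P. real (card (Q \<gamma>)))" using assms(1,3) by (simp add: card_SigmaI)
  also have "\<dots> \<le> (\<Sum>\<gamma>\<in>P. 4 * L / \<kappa>)"
  proof (rule sum_mono)
    fix \<gamma> assume "\<gamma> \<in> P"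
    then have \<gamma>: "L \<le> snd \<gamma>" "snd \<gamma> \<le> L + c" using assms(2) PK_D by auto
    have "real (card (Q \<gamma>)) \<le> 2 * snd \<gamma> / \<kappa>" using Q[of \<gamma>] \<gamma> assms(6) by simp
    also have "\<dots> \<le> 4 * L / \<kappa>" using \<gamma> assms(5,7) by (intro divide_right_mono) auto
    finally show "real (card (Q \<gamma>)) \<le> 4 * L / \<kappa>" .
  qed
  finally show ?thesis by (simp add: mult.commute)
qed

text \<open>Points at close positions of the same orbit have close orbits, also at close times.\<close>

lemma dist_shift:
  assumes "\<And>s t x. dist (\<phi> s x) (\<phi> t x) \<le> b * \<bar>s - t\<bar>" "0 < b" "\<bar>v\<^sub>1 - v\<^sub>2\<bar> \<le> c" "y\<^sub>1 = \<phi> v\<^sub>1 q" "y\<^sub>2 = \<phi> v\<^sub>2 q"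
    "\<bar>s - t\<bar> \<le> d"
  shows "dist (\<phi> s y\<^sub>1) (\<phi> t y\<^sub>2) \<le> b * (c + d)"
proof -
  have "dist (\<phi> s y\<^sub>1) (\<phi> t y\<^sub>2) \<le> b * \<bar>(s + v\<^sub>1) - (t + v\<^sub>2)\<bar>"
    unfolding assms(4,5) flow_flow by (rule assms(1))
  also have "\<dots> \<le> b * (c + d)" using assms(2,3,6) by (intro mult_left_mono) linarith+
  finally show ?thesis .
qed

text \<open>The upper count. If a periodic orbit \<open>\<gamma>\<close> of length about \<open>L\<close> visits the dynamical ball of
  \<open>x\<close>, its passage near the orbit segment of \<open>x\<close> can be replaced by any chord from \<open>x\<close> to \<open>y\<^sub>0\<close>, which
  results in a periodic orbit of length about \<open>L\<close> again. Up to bounded multiplicity, the new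
  orbit and the position of the chord on it determine the chord, the orbit \<open>\<gamma>\<close> and the time of
  its visit.\<close>

lemma upper_count:
  assumes K\<^sub>0: "compact K\<^sub>0" "interior K\<^sub>0 \<noteq> {}" and C: "compact C"
    and "0 < \<delta>" "0 < \<epsilon>" "2 * \<epsilon> \<le> e" "0 < e" "expansive_const e"
  obtains S D where "0 < S" "0 < D"
    "\<And>x T F L. \<lbrakk>S < T; ball x \<epsilon> \<subseteq> C; ball (\<phi> T x) \<epsilon> \<subseteq> C; ball y\<^sub>0 \<epsilon> \<subseteq> C; T + S \<le> L; finite F;
       F \<subseteq> chords \<phi> x y\<^sub>0 \<epsilon> (T - S) (T - S + 5 * tau_K \<phi> K\<^sub>0); separating \<phi> \<delta> (T - S) F;
       finite (PK \<phi> K\<^sub>0 L (L + 5 * tau_K \<phi> K\<^sub>0))\<rbrakk> \<Longrightarrow>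
       (\<Sum>\<gamma>\<in>{\<gamma>\<in>PK \<phi> K\<^sub>0 L (L + 5 * tau_K \<phi> K\<^sub>0). primitive \<gamma>}. occ \<gamma> (dyn_ball \<phi> x \<epsilon> T)) * real (card F)
         \<le> D * L * real (card (PK \<phi> K\<^sub>0 L (L + 5 * tau_K \<phi> K\<^sub>0)))"
proof -
  define \<tau> where "\<tau> = tau_K \<phi> K\<^sub>0"
  have \<tau>: "1 \<le> \<tau>" using tau_K_approx(1)[OF K\<^sub>0(2)] \<tau>_def by metis
  obtain b where b: "0 < b" "\<And>s t x. dist (\<phi> s x) (\<phi> t x) \<le> b * \<bar>s - t\<bar>"
    using speed_bound by metis
  obtain p where p: "0 < p" "\<And>x t. x \<in> C \<Longrightarrow> 0 < t \<Longrightarrow> \<phi> t x = x \<Longrightarrow> p \<le> t"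
    using min_period[OF C] by metis
  define m where "m = min \<delta> e"
  have m: "0 < m" "m \<le> \<delta>" "m \<le> e" using assms by (auto simp: m_def)
  define \<delta>' where "\<delta>' = m / 8"
  obtain \<kappa> where \<kappa>: "0 < \<kappa>" "\<kappa> \<le> 1" "\<kappa> \<le> p" "\<kappa> \<le> e" and b\<kappa>: "b * \<kappa> \<le> m / 8"
    using fine_scale[OF b(1) assms(7) m(1) p(1)] by metis
  obtain ct R where ct: "finite (range (case_prod ct))" "\<And>p q. 0 \<le> ct p q" "0 < R"
    "\<And>ps L. \<lbrakk>length ps = 2; segments_in C ps; sum_list (map snd ps) + R \<le> L\<rbrakk> \<Longrightarrow>
       \<exists>y l. \<phi> l y = y \<and> L \<le> l \<and> l \<le> L + 5 * \<tau> \<and> orbit y \<inter> K\<^sub>0 \<noteq> {} \<and> tracks \<phi> ct \<delta>' y ps"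
    using closed_gluing[OF K\<^sub>0 C, of \<delta>' 2] m(1) unfolding \<delta>'_def \<tau>_def
    by (metis divide_pos_pos one_le_numeral zero_less_numeral)
  obtain Q where Q: "\<And>\<gamma>::'a set \<times> real. finite (Q \<gamma>)"
    "\<And>\<gamma> v. 0 \<le> v \<Longrightarrow> v \<le> snd \<gamma> \<Longrightarrow> \<exists>u\<in>Q \<gamma>. \<bar>v - u\<bar> < \<kappa>"
    "\<And>\<gamma>. \<kappa> \<le> snd \<gamma> \<Longrightarrow> real (card (Q \<gamma>)) \<le> 2 * snd \<gamma> / \<kappa>"
    using position_nets[OF \<kappa>(1)] by metis
  \<comment> \<open>The chord and the rest of \<open>\<gamma>\<close> take at most \<open>(T - S + 5 \<tau>) + (L + 5 \<tau> - T) = L - R\<close>.\<close>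
  define S where "S = R + 10 * \<tau>"
  define n where "n = bin \<kappa> (5 * \<tau>)"
  define M where "M = card (range (case_prod ct)) * (Suc n * (Suc n * 2))"
  define D where "D = 2 * (4 / \<kappa>) * real M"
  have "0 < S" using ct(3) \<tau> by (simp add: S_def)
  moreover have "0 < M" using ct(1) by (simp add: M_def card_gt_0_iff)
  then have "0 < D" using \<kappa>(1) by (simp add: D_def)
  moreover have "(\<Sum>\<gamma>\<in>{\<gamma>\<in>P. primitive \<gamma>}. occ \<gamma> (dyn_ball \<phi> x \<epsilon> T)) * real (card F) \<le> D * L * real (card P)"
    if T: "S < T" "T + S \<le> L" and balls: "ball x \<epsilon> \<subseteq> C" "ball (\<phi> T x) \<epsilon> \<subseteq> C" "ball y\<^sub>0 \<epsilon> \<subseteq> C"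
      and F: "finite F" "F \<subseteq> chords \<phi> x y\<^sub>0 \<epsilon> (T - S) (T - S + 5 * \<tau>)" "separating \<phi> \<delta> (T - S) F"
      and P: "finite P" "P = PK \<phi> K\<^sub>0 L (L + 5 * \<tau>)" for x T F L P
  proof -
    define Prim where "Prim = {\<gamma>\<in>P. primitive \<gamma>}"
    have fin: "finite Prim" using P(1) by (simp add: Prim_def)
    have L: "0 < T" "T \<le> L" "5 * \<tau> \<le> L" "1 < L" using T ct(3) \<tau> by (auto simp: S_def)
    obtain V where V: "\<And>\<gamma>. finite (V \<gamma>)"
      "\<And>\<gamma> t. t \<in> V \<gamma> \<Longrightarrow> 0 \<le> t \<and> t \<le> snd \<gamma> \<and> \<phi> t (pt \<gamma>) \<in> dyn_ball \<phi> x \<epsilon> T"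
      "\<And>\<gamma> s s'. s \<in> V \<gamma> \<Longrightarrow> s' \<in> V \<gamma> \<Longrightarrow> \<bar>s - s'\<bar> < 1 \<Longrightarrow> s = s'"
      "(\<Sum>\<gamma>\<in>Prim. occ \<gamma> (dyn_ball \<phi> x \<epsilon> T)) \<le> 2 * real (card (Sigma Prim V))"
      using discretise_occ[OF fin, of "dyn_ball \<phi> x \<epsilon> T"] open_dyn_ball by (metis borel_open)
    \<comment> \<open>The code of \<open>((\<gamma>, t), z)\<close>: the glued orbit \<open>\<gamma>'\<close>, the position on it at which the chord \<open>z\<close>
        starts, the connecting time, the duration \<open>s\<close> of the chord and the period of \<open>\<gamma>\<close> up to \<open>\<kappa>\<close>, and
        the half of the period of \<open>\<gamma>\<close> in which \<open>t\<close> lies.\<close>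
    define rel where "rel = (\<lambda>((\<gamma>, t), z) ((\<gamma>', u), c, i, j, f). \<exists>y s v.
        y = \<phi> v (pt \<gamma>') \<and> \<bar>v - u\<bar> < \<kappa> \<and> T - S \<le> s \<and> i = bin \<kappa> (s - (T - S)) \<and>
        j = bin \<kappa> (snd \<gamma> - L) \<and> f = (t < snd \<gamma> / 2) \<and>
        (\<forall>r\<in>{0..s}. dist (\<phi> r y) (\<phi> r z) \<le> \<delta>') \<and>
        (\<forall>r\<in>{0..snd \<gamma> - T}. dist (\<phi> (r + (s + c)) y) (\<phi> (r + T) (\<phi> t (pt \<gamma>))) \<le> \<delta>'))"
    define X where "X = Sigma Prim V \<times> F"
    define Y where "Y = Sigma P Q \<times> range (case_prod ct) \<times> {..n} \<times> {..n} \<times> (UNIV :: bool set)"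
    have "card X \<le> card Y"
    proof (rule card_le_by_relation)
      show "finite Y" unfolding Y_def using P(1) Q(1) ct(1) by auto
    next
      fix \<xi> assume "\<xi> \<in> X"
      then obtain \<gamma> t z where \<xi>: "\<xi> = ((\<gamma>, t), z)" "\<gamma> \<in> P" "t \<in> V \<gamma>" "z \<in> F"
        by (auto simp: X_def Prim_def)
      note \<gamma> = PK_D[OF \<xi>(2)[unfolded P(2)]] V(2)[OF \<xi>(3)]
      define x' where "x' = \<phi> t (pt \<gamma>)"
      have x': "x' \<in> dyn_ball \<phi> x \<epsilon> T" using \<gamma> by (simp add: x'_def)
      have per: "\<phi> (snd \<gamma>) x' = x'"
        unfolding x'_def by (rule flow_period_shift[OF periodic_orbitsD(2)[OF \<gamma>(1)]])
      obtain s where s: "T - S \<le> s" "s \<le> T - S + 5 * \<tau>" "z \<in> ball x \<epsilon>" "\<phi> s z \<in> ball y\<^sub>0 \<epsilon>"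
      proof -
        have "z \<in> chords \<phi> x y\<^sub>0 \<epsilon> (T - S) (T - S + 5 * \<tau>)" using F(2) \<xi>(4) by blast
        then show ?thesis using that unfolding chords_def by auto
      qed
      define c where "c = ct (\<phi> s z) (\<phi> T x')"
      define ps where "ps = [(z, s), (\<phi> T x', snd \<gamma> - T)]"
      have "\<phi> T x' \<in> ball (\<phi> T x) \<epsilon>" "x' \<in> ball x \<epsilon>"
        using x' L dyn_ball_subset_ball[of T x \<epsilon>] by (auto simp: dyn_ball_def)
      then have "segments_in C ps"
        using balls s T \<gamma> L per by (auto simp: ps_def flow_flow)
      moreover have "sum_list (map snd ps) + R \<le> L"
        using s \<gamma> by (simp add: ps_def S_def)
      ultimately obtain y l where y: "\<phi> l y = y" "L \<le> l" "l \<le> L + 5 * \<tau>" "orbit y \<inter> K\<^sub>0 \<noteq> {}" "tracks \<phi> ct \<delta>' y ps"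
        using ct(4)[of ps L] by (auto simp: ps_def)
      have "0 < L" using L(4) by simp
      then obtain v where \<gamma>': "(orbit y, l) \<in> P" and v: "0 \<le> v" "v \<le> l" "y = \<phi> v (pt (orbit y, l))"
        using glued_orbit_position[OF y(1) _ y(2-4)] unfolding P(2) by metis
      obtain u where u: "u \<in> Q (orbit y, l)" "\<bar>v - u\<bar> < \<kappa>" using Q(2)[of v "(orbit y, l)"] v by auto
      define \<zeta> where "\<zeta> = (((orbit y, l), u), c, bin \<kappa> (s - (T - S)), bin \<kappa> (snd \<gamma> - L), t < snd \<gamma> / 2)"
      have "\<zeta> \<in> Y"
        unfolding Y_def \<zeta>_def n_def c_def using \<gamma>' u(1) s \<gamma> bin_le[OF \<kappa>(1)]
        by (auto intro: rev_image_eqI[of "(\<phi> s z, \<phi> T x')"])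
      moreover have "rel \<xi> \<zeta>"
        unfolding rel_def \<zeta>_def \<xi>(1) split
        by (rule exI[of _ y], rule exI[of _ s], rule exI[of _ v])
          (use v u s y(5) in \<open>auto simp: ps_def c_def x'_def flow_flow add_ac\<close>)
      ultimately show "\<exists>\<zeta>\<in>Y. rel \<xi> \<zeta>" by blast
    next
      fix \<xi>\<^sub>1 \<xi>\<^sub>2 \<zeta> assume "\<xi>\<^sub>1 \<in> X" "\<xi>\<^sub>2 \<in> X" "\<zeta> \<in> Y" and rel: "rel \<xi>\<^sub>1 \<zeta>" "rel \<xi>\<^sub>2 \<zeta>"
      then obtain \<gamma>\<^sub>1 t\<^sub>1 z\<^sub>1 \<gamma>\<^sub>2 t\<^sub>2 z\<^sub>2 where \<xi>:
        "\<xi>\<^sub>1 = ((\<gamma>\<^sub>1, t\<^sub>1), z\<^sub>1)" "\<gamma>\<^sub>1 \<in> P" "primitive \<gamma>\<^sub>1" "t\<^sub>1 \<in> V \<gamma>\<^sub>1" "z\<^sub>1 \<in> F"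
        "\<xi>\<^sub>2 = ((\<gamma>\<^sub>2, t\<^sub>2), z\<^sub>2)" "\<gamma>\<^sub>2 \<in> P" "primitive \<gamma>\<^sub>2" "t\<^sub>2 \<in> V \<gamma>\<^sub>2" "z\<^sub>2 \<in> F"
        by (auto simp: X_def Prim_def)
      obtain \<gamma>' u c i j f where \<zeta>: "\<zeta> = ((\<gamma>', u), c, i, j, f)" by (metis surj_pair)
      note \<gamma>1 = PK_D[OF \<xi>(2)[unfolded P(2)]] V(2)[OF \<xi>(4)]
      note \<gamma>2 = PK_D[OF \<xi>(7)[unfolded P(2)]] V(2)[OF \<xi>(9)]
      obtain y\<^sub>1 s\<^sub>1 v\<^sub>1 where 1: "y\<^sub>1 = \<phi> v\<^sub>1 (pt \<gamma>')" "\<bar>v\<^sub>1 - u\<bar> < \<kappa>" "T - S \<le> s\<^sub>1" "i = bin \<kappa> (s\<^sub>1 - (T - S))"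
        "j = bin \<kappa> (snd \<gamma>\<^sub>1 - L)" "f = (t\<^sub>1 < snd \<gamma>\<^sub>1 / 2)"
        "\<And>r. 0 \<le> r \<Longrightarrow> r \<le> s\<^sub>1 \<Longrightarrow> dist (\<phi> r y\<^sub>1) (\<phi> r z\<^sub>1) \<le> \<delta>'"
        "\<And>r. 0 \<le> r \<Longrightarrow> r \<le> snd \<gamma>\<^sub>1 - T \<Longrightarrow> dist (\<phi> (r + (s\<^sub>1 + c)) y\<^sub>1) (\<phi> (r + T) (\<phi> t\<^sub>1 (pt \<gamma>\<^sub>1))) \<le> \<delta>'"
        using rel(1) unfolding rel_def \<xi>(1) \<zeta> split by (auto simp: Ball_def)
      obtain y\<^sub>2 s\<^sub>2 v\<^sub>2 where 2: "y\<^sub>2 = \<phi> v\<^sub>2 (pt \<gamma>')" "\<bar>v\<^sub>2 - u\<bar> < \<kappa>" "T - S \<le> s\<^sub>2" "i = bin \<kappa> (s\<^sub>2 - (T - S))"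
        "j = bin \<kappa> (snd \<gamma>\<^sub>2 - L)" "f = (t\<^sub>2 < snd \<gamma>\<^sub>2 / 2)"
        "\<And>r. 0 \<le> r \<Longrightarrow> r \<le> s\<^sub>2 \<Longrightarrow> dist (\<phi> r y\<^sub>2) (\<phi> r z\<^sub>2) \<le> \<delta>'"
        "\<And>r. 0 \<le> r \<Longrightarrow> r \<le> snd \<gamma>\<^sub>2 - T \<Longrightarrow> dist (\<phi> (r + (s\<^sub>2 + c)) y\<^sub>2) (\<phi> (r + T) (\<phi> t\<^sub>2 (pt \<gamma>\<^sub>2))) \<le> \<delta>'"
        using rel(2) unfolding rel_def \<xi>(6) \<zeta> split by (auto simp: Ball_def)
      have v: "\<bar>v\<^sub>1 - v\<^sub>2\<bar> \<le> 2 * \<kappa>" using 1(2) 2(2) by linarith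
      have s: "\<bar>s\<^sub>1 - s\<^sub>2\<bar> \<le> \<kappa>"
        using bin_eqD[of \<kappa> "s\<^sub>1 - (T - S)" "s\<^sub>2 - (T - S)"] 1(3,4) 2(3,4) \<kappa>(1) by auto
      have l: "\<bar>snd \<gamma>\<^sub>1 - snd \<gamma>\<^sub>2\<bar> < \<kappa>"
        using bin_eqD[of \<kappa> "snd \<gamma>\<^sub>1 - L" "snd \<gamma>\<^sub>2 - L"] 1(5) 2(5) \<kappa>(1) \<gamma>1 \<gamma>2 by auto
      have z: "z\<^sub>1 = z\<^sub>2"
      proof (rule ccontr)
        assume "z\<^sub>1 \<noteq> z\<^sub>2"
        then obtain r where r: "0 \<le> r" "r \<le> T - S" "\<delta> \<le> dist (\<phi> r z\<^sub>1) (\<phi> r z\<^sub>2)"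
          using F(3)[unfolded separating_def, rule_format, OF \<xi>(5,10)] by auto
        have "dist (\<phi> r z\<^sub>1) (\<phi> r z\<^sub>2) \<le> \<delta>' + b * (2 * \<kappa> + 0) + \<delta>'"
          using 1(7)[of r] 2(7)[of r] r 1(3) 2(3) dist_shift[OF b(2,1) v 1(1) 2(1), of r r 0]
          by (intro dist_triangle_four[of _ "\<phi> r y\<^sub>1" _ "\<phi> r y\<^sub>2"]) (auto simp: dist_commute)
        also have "\<dots> < \<delta>" using b\<kappa> m by (simp add: \<delta>'_def)
        finally show False using r by simp
      qed
      define x\<^sub>1 where "x\<^sub>1 = \<phi> t\<^sub>1 (pt \<gamma>\<^sub>1)"
      define x\<^sub>2 where "x\<^sub>2 = \<phi> t\<^sub>2 (pt \<gamma>\<^sub>2)"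
      have close: "dist (\<phi> r x\<^sub>1) (\<phi> r x\<^sub>2) \<le> e" if r: "0 \<le> r" "r \<le> snd \<gamma>\<^sub>1" "r \<le> snd \<gamma>\<^sub>2" for r
      proof (cases "r \<le> T")
        case True
        then have "dist (\<phi> r x) (\<phi> r x\<^sub>1) < \<epsilon>" "dist (\<phi> r x) (\<phi> r x\<^sub>2) < \<epsilon>"
          using \<gamma>1(5) \<gamma>2(5) r unfolding x\<^sub>1_def x\<^sub>2_def dyn_ball_def by auto
        then show ?thesis using dist_triangle3[of "\<phi> r x\<^sub>1" "\<phi> r x\<^sub>2" "\<phi> r x"] assms(6) by linarith
      next
        case False
        have "dist (\<phi> r x\<^sub>1) (\<phi> r x\<^sub>2) \<le> \<delta>' + b * (2 * \<kappa> + \<kappa>) + \<delta>'"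
          using 1(8)[of "r - T"] 2(8)[of "r - T"] r False s
            dist_shift[OF b(2,1) v 1(1) 2(1), of "r - T + (s\<^sub>1 + c)" "r - T + (s\<^sub>2 + c)" \<kappa>]
          by (intro dist_triangle_four[of _ "\<phi> (r - T + (s\<^sub>1 + c)) y\<^sub>1" _ "\<phi> (r - T + (s\<^sub>2 + c)) y\<^sub>2"])
            (auto simp: dist_commute x\<^sub>1_def x\<^sub>2_def)
        also have "\<dots> \<le> e" using b\<kappa> m by (simp add: \<delta>'_def)
        finally show ?thesis .
      qed
      have "x\<^sub>1 \<in> C"
        using \<gamma>1(5) dyn_ball_subset_ball[of T x \<epsilon>] L balls(1) by (auto simp: x\<^sub>1_def)
      then have p: "\<And>t. 0 < t \<Longrightarrow> \<phi> t x\<^sub>1 = x\<^sub>1 \<Longrightarrow> p \<le> t" by (rule p(2))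
      have "1 < snd \<gamma>\<^sub>1" "t\<^sub>1 < snd \<gamma>\<^sub>1 / 2 \<longleftrightarrow> t\<^sub>2 < snd \<gamma>\<^sub>2 / 2" using \<gamma>1 L 1(6) 2(6) by auto
      then have same: "\<gamma>\<^sub>1 = \<gamma>\<^sub>2 \<and> \<bar>t\<^sub>1 - t\<^sub>2\<bar> \<le> 1/2"
        using \<gamma>1(5) \<gamma>2(5) l \<kappa>(3,4) p close unfolding x\<^sub>1_def x\<^sub>2_def
        by (intro same_visit[OF assms(8) \<gamma>1(1) \<gamma>2(1) \<xi>(3)]) auto
      then have "t\<^sub>1 = t\<^sub>2" using V(3)[of t\<^sub>1 \<gamma>\<^sub>1 t\<^sub>2] \<xi> by auto
      then show "\<xi>\<^sub>1 = \<xi>\<^sub>2" using \<xi> same z by simp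
    qed
    moreover have "card X = card (Sigma Prim V) * card F" by (simp add: X_def card_cartesian_product)
    moreover have "card Y = card (Sigma P Q) * M"
      by (simp add: Y_def M_def card_cartesian_product)
    moreover have "real (card (Sigma P Q)) \<le> (4 * L / \<kappa>) * real (card P)"
      by (rule card_positions_le[OF P Q(1,3) \<kappa>(1)]) (use \<kappa>(2) L(4) L(3) in auto)
    ultimately have "real (card (Sigma Prim V)) * real (card F) \<le> (4 * L / \<kappa>) * real (card P) * real M"
      by (metis (no_types, lifting) mult_right_mono of_nat_0_le_iff of_nat_le_iff of_nat_mult order_trans)
    moreover have "D * L * real (card P) = 2 * ((4 * L / \<kappa>) * real (card P) * real M)"
      by (simp add: D_def)
    ultimately have "2 * (real (card (Sigma Prim V)) * real (card F)) \<le> D * L * real (card P)"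
      by linarith
    moreover have "(\<Sum>\<gamma>\<in>Prim. occ \<gamma> (dyn_ball \<phi> x \<epsilon> T)) * real (card F) \<le> 2 * real (card (Sigma Prim V)) * real (card F)"
      using V(4) by (intro mult_right_mono) auto
    ultimately show ?thesis unfolding Prim_def by (simp add: mult_ac)
  qed
  ultimately show ?thesis by (intro that[of S D]) (auto simp: \<tau>_def)
qed

text \<open>The lower count. A periodic orbit \<open>\<gamma>\<close> of length about \<open>L\<close> that is in \<open>K\<close> at two times
  \<open>T + S\<close> apart is cut into two pieces. The one of duration \<open>T + S\<close> becomes part of a chord from
  \<open>x\<close> to \<open>y\<^sub>0\<close>; the other one is closed up through the orbit segment of \<open>x\<close> of duration \<open>T\<close>, which
  results in a periodic orbit of length about \<open>L\<close> that visits the dynamical ball of \<open>x\<close>. Up to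
  bounded multiplicity, the chord and the visit determine \<open>\<gamma>\<close> and the time of the cut.\<close>

lemma lower_count:
  assumes K\<^sub>0: "compact K\<^sub>0" "interior K\<^sub>0 \<noteq> {}" and K: "compact K" "y\<^sub>0 \<in> K"
    and "0 < \<delta>" "0 < \<epsilon>" "0 < \<eta>" "4 * \<delta> \<le> e" "0 < e" "expansive_const e"
  obtains S S' D where "0 < S" "0 < S'" "0 < D"
    "\<And>x T E L. \<lbrakk>x \<in> K; \<phi> T x \<in> K; 0 < T; T + S' \<le> L; finite E;
       chords \<phi> x y\<^sub>0 \<eta> (T + S') (T + S' + 5 * tau_K \<phi> K\<^sub>0) \<subseteq> (\<Union>z\<in>E. dyn_ball \<phi> z \<delta> (T + S'));
       finite (PK \<phi> K\<^sub>0 L (L + 5 * tau_K \<phi> K\<^sub>0))\<rbrakk> \<Longrightarrow>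
       (\<Sum>\<gamma>\<in>{\<gamma>\<in>PK \<phi> K\<^sub>0 L (L + 5 * tau_K \<phi> K\<^sub>0). primitive \<gamma>}. occ \<gamma> {q. q \<in> K \<and> \<phi> (T + S) q \<in> K})
         \<le> D * real (card E) * (\<Sum>\<gamma>\<in>PK \<phi> K\<^sub>0 L (L + 5 * tau_K \<phi> K\<^sub>0). occ \<gamma> (cdyn_ball x \<epsilon> T))"
proof -
  define \<tau> where "\<tau> = tau_K \<phi> K\<^sub>0"
  have \<tau>: "1 \<le> \<tau>" using tau_K_approx(1)[OF K\<^sub>0(2)] \<tau>_def by metis
  obtain b where b: "0 < b" "\<And>s t x. dist (\<phi> s x) (\<phi> t x) \<le> b * \<bar>s - t\<bar>"
    using speed_bound by metis
  obtain p where p: "0 < p" "\<And>x t. x \<in> K \<Longrightarrow> 0 < t \<Longrightarrow> \<phi> t x = x \<Longrightarrow> p \<le> t"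
    using min_period[OF K(1)] by metis
  define m where "m = min (min \<eta> \<epsilon>) e"
  have m: "0 < m" "m \<le> \<eta>" "m \<le> \<epsilon>" "m \<le> e" using assms by (auto simp: m_def)
  define \<delta>' where "\<delta>' = m / 8"
  obtain \<kappa> where \<kappa>: "0 < \<kappa>" "\<kappa> \<le> 1" "\<kappa> \<le> p" "\<kappa> \<le> e" and b\<kappa>: "b * \<kappa> \<le> m / 8"
    using fine_scale[OF b(1) assms(9) m(1) p(1)] by metis
  have \<delta>'0: "0 < \<delta>'" using m(1) by (simp add: \<delta>'_def)
  obtain ct R where ct: "finite (range (case_prod ct))" "\<And>p q. 0 \<le> ct p q" "0 < R"
    "\<And>ps L. \<lbrakk>length ps = 2; segments_in K ps; sum_list (map snd ps) + R \<le> L\<rbrakk> \<Longrightarrow>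
       \<exists>y l. \<phi> l y = y \<and> L \<le> l \<and> l \<le> L + 5 * \<tau> \<and> orbit y \<inter> K\<^sub>0 \<noteq> {} \<and> tracks \<phi> ct \<delta>' y ps"
    using closed_gluing[OF K\<^sub>0 K(1) \<delta>'0, of 2] unfolding \<tau>_def by (metis one_le_numeral)
  obtain ct' R' where ct': "finite (range (case_prod ct'))" "\<And>p q. 0 \<le> ct' p q" "\<And>p q. ct' p q \<le> R'" "0 < R'"
    "\<And>ps L. \<lbrakk>length ps = 3; segments_in K ps; sum_list (map snd ps) + R' \<le> L\<rbrakk> \<Longrightarrow>
       \<exists>y l. \<phi> l y = y \<and> L \<le> l \<and> l \<le> L + 5 * \<tau> \<and> orbit y \<inter> K\<^sub>0 \<noteq> {} \<and> tracks \<phi> ct' \<delta>' y ps"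
    using closed_gluing[OF K\<^sub>0 K(1) \<delta>'0, of 3] unfolding \<tau>_def by (metis one_le_numeral)
  \<comment> \<open>The segment of \<open>x\<close> and the long piece of \<open>\<gamma>\<close> take at most \<open>T + (L + 5 \<tau> - (T + S)) = L - R\<close>.\<close>
  define S where "S = R + 5 * \<tau>"
  define S' where "S' = S + R'"
  define n where "n = bin \<kappa> (5 * \<tau>)"
  define M where "M = card (range (case_prod ct')) * (card (range (case_prod ct)) * (Suc n * 2))"
  define D where "D = 2 * (2 / \<kappa>) * real M"
  have "0 < S" using ct(3) \<tau> by (simp add: S_def)
  moreover have "0 < S'" using calculation ct'(4) by (simp add: S'_def)
  moreover have "0 < M" using ct(1) ct'(1) by (simp add: M_def card_gt_0_iff)
  then have "0 < D" using \<kappa>(1) by (simp add: D_def)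
  moreover have "(\<Sum>\<gamma>\<in>{\<gamma>\<in>P. primitive \<gamma>}. occ \<gamma> {q. q \<in> K \<and> \<phi> (T + S) q \<in> K}) \<le>
      D * real (card E) * (\<Sum>\<gamma>\<in>P. occ \<gamma> (cdyn_ball x \<epsilon> T))"
    if T: "0 < T" "T + S' \<le> L" and x: "x \<in> K" "\<phi> T x \<in> K"
      and E: "finite E" "chords \<phi> x y\<^sub>0 \<eta> (T + S') (T + S' + 5 * \<tau>) \<subseteq> (\<Union>z\<in>E. dyn_ball \<phi> z \<delta> (T + S'))"
      and P: "finite P" "P = PK \<phi> K\<^sub>0 L (L + 5 * \<tau>)" for x T E L P
  proof -
    define A where "A = {q. q \<in> K \<and> \<phi> (T + S) q \<in> K}"
    have "A = K \<inter> (\<lambda>q. \<phi> (T + S) q) -` K" by (auto simp: A_def)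
    moreover have "closed (K \<inter> (\<lambda>q. \<phi> (T + S) q) -` K)"
      using K(1) by (intro closed_Int closed_vimage compact_imp_closed continuous_intros)
    ultimately have "A \<in> sets borel" by simp
    define Prim where "Prim = {\<gamma>\<in>P. primitive \<gamma>}"
    have fin: "finite Prim" using P(1) by (simp add: Prim_def)
    have L: "T + S \<le> L" "5 * \<tau> \<le> L" "1 < L" using T ct(3) ct'(4) \<tau> by (auto simp: S_def S'_def)
    obtain V where V: "\<And>\<gamma>. finite (V \<gamma>)"
      "\<And>\<gamma> t. t \<in> V \<gamma> \<Longrightarrow> 0 \<le> t \<and> t \<le> snd \<gamma> \<and> \<phi> t (pt \<gamma>) \<in> A"
      "\<And>\<gamma> s s'. s \<in> V \<gamma> \<Longrightarrow> s' \<in> V \<gamma> \<Longrightarrow> \<bar>s - s'\<bar> < 1 \<Longrightarrow> s = s'"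
      "(\<Sum>\<gamma>\<in>Prim. occ \<gamma> A) \<le> 2 * real (card (Sigma Prim V))"
      using discretise_occ[OF fin, of A] \<open>A \<in> sets borel\<close> by metis
    \<comment> \<open>The positions from which an orbit tracks the segment of \<open>x\<close>, up to \<open>\<kappa>\<close>.\<close>
    define visits where "visits \<gamma> = {v\<in>{0..snd \<gamma>}. \<phi> v (pt \<gamma>) \<in> cdyn_ball x \<delta>' T}" for \<gamma>
    define net where "net \<gamma> S \<longleftrightarrow> finite S \<and> S \<subseteq> visits \<gamma> \<and> (\<forall>s\<in>S. \<forall>s'\<in>S. \<bar>s - s'\<bar> < \<kappa> \<longrightarrow> s = s') \<and>
        (\<forall>a\<in>visits \<gamma>. \<exists>s\<in>S. \<bar>a - s\<bar> < \<kappa>)" for \<gamma> S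
    have "\<exists>S. net \<gamma> S" for \<gamma>
      unfolding net_def by (rule separated_times[of _ "snd \<gamma>"]) (use \<kappa> in \<open>auto simp: visits_def\<close>)
    then obtain Q where "\<And>\<gamma>. net \<gamma> (Q \<gamma>)" by metis
    then have Q: "finite (Q \<gamma>)" "Q \<gamma> \<subseteq> visits \<gamma>" "\<forall>s\<in>Q \<gamma>. \<forall>s'\<in>Q \<gamma>. \<bar>s - s'\<bar> < \<kappa> \<longrightarrow> s = s'"
      "\<forall>a\<in>visits \<gamma>. \<exists>s\<in>Q \<gamma>. \<bar>a - s\<bar> < \<kappa>" for \<gamma>
      by (simp_all add: net_def)
    \<comment> \<open>The code of \<open>(\<gamma>, t)\<close>: an element \<open>z\<close> of \<open>E\<close> whose dynamical ball contains the chord, the glued orbit \<open>\<gamma>'\<close> with the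
        position on it at which the segment of \<open>x\<close> starts, the two connecting times, the period of \<open>\<gamma>\<close> up to
        \<open>\<kappa>\<close>, and the half of it in which \<open>t\<close> lies.\<close>
    define rel where "rel = (\<lambda>(\<gamma>, t) (z, (\<gamma>', u), c', c, j, f). \<exists>w y v.
        y = \<phi> v (pt \<gamma>') \<and> \<bar>v - u\<bar> < \<kappa> \<and> j = bin \<kappa> (snd \<gamma> - L) \<and> f = (t < snd \<gamma> / 2) \<and>
        0 \<le> c' \<and> c' \<le> R' \<and>
        (\<forall>r\<in>{0..T + S'}. dist (\<phi> r z) (\<phi> r w) < \<delta>) \<and>
        (\<forall>r\<in>{0..T + S}. dist (\<phi> (r + c') w) (\<phi> r (\<phi> t (pt \<gamma>))) \<le> \<delta>') \<and>
        (\<forall>r\<in>{0..snd \<gamma> - (T + S)}. dist (\<phi> (r + (T + c)) y) (\<phi> (r + (T + S)) (\<phi> t (pt \<gamma>))) \<le> \<delta>'))"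
    define X where "X = Sigma Prim V"
    define Y where "Y = E \<times> Sigma P Q \<times> range (case_prod ct') \<times> range (case_prod ct) \<times> {..n} \<times> (UNIV :: bool set)"
    have "card X \<le> card Y"
    proof (rule card_le_by_relation)
      show "finite Y" unfolding Y_def using P(1) Q(1) ct(1) ct'(1) E(1) by auto
    next
      fix \<xi> assume "\<xi> \<in> X"
      then obtain \<gamma> t where \<xi>: "\<xi> = (\<gamma>, t)" "\<gamma> \<in> P" "t \<in> V \<gamma>"
        by (auto simp: X_def Prim_def)
      note \<gamma> = PK_D[OF \<xi>(2)[unfolded P(2)]] V(2)[OF \<xi>(3)]
      define q where "q = \<phi> t (pt \<gamma>)"
      have q: "q \<in> K" "\<phi> (T + S) q \<in> K" using \<gamma> by (auto simp: q_def A_def)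
      have per: "\<phi> (snd \<gamma>) q = q"
        unfolding q_def by (rule flow_period_shift[OF periodic_orbitsD(2)[OF \<gamma>(1)]])
      \<comment> \<open>The chord passes from \<open>x\<close> through \<open>q\<close> and \<open>\<phi> (T + S) q\<close> to \<open>y\<^sub>0\<close>. It is cut out of a periodic orbit
          of which only the last connection, that to \<open>y\<^sub>0\<close>, has an uncontrolled length; adding \<open>c''\<close> to the
          length makes the window the same for all \<open>x\<close>.\<close>
      define c' where "c' = ct' x q"
      define c'' where "c'' = ct' y\<^sub>0 x"
      define ps' where "ps' = [(y\<^sub>0, 0), (x, 0), (q, T + S)]"
      have "segments_in K ps'" using K x q T \<open>0 < S\<close> by (simp add: ps'_def)
      moreover have "sum_list (map snd ps') + R' \<le> T + S' + c''"
        using ct'(2)[of y\<^sub>0 x] by (simp add: ps'_def S'_def c''_def)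
      ultimately obtain y' l' where y': "\<phi> l' y' = y'" "T + S' + c'' \<le> l'" "l' \<le> T + S' + c'' + 5 * \<tau>"
          "tracks \<phi> ct' \<delta>' y' ps'"
        using ct'(5)[of ps' "T + S' + c''"] by (auto simp: ps'_def)
      define w where "w = \<phi> c'' y'"
      have w: "dist y' y\<^sub>0 \<le> \<delta>'" "dist w x \<le> \<delta>'" "\<And>r. r \<in> {0..T + S} \<Longrightarrow> dist (\<phi> (r + c') w) (\<phi> r q) \<le> \<delta>'"
        using y'(4) by (auto simp: ps'_def w_def c''_def c'_def flow_flow add_ac)
      have "\<phi> (l' - c'') w = y'" using y'(1) by (simp add: w_def flow_flow)
      moreover have "l' - c'' \<in> {T + S'..T + S' + 5 * \<tau>}" using y' by simp
      ultimately have "y' \<in> (\<lambda>t. \<phi> t w) ` {T + S'..T + S' + 5 * \<tau>}" by (metis image_eqI)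
      moreover have "y' \<in> ball y\<^sub>0 \<eta>" "w \<in> ball x \<eta>"
        using w m by (auto simp: \<delta>'_def dist_commute)
      ultimately have "w \<in> chords \<phi> x y\<^sub>0 \<eta> (T + S') (T + S' + 5 * \<tau>)"
        unfolding chords_def by blast
      then obtain z where z: "z \<in> E" "w \<in> dyn_ball \<phi> z \<delta> (T + S')" using E(2) by auto
      \<comment> \<open>The periodic orbit in which the segment of \<open>x\<close> replaces the one of duration \<open>T + S\<close>.\<close>
      define c where "c = ct (\<phi> T x) (\<phi> (T + S) q)"
      define ps where "ps = [(x, T), (\<phi> (T + S) q, snd \<gamma> - (T + S))]"
      have "segments_in K ps"
        using x q T \<gamma> L per by (auto simp: ps_def flow_flow)
      moreover have "sum_list (map snd ps) + R \<le> L"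
        using \<gamma> by (simp add: ps_def S_def)
      ultimately obtain y l where y: "\<phi> l y = y" "L \<le> l" "l \<le> L + 5 * \<tau>" "orbit y \<inter> K\<^sub>0 \<noteq> {}" "tracks \<phi> ct \<delta>' y ps"
        using ct(4)[of ps L] by (auto simp: ps_def)
      have "0 < L" using L(3) by simp
      then obtain v where \<gamma>': "(orbit y, l) \<in> P" and v: "0 \<le> v" "v \<le> l" "y = \<phi> v (pt (orbit y, l))"
        using glued_orbit_position[OF y(1) _ y(2-4)] unfolding P(2) by metis
      have tr: "\<And>r. r \<in> {0..T} \<Longrightarrow> dist (\<phi> r y) (\<phi> r x) \<le> \<delta>'"
          "\<And>r. r \<in> {0..snd \<gamma> - (T + S)} \<Longrightarrow> dist (\<phi> (r + (T + c)) y) (\<phi> (r + (T + S)) q) \<le> \<delta>'"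
        using y(5) by (auto simp: ps_def c_def flow_flow)
      have "v \<in> visits (orbit y, l)"
        unfolding visits_def cdyn_ball_def using v tr(1) by (simp add: dist_commute)
      then obtain u where u: "u \<in> Q (orbit y, l)" "\<bar>v - u\<bar> < \<kappa>" using Q(4) by blast
      define \<zeta> where "\<zeta> = (z, ((orbit y, l), u), c', c, bin \<kappa> (snd \<gamma> - L), t < snd \<gamma> / 2)"
      have "c' \<in> range (case_prod ct')" "c \<in> range (case_prod ct)"
        unfolding c'_def c_def by (auto intro: rev_image_eqI[of "(x, q)"] rev_image_eqI[of "(\<phi> T x, \<phi> (T + S) q)"])
      then have "\<zeta> \<in> Y"
        unfolding Y_def \<zeta>_def n_def using \<gamma>' u(1) z(1) \<gamma> bin_le[OF \<kappa>(1)] by simp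
      moreover have "rel \<xi> \<zeta>"
        unfolding rel_def \<zeta>_def \<xi>(1) split
        by (rule exI[of _ w], rule exI[of _ y], rule exI[of _ v])
          (use v u w(3) z(2) tr(2) ct'(2,3)[of x q] in \<open>simp add: dyn_ball_def c'_def q_def\<close>)
      ultimately show "\<exists>\<zeta>\<in>Y. rel \<xi> \<zeta>" by blast
    next
      fix \<xi>\<^sub>1 \<xi>\<^sub>2 \<zeta> assume "\<xi>\<^sub>1 \<in> X" "\<xi>\<^sub>2 \<in> X" "\<zeta> \<in> Y" and rel: "rel \<xi>\<^sub>1 \<zeta>" "rel \<xi>\<^sub>2 \<zeta>"
      then obtain \<gamma>\<^sub>1 t\<^sub>1 \<gamma>\<^sub>2 t\<^sub>2 where \<xi>:
        "\<xi>\<^sub>1 = (\<gamma>\<^sub>1, t\<^sub>1)" "\<gamma>\<^sub>1 \<in> P" "primitive \<gamma>\<^sub>1" "t\<^sub>1 \<in> V \<gamma>\<^sub>1"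
        "\<xi>\<^sub>2 = (\<gamma>\<^sub>2, t\<^sub>2)" "\<gamma>\<^sub>2 \<in> P" "primitive \<gamma>\<^sub>2" "t\<^sub>2 \<in> V \<gamma>\<^sub>2"
        by (auto simp: X_def Prim_def)
      obtain z \<gamma>' u c' c j f where \<zeta>: "\<zeta> = (z, (\<gamma>', u), c', c, j, f)" by (metis surj_pair)
      note \<gamma>1 = PK_D[OF \<xi>(2)[unfolded P(2)]] V(2)[OF \<xi>(4)]
      note \<gamma>2 = PK_D[OF \<xi>(6)[unfolded P(2)]] V(2)[OF \<xi>(8)]
      obtain w\<^sub>1 y\<^sub>1 v\<^sub>1 where 1: "y\<^sub>1 = \<phi> v\<^sub>1 (pt \<gamma>')" "\<bar>v\<^sub>1 - u\<bar> < \<kappa>"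
        "j = bin \<kappa> (snd \<gamma>\<^sub>1 - L)" "f = (t\<^sub>1 < snd \<gamma>\<^sub>1 / 2)" "0 \<le> c'" "c' \<le> R'"
        "\<forall>r\<in>{0..T + S'}. dist (\<phi> r z) (\<phi> r w\<^sub>1) < \<delta>"
        "\<forall>r\<in>{0..T + S}. dist (\<phi> (r + c') w\<^sub>1) (\<phi> r (\<phi> t\<^sub>1 (pt \<gamma>\<^sub>1))) \<le> \<delta>'"
        "\<forall>r\<in>{0..snd \<gamma>\<^sub>1 - (T + S)}.
           dist (\<phi> (r + (T + c)) y\<^sub>1) (\<phi> (r + (T + S)) (\<phi> t\<^sub>1 (pt \<gamma>\<^sub>1))) \<le> \<delta>'"
        using rel(1) unfolding rel_def \<xi>(1) \<zeta> split by blast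
      obtain w\<^sub>2 y\<^sub>2 v\<^sub>2 where 2: "y\<^sub>2 = \<phi> v\<^sub>2 (pt \<gamma>')" "\<bar>v\<^sub>2 - u\<bar> < \<kappa>"
        "j = bin \<kappa> (snd \<gamma>\<^sub>2 - L)" "f = (t\<^sub>2 < snd \<gamma>\<^sub>2 / 2)" "0 \<le> c'" "c' \<le> R'"
        "\<forall>r\<in>{0..T + S'}. dist (\<phi> r z) (\<phi> r w\<^sub>2) < \<delta>"
        "\<forall>r\<in>{0..T + S}. dist (\<phi> (r + c') w\<^sub>2) (\<phi> r (\<phi> t\<^sub>2 (pt \<gamma>\<^sub>2))) \<le> \<delta>'"
        "\<forall>r\<in>{0..snd \<gamma>\<^sub>2 - (T + S)}.
           dist (\<phi> (r + (T + c)) y\<^sub>2) (\<phi> (r + (T + S)) (\<phi> t\<^sub>2 (pt \<gamma>\<^sub>2))) \<le> \<delta>'"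
        using rel(2) unfolding rel_def \<xi>(5) \<zeta> split by blast
      have v: "\<bar>v\<^sub>1 - v\<^sub>2\<bar> \<le> 2 * \<kappa>" using 1(2) 2(2) by linarith
      have l: "\<bar>snd \<gamma>\<^sub>1 - snd \<gamma>\<^sub>2\<bar> < \<kappa>"
        using bin_eqD[of \<kappa> "snd \<gamma>\<^sub>1 - L" "snd \<gamma>\<^sub>2 - L"] 1(3) 2(3) \<kappa>(1) \<gamma>1 \<gamma>2 by auto
      define q\<^sub>1 where "q\<^sub>1 = \<phi> t\<^sub>1 (pt \<gamma>\<^sub>1)"
      define q\<^sub>2 where "q\<^sub>2 = \<phi> t\<^sub>2 (pt \<gamma>\<^sub>2)"
      have close: "dist (\<phi> r q\<^sub>1) (\<phi> r q\<^sub>2) \<le> e" if r: "0 \<le> r" "r \<le> snd \<gamma>\<^sub>1" "r \<le> snd \<gamma>\<^sub>2" for r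
      proof (cases "r \<le> T + S")
        case True
        have "r + c' \<le> T + S'" using True 1(6) by (simp add: S'_def)
        then have "dist (\<phi> (r + c') z) (\<phi> (r + c') w\<^sub>1) < \<delta>" "dist (\<phi> (r + c') z) (\<phi> (r + c') w\<^sub>2) < \<delta>"
          using 1(7)[rule_format, of "r + c'"] 2(7)[rule_format, of "r + c'"] 1(5) r(1) by auto
        then have "dist (\<phi> (r + c') w\<^sub>1) (\<phi> (r + c') w\<^sub>2) \<le> 2 * \<delta>"
          using dist_triangle3[of "\<phi> (r + c') w\<^sub>1" "\<phi> (r + c') w\<^sub>2" "\<phi> (r + c') z"] by linarith
        then have "dist (\<phi> r q\<^sub>1) (\<phi> r q\<^sub>2) \<le> \<delta>' + 2 * \<delta> + \<delta>'"
          using 1(8)[rule_format, of r] 2(8)[rule_format, of r] r(1) True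
          by (intro dist_triangle_four[of _ "\<phi> (r + c') w\<^sub>1" _ "\<phi> (r + c') w\<^sub>2"]) (auto simp: dist_commute q\<^sub>1_def q\<^sub>2_def)
        then show ?thesis using assms(8) m by (simp add: \<delta>'_def)
      next
        case False
        have "dist (\<phi> r q\<^sub>1) (\<phi> r q\<^sub>2) \<le> \<delta>' + b * (2 * \<kappa> + 0) + \<delta>'"
          using 1(9)[rule_format, of "r - (T + S)"] 2(9)[rule_format, of "r - (T + S)"] r False
            dist_shift[OF b(2,1) v 1(1) 2(1), of "r - (T + S) + (T + c)" "r - (T + S) + (T + c)" 0]
          by (intro dist_triangle_four[of _ "\<phi> (r - (T + S) + (T + c)) y\<^sub>1" _ "\<phi> (r - (T + S) + (T + c)) y\<^sub>2"])
            (auto simp: dist_commute q\<^sub>1_def q\<^sub>2_def)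
        also have "\<dots> \<le> e" using b\<kappa> m by (simp add: \<delta>'_def)
        finally show ?thesis .
      qed
      have "q\<^sub>1 \<in> K" using \<gamma>1(5) by (auto simp: q\<^sub>1_def A_def)
      then have p: "\<And>t. 0 < t \<Longrightarrow> \<phi> t q\<^sub>1 = q\<^sub>1 \<Longrightarrow> p \<le> t" by (rule p(2))
      have "1 < snd \<gamma>\<^sub>1" "t\<^sub>1 < snd \<gamma>\<^sub>1 / 2 \<longleftrightarrow> t\<^sub>2 < snd \<gamma>\<^sub>2 / 2" using \<gamma>1 L 1(4) 2(4) by auto
      then have same: "\<gamma>\<^sub>1 = \<gamma>\<^sub>2 \<and> \<bar>t\<^sub>1 - t\<^sub>2\<bar> \<le> 1/2"
        using \<gamma>1(5) \<gamma>2(5) l \<kappa>(3,4) p close unfolding q\<^sub>1_def q\<^sub>2_def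
        by (intro same_visit[OF assms(10) \<gamma>1(1) \<gamma>2(1) \<xi>(3)]) auto
      then have "t\<^sub>1 = t\<^sub>2" using V(3)[of t\<^sub>1 \<gamma>\<^sub>1 t\<^sub>2] \<xi> by auto
      then show "\<xi>\<^sub>1 = \<xi>\<^sub>2" using \<xi> same by simp
    qed
    moreover have "card Y = card E * (card (Sigma P Q) * M)"
      by (simp add: Y_def M_def card_cartesian_product)
    moreover have "real (card (Sigma P Q)) \<le> (2 / \<kappa>) * (\<Sum>\<gamma>\<in>P. occ \<gamma> (cdyn_ball x \<epsilon> T))"
    proof -
      have "real (card (Sigma P Q)) = (\<Sum>\<gamma>\<in>P. real (card (Q \<gamma>)))" using P(1) Q(1) by (simp add: card_SigmaI)
      also have "\<dots> \<le> (\<Sum>\<gamma>\<in>P. (2 / \<kappa>) * occ \<gamma> (cdyn_ball x \<epsilon> T))"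
      proof (rule sum_mono)
        fix \<gamma> assume "\<gamma> \<in> P"
        note \<gamma> = PK_D[OF this[unfolded P(2)]]
        have "real (card (Q \<gamma>)) * (\<kappa> / 2) \<le> measure lborel {t\<in>{0..snd \<gamma>}. \<phi> t (pt \<gamma>) \<in> cdyn_ball x \<epsilon> T}"
        proof (rule card_separated_le_measure[OF Q(1)])
          show "Q \<gamma> \<subseteq> {0..snd \<gamma>}" using Q(2)[of \<gamma>] by (auto simp: visits_def)
          show "s = s'" if "s \<in> Q \<gamma>" "s' \<in> Q \<gamma>" "\<bar>s - s'\<bar> < \<kappa>" for s s' using Q(3)[of \<gamma>] that by blast
          show "0 < \<kappa>" "\<kappa> \<le> snd \<gamma>" using \<kappa> L \<gamma> by auto
          show "{t\<in>{0..snd \<gamma>}. \<phi> t (pt \<gamma>) \<in> cdyn_ball x \<epsilon> T} \<in> sets lborel"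
            by (intro sets_occ borel_closed closed_cdyn_ball)
        next
          fix s t assume s: "s \<in> Q \<gamma>" and t: "t \<in> {0..snd \<gamma>}" "\<bar>t - s\<bar> < \<kappa> / 2"
          have "dist (\<phi> r x) (\<phi> r (\<phi> t (pt \<gamma>))) \<le> \<epsilon>" if "r \<in> {0..T}" for r
          proof -
            have "dist (\<phi> r x) (\<phi> r (\<phi> s (pt \<gamma>))) \<le> \<delta>'"
              using Q(2)[of \<gamma>] s that by (auto simp: visits_def cdyn_ball_def)
            moreover have "dist (\<phi> r (\<phi> s (pt \<gamma>))) (\<phi> r (\<phi> t (pt \<gamma>))) \<le> b * (\<kappa> + 0)"
              using t(2) \<kappa>(1) by (intro dist_shift[OF b(2,1) _ refl refl]) (auto simp: abs_minus_commute)
            ultimately show ?thesis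
              using dist_triangle[of "\<phi> r x" "\<phi> r (\<phi> t (pt \<gamma>))" "\<phi> r (\<phi> s (pt \<gamma>))"] b\<kappa> m
              by (simp add: \<delta>'_def)
          qed
          then show "t \<in> {t\<in>{0..snd \<gamma>}. \<phi> t (pt \<gamma>) \<in> cdyn_ball x \<epsilon> T}"
            using t by (simp add: cdyn_ball_def)
        qed auto
        then show "real (card (Q \<gamma>)) \<le> (2 / \<kappa>) * occ \<gamma> (cdyn_ball x \<epsilon> T)"
          using \<kappa>(1) by (simp add: occ_def field_simps)
      qed
      finally show ?thesis by (simp add: sum_distrib_left)
    qed
    ultimately have *: "card X \<le> card E * (card (Sigma P Q) * M)"
      "real (card (Sigma P Q)) \<le> (2 / \<kappa>) * (\<Sum>\<gamma>\<in>P. occ \<gamma> (cdyn_ball x \<epsilon> T))" by simp_all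
    have "real (card X) \<le> real (card E) * (real (card (Sigma P Q)) * real M)"
      using *(1) by (metis of_nat_le_iff of_nat_mult)
    also have "\<dots> \<le> real (card E) * (((2 / \<kappa>) * (\<Sum>\<gamma>\<in>P. occ \<gamma> (cdyn_ball x \<epsilon> T))) * real M)"
      using *(2) by (intro mult_left_mono mult_right_mono) auto
    also have "\<dots> = D * real (card E) * (\<Sum>\<gamma>\<in>P. occ \<gamma> (cdyn_ball x \<epsilon> T)) / 2"
      by (simp add: D_def)
    finally have "2 * real (card X) \<le> D * real (card E) * (\<Sum>\<gamma>\<in>P. occ \<gamma> (cdyn_ball x \<epsilon> T))"
      by linarith
    then show ?thesis using V(4) unfolding Prim_def A_def X_def by linarith
  qed
  ultimately show ?thesis by (intro that[of S S' D]) (auto simp: \<tau>_def)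
qed

lemma nonprimitive_period:
  assumes "\<gamma> \<in> periodic_orbits \<phi>" "\<not> primitive \<gamma>" "x \<in> fst \<gamma>"
  obtains q where "0 < q" "q \<le> snd \<gamma> / 2" "\<phi> q x = x"
proof -
  obtain t where t: "0 < t" "t < snd \<gamma>" "\<phi> t (pt \<gamma>) = pt \<gamma>" using assms(2) by (auto simp: primitive_def)
  obtain s where s: "x = \<phi> s (pt \<gamma>)" using periodic_orbitsD(1)[OF assms(1)] assms(3) by auto
  have 1: "\<phi> t x = x" unfolding s by (rule flow_period_shift[OF t(3)])
  then have "\<phi> (- t) x = x" using flow_minus(1)[of t x] by simp
  then have 2: "\<phi> (snd \<gamma> - t) x = x"
    using flow_add[of "snd \<gamma>" "- t" x] periodic_orbit_period[OF assms(1,3)] by simp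
  show ?thesis
  proof (cases "t \<le> snd \<gamma> / 2")
    case True
    then show ?thesis using that[of t] t 1 by simp
  next
    case False
    then show ?thesis using that[of "snd \<gamma> - t"] t 2 by simp
  qed
qed

text \<open>If there are two distinct periodic orbits, those of \<open>a\<close> and \<open>b\<close>, then most periodic orbits are
  primitive. A non-primitive orbit through \<open>x\<close> of length about \<open>L\<close> has a period \<open>q\<close> of at most about
  \<open>L / 2\<close>. Following \<open>x\<close> only for the time \<open>q\<close> leaves time for turning \<open>i\<close> times around \<open>a\<close>,
  \<open>j\<close> times around \<open>b\<close> and \<open>k\<close> times around \<open>a\<close> again before, with about \<open>L\<^sup>2\<close> choices of \<open>(i, j)\<close>.
  The result is a periodic orbit of length about \<open>L\<close> that, with a position on it, determines
  \<open>i\<close>, \<open>j\<close>, \<open>k\<close> and then the original orbit up to bounded multiplicity. Since there are only about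
  \<open>L\<close> positions, one factor \<open>L\<close> is gained.\<close>

lemma nonprimitive_count:
  assumes K\<^sub>0: "compact K\<^sub>0" "interior K\<^sub>0 \<noteq> {}"
    and a: "\<phi> \<alpha> a = a" "0 < \<alpha>" and b: "\<phi> \<beta> b = b" "0 < \<beta>" and ab: "orbit a \<noteq> orbit b"
  obtains D L\<^sub>0 where "0 < D"
    "\<And>L. L\<^sub>0 \<le> L \<Longrightarrow> finite (PK \<phi> K\<^sub>0 L (L + 5 * tau_K \<phi> K\<^sub>0)) \<Longrightarrow>
       real (card {\<gamma>\<in>PK \<phi> K\<^sub>0 L (L + 5 * tau_K \<phi> K\<^sub>0). \<not> primitive \<gamma>}) * L
         \<le> D * real (card (PK \<phi> K\<^sub>0 L (L + 5 * tau_K \<phi> K\<^sub>0)))"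
proof -
  define \<tau> where "\<tau> = tau_K \<phi> K\<^sub>0"
  have \<tau>: "1 \<le> \<tau>" using tau_K_approx(1)[OF K\<^sub>0(2)] \<tau>_def by metis
  obtain B' where B': "0 < B'" "\<And>s t x. dist (\<phi> s x) (\<phi> t x) \<le> B' * \<bar>s - t\<bar>"
    using speed_bound by metis
  obtain p where p: "0 < p" "\<And>x t. x \<in> K\<^sub>0 \<Longrightarrow> 0 < t \<Longrightarrow> \<phi> t x = x \<Longrightarrow> p \<le> t"
    using min_period[OF K\<^sub>0(1)] by metis
  obtain e where e: "0 < e" "expansive_const e" using expansive_const_exists by metis
  have "orbit a \<inter> orbit b = {}" using ab orbit_eqI by blast
  obtain x\<^sub>0 where x\<^sub>0: "x\<^sub>0 \<in> orbit a" "\<And>x. x \<in> orbit a \<Longrightarrow> infdist x\<^sub>0 (orbit b) \<le> infdist x (orbit b)"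
    using continuous_attains_inf[OF compact_periodic_orbit[OF a], of "\<lambda>x. infdist x (orbit b)"]
    by (force intro!: continuous_intros)
  define d where "d = infdist x\<^sub>0 (orbit b)"
  have "0 < d"
    unfolding d_def using compact_imp_closed[OF compact_periodic_orbit[OF b]] x\<^sub>0(1) \<open>orbit a \<inter> orbit b = {}\<close>
    by (intro infdist_pos_not_in_closed) auto
  moreover have "d \<le> dist x y" if "x \<in> orbit a" "y \<in> orbit b" for x y
    unfolding d_def using x\<^sub>0(2)[OF that(1)] infdist_le[OF that(2), of x] by linarith
  ultimately have d: "0 < d" "\<And>x y. x \<in> orbit a \<Longrightarrow> y \<in> orbit b \<Longrightarrow> d \<le> dist x y" by auto
  define m where "m = min d e"
  have m: "0 < m" "m \<le> d" "m \<le> e" using d e by (auto simp: m_def)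
  define \<delta>' where "\<delta>' = m / 8"
  obtain \<kappa> where \<kappa>: "0 < \<kappa>" "\<kappa> \<le> 1" "\<kappa> \<le> p" "\<kappa> \<le> e" and b\<kappa>: "B' * \<kappa> \<le> m / 8"
    using fine_scale[OF B'(1) e(1) m(1) p(1)] by metis
  have \<delta>'0: "0 < \<delta>'" using m(1) by (simp add: \<delta>'_def)
  define C where "C = K\<^sub>0 \<union> {a, b}"
  have C: "compact C" using K\<^sub>0 by (simp add: C_def)
  obtain ct R where ct: "finite (range (case_prod ct))" "\<And>p q. 0 \<le> ct p q" "\<And>p q. ct p q \<le> R" "0 < R"
    "\<And>ps L. \<lbrakk>length ps = 5; segments_in C ps; sum_list (map snd ps) + R \<le> L\<rbrakk> \<Longrightarrow>
       \<exists>y l. \<phi> l y = y \<and> L \<le> l \<and> l \<le> L + 5 * \<tau> \<and> orbit y \<inter> K\<^sub>0 \<noteq> {} \<and> tracks \<phi> ct \<delta>' y ps"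
    using closed_gluing[OF K\<^sub>0 C \<delta>'0, of 5] unfolding \<tau>_def by (metis one_le_numeral)
  obtain Q where Q: "\<And>\<gamma>::'a set \<times> real. finite (Q \<gamma>)"
    "\<And>\<gamma> v. 0 \<le> v \<Longrightarrow> v \<le> snd \<gamma> \<Longrightarrow> \<exists>u\<in>Q \<gamma>. \<bar>v - u\<bar> < \<kappa>"
    "\<And>\<gamma>. \<kappa> \<le> snd \<gamma> \<Longrightarrow> real (card (Q \<gamma>)) \<le> 2 * snd \<gamma> / \<kappa>"
    using position_nets[OF \<kappa>(1)] by metis
  \<comment> \<open>Multiples of the two periods that exceed all connecting times.\<close>
  obtain n\<^sub>A where n\<^sub>A: "R < real n\<^sub>A * \<alpha>" using ex_less_of_nat_mult[OF a(2)] by metis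
  define A where "A = real n\<^sub>A * \<alpha>"
  have A: "R < A" "0 < A" "\<phi> A a = a" using n\<^sub>A flow_period_of_nat[OF a(1)] ct(4) by (auto simp: A_def)
  obtain n\<^sub>B where n\<^sub>B: "R < real n\<^sub>B * \<beta>" using ex_less_of_nat_mult[OF b(2)] by metis
  define B where "B = real n\<^sub>B * \<beta>"
  have B: "R < B" "0 < B" "\<phi> B b = b" using n\<^sub>B flow_period_of_nat[OF b(1)] ct(4) by (auto simp: B_def)
  have Ai: "\<phi> (real i * A) a = a" and Bi: "\<phi> (real i * B) b = b" for i
    using flow_period_of_nat A(3) B(3) by auto
  define c\<^sub>1 where "c\<^sub>1 = ct a b"
  define c\<^sub>2 where "c\<^sub>2 = ct b a"
  have c: "0 \<le> c\<^sub>1" "c\<^sub>1 < A" "0 \<le> c\<^sub>2" "c\<^sub>2 < B"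
    using ct(2,3)[of a b] ct(2,3)[of b a] A(1) B(1) by (auto simp: c\<^sub>1_def c\<^sub>2_def)
  have step: "real i * A + c\<^sub>1 \<le> real j * A" "real i * B + c\<^sub>2 \<le> real j * B" if "i < j" for i j :: nat
  proof -
    have "real (Suc i) * A \<le> real j * A" "real (Suc i) * B \<le> real j * B"
      using that A(2) B(2) by (intro mult_right_mono; simp)+
    then show "real i * A + c\<^sub>1 \<le> real j * A" "real i * B + c\<^sub>2 \<le> real j * B"
      using c by (simp_all add: algebra_simps)
  qed
  \<comment> \<open>The times at which the glued orbit starts the turns around \<open>b\<close> and the second turns around \<open>a\<close>,
      and at which it returns to \<open>b\<close>.\<close>
  define o\<^sub>1 where "o\<^sub>1 i = real i * A + c\<^sub>1" for i :: nat
  define o\<^sub>2 where "o\<^sub>2 i j = real j * B + c\<^sub>2 + o\<^sub>1 i" for i j :: nat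
  define o\<^sub>3 where "o\<^sub>3 i j k = real k * A + c\<^sub>1 + o\<^sub>2 i j" for i j k :: nat
  define good where "good y i j k x q c \<longleftrightarrow>
      (\<forall>r\<in>{0..real i * A}. dist (\<phi> r y) (\<phi> r a) \<le> \<delta>') \<and>
      (\<forall>r\<in>{0..real j * B}. dist (\<phi> (r + o\<^sub>1 i) y) (\<phi> r b) \<le> \<delta>') \<and>
      (\<forall>r\<in>{0..real k * A}. dist (\<phi> (r + o\<^sub>2 i j) y) (\<phi> r a) \<le> \<delta>') \<and>
      dist (\<phi> (o\<^sub>3 i j k) y) b \<le> \<delta>' \<and>
      (\<forall>r\<in>{0..q}. dist (\<phi> (r + (o\<^sub>3 i j k + c)) y) (\<phi> r x) \<le> \<delta>')" for y i j k x q c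
  \<comment> \<open>As the two orbits are disjoint, two orbits with close positions cannot be near \<open>a\<close> and near \<open>b\<close>
      at the same time. If the numbers of turns differed, this would happen at the first time that only
      one of them changes over.\<close>
  have clash: False
    if "dist (\<phi> s y) z \<le> \<delta>'" "z \<in> orbit b" "dist (\<phi> s y') z' \<le> \<delta>'" "z' \<in> orbit a"
      "dist (\<phi> s y) (\<phi> s y') \<le> B' * (2 * \<kappa> + 0)" for s y z y' z'
  proof -
    have "d \<le> dist z' z" using d(2) that by blast
    also have "\<dots> \<le> \<delta>' + B' * (2 * \<kappa> + 0) + \<delta>'"
      using that by (intro dist_triangle_four[of _ "\<phi> s y'" _ "\<phi> s y"]) (auto simp: dist_commute)
    also have "\<dots> < d" using b\<kappa> m by (simp add: \<delta>'_def)
    finally show False by simp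
  qed
  have eq_i: "\<not> i < i'" if "good y i j k x q c" "good y' i' j' k' x' q' c'"
      and "\<And>s. dist (\<phi> s y) (\<phi> s y') \<le> B' * (2 * \<kappa> + 0)" for y i j k x q c y' i' j' k' x' q' c'
  proof
    assume "i < i'"
    show False
    proof (rule clash)
      show "dist (\<phi> (o\<^sub>1 i) y) b \<le> \<delta>'"
        using that(1) B(2) unfolding good_def by (auto dest!: bspec[of _ _ 0])
      show "dist (\<phi> (o\<^sub>1 i) y') (\<phi> (o\<^sub>1 i) a) \<le> \<delta>'"
        using that(2) step(1)[OF \<open>i < i'\<close>] c A(2) unfolding good_def o\<^sub>1_def by auto
    qed (use that(3) orbit_self in auto)
  qed
  have eq_j: "\<not> j < j'" if "good y i j k x q c" "good y' i j' k' x' q' c'"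
      and "\<And>s. dist (\<phi> s y) (\<phi> s y') \<le> B' * (2 * \<kappa> + 0)" for y i j k x q c y' j' k' x' q' c'
  proof
    assume "j < j'"
    show False
    proof (rule clash)
      show "dist (\<phi> (o\<^sub>2 i j) y') (\<phi> (real j * B + c\<^sub>2) b) \<le> \<delta>'"
        using that(2) step(2)[OF \<open>j < j'\<close>] c B(2) unfolding good_def o\<^sub>2_def by auto
      show "dist (\<phi> (o\<^sub>2 i j) y) a \<le> \<delta>'"
        using that(1) A(2) unfolding good_def by (auto dest!: bspec[of _ _ 0])
    qed (use that(3) orbit_self in \<open>auto simp: dist_commute\<close>)
  qed
  have eq_k: "\<not> k < k'" if "good y i j k x q c" "good y' i j k' x' q' c'"
      and "\<And>s. dist (\<phi> s y) (\<phi> s y') \<le> B' * (2 * \<kappa> + 0)" for y i j k x q c y' k' x' q' c'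
  proof
    assume "k < k'"
    show False
    proof (rule clash)
      show "dist (\<phi> (o\<^sub>3 i j k) y) b \<le> \<delta>'"
        using that(1) unfolding good_def by auto
      show "dist (\<phi> (o\<^sub>3 i j k) y') (\<phi> (real k * A + c\<^sub>1) a) \<le> \<delta>'"
        using that(2) step(1)[OF \<open>k < k'\<close>] c A(2) unfolding good_def o\<^sub>3_def by auto
    qed (use that(3) orbit_self in auto)
  qed
  define n where "n = bin \<kappa> (5 * \<tau>)"
  define n' where "n' = bin \<kappa> (R + A + 5 * \<tau>)"
  define M where "M = card (range (case_prod ct)) * (Suc n' * Suc n)"
  define D where "D = (4 / \<kappa>) * real M * (64 * (A + B)\<^sup>2)"
  define L\<^sub>0 where "L\<^sub>0 = 8 * (A + B) + 4 * R + 10 * \<tau> + 1"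
  have "0 < M" using ct(1) by (simp add: M_def card_gt_0_iff)
  then have "0 < D" using \<kappa>(1) A(2) B(2) by (simp add: D_def)
  moreover have "real (card {\<gamma>\<in>P. \<not> primitive \<gamma>}) * L \<le> D * real (card P)"
    if L: "L\<^sub>0 \<le> L" and P: "finite P" "P = PK \<phi> K\<^sub>0 L (L + 5 * \<tau>)" for L P
  proof -
    define NP where "NP = {\<gamma>\<in>P. \<not> primitive \<gamma>}"
    have L': "8 * (A + B) \<le> L" "4 * R + 10 * \<tau> \<le> L" "1 < L" "5 * \<tau> \<le> L"
      using L \<tau> A B ct(4) by (auto simp: L\<^sub>0_def)
    define I where "I = nat \<lfloor>L / (4 * (A + B))\<rfloor>"
    have I: "real I * (A + B) \<le> L / 4" "L / (8 * (A + B)) \<le> real I"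
    proof -
      define h where "h = L / (4 * (A + B))"
      have h: "2 \<le> h" using L'(1) A(2) B(2) by (simp add: h_def field_simps)
      have "real I \<le> h" "h / 2 \<le> real I" using h unfolding I_def h_def[symmetric] by linarith+
      moreover have "h * (A + B) = L / 4" "h / 2 = L / (8 * (A + B))"
      proof -
        define G where "G = A + B"
        have "0 < G" using A(2) B(2) by (simp add: G_def)
        then show "h * (A + B) = L / 4" "h / 2 = L / (8 * (A + B))"
          unfolding h_def G_def[symmetric] by simp_all
      qed
      ultimately show "real I * (A + B) \<le> L / 4" "L / (8 * (A + B)) \<le> real I"
        using mult_right_mono[of "real I" h "A + B"] A(2) B(2) by simp_all
    qed
    \<comment> \<open>The code of \<open>(\<gamma>, i, j)\<close>: the glued orbit \<open>\<gamma>'\<close> with the position on it at which the turns around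
        \<open>a\<close> start, the connecting time from \<open>b\<close> to \<open>x\<close>, the time left at the end and the period of \<open>\<gamma>\<close> up
        to \<open>\<kappa>\<close>. Once \<open>i\<close>, \<open>j\<close> and \<open>k\<close> are known, the time left determines \<open>q\<close> up to \<open>\<kappa>\<close>.\<close>
    define rel where "rel = (\<lambda>(\<gamma>, i, j) ((\<gamma>', u), c, l', l). \<exists>y v x q k.
        y = \<phi> v (pt \<gamma>') \<and> \<bar>v - u\<bar> < \<kappa> \<and> x \<in> fst \<gamma> \<and> x \<in> K\<^sub>0 \<and> 0 < q \<and> \<phi> q x = x \<and>
        l = bin \<kappa> (snd \<gamma> - L) \<and> 0 \<le> snd \<gamma>' - (real i * A + real j * B + real k * A + q) \<and>
        l' = bin \<kappa> (snd \<gamma>' - (real i * A + real j * B + real k * A + q)) \<and> good y i j k x q c)"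
    define X where "X = NP \<times> {..<I} \<times> {..<I}"
    define Y where "Y = Sigma P Q \<times> range (case_prod ct) \<times> {..n'} \<times> {..n}"
    have "card X \<le> card Y"
    proof (rule card_le_by_relation)
      show "finite Y" unfolding Y_def using P(1) Q(1) ct(1) by auto
    next
      fix \<xi> assume "\<xi> \<in> X"
      then obtain \<gamma> i j where \<xi>: "\<xi> = (\<gamma>, i, j)" "\<gamma> \<in> P" "\<not> primitive \<gamma>" "i < I" "j < I"
        by (auto simp: X_def NP_def)
      note \<gamma> = PK_D[OF \<xi>(2)[unfolded P(2)]]
      obtain x where x: "x \<in> fst \<gamma>" "x \<in> K\<^sub>0" using \<gamma>(4) by blast
      obtain q where q: "0 < q" "q \<le> snd \<gamma> / 2" "\<phi> q x = x"
        using nonprimitive_period[OF \<gamma>(1) \<xi>(3) x(1)] by metis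
      have ij: "real i * A + real j * B \<le> L / 4"
      proof -
        have "real i * A \<le> real I * A" "real j * B \<le> real I * B"
          using \<xi> A(2) B(2) by (intro mult_right_mono; simp)+
        then show ?thesis using I(1) by (simp add: distrib_left)
      qed
      \<comment> \<open>The number of second turns around \<open>a\<close> uses up the remaining time.\<close>
      define rem where "rem = L - R - real i * A - real j * B - q"
      have "0 \<le> rem" using ij q(2) \<gamma>(3) L'(2) unfolding rem_def by linarith
      define k where "k = nat \<lfloor>rem / A\<rfloor>"
      have "0 \<le> rem / A" using \<open>0 \<le> rem\<close> A(2) by simp
      then have "real k \<le> rem / A" "rem / A < real k + 1" unfolding k_def by linarith+
      then have k: "real k * A \<le> rem" "rem < real k * A + A"
        using A(2) by (auto simp: field_simps)
      define ps where "ps = [(a, real i * A), (b, real j * B), (a, real k * A), (b, 0), (x, q)]"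
      have "segments_in C ps"
        using x q A(2) B(2) Ai Bi by (simp add: ps_def C_def)
      moreover have "sum_list (map snd ps) + R \<le> L"
        using k(1) by (simp add: ps_def rem_def)
      ultimately obtain y l where y: "\<phi> l y = y" "L \<le> l" "l \<le> L + 5 * \<tau>" "orbit y \<inter> K\<^sub>0 \<noteq> {}" "tracks \<phi> ct \<delta>' y ps"
        using ct(5)[of ps L] by (auto simp: ps_def)
      have "0 < L" using L'(3) by simp
      then obtain v where \<gamma>': "(orbit y, l) \<in> P" and v: "0 \<le> v" "v \<le> l" "y = \<phi> v (pt (orbit y, l))"
        using glued_orbit_position[OF y(1) _ y(2-4)] unfolding P(2) by metis
      obtain u where u: "u \<in> Q (orbit y, l)" "\<bar>v - u\<bar> < \<kappa>" using Q(2)[of v "(orbit y, l)"] v by auto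
      define t where "t = l - (real i * A + real j * B + real k * A + q)"
      have t: "0 \<le> t" "t \<le> R + A + 5 * \<tau>" using k y(2,3) ct(4) by (auto simp: t_def rem_def)
      define \<zeta> where "\<zeta> = (((orbit y, l), u), ct b x, bin \<kappa> t, bin \<kappa> (snd \<gamma> - L))"
      have "ct b x \<in> range (case_prod ct)" by (auto intro: rev_image_eqI[of "(b, x)"])
      then have \<zeta>Y: "\<zeta> \<in> Y"
        unfolding Y_def \<zeta>_def n_def n'_def using \<gamma>' u(1) t \<gamma> bin_le[OF \<kappa>(1)] by simp
      have good: "good y i j k x q (ct b x)"
        using y(5) Ai Bi unfolding good_def ps_def o\<^sub>3_def o\<^sub>2_def o\<^sub>1_def c\<^sub>1_def c\<^sub>2_def
        by (simp add: flow_flow add_ac)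
      have "rel \<xi> \<zeta>"
        unfolding rel_def \<zeta>_def \<xi>(1) split
        by (rule exI[of _ y], rule exI[of _ v], rule exI[of _ x], rule exI[of _ q], rule exI[of _ k])
          (use good v u x q t in \<open>simp add: t_def\<close>)
      then show "\<exists>\<zeta>\<in>Y. rel \<xi> \<zeta>" using \<zeta>Y by blast
    next
      fix \<xi>\<^sub>1 \<xi>\<^sub>2 \<zeta> assume "\<xi>\<^sub>1 \<in> X" "\<xi>\<^sub>2 \<in> X" "\<zeta> \<in> Y" and rel: "rel \<xi>\<^sub>1 \<zeta>" "rel \<xi>\<^sub>2 \<zeta>"
      then obtain \<gamma>\<^sub>1 i\<^sub>1 j\<^sub>1 \<gamma>\<^sub>2 i\<^sub>2 j\<^sub>2 where \<xi>:
        "\<xi>\<^sub>1 = (\<gamma>\<^sub>1, i\<^sub>1, j\<^sub>1)" "\<gamma>\<^sub>1 \<in> P" "\<xi>\<^sub>2 = (\<gamma>\<^sub>2, i\<^sub>2, j\<^sub>2)" "\<gamma>\<^sub>2 \<in> P"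
        by (auto simp: X_def NP_def)
      obtain \<gamma>' u c l' l where \<zeta>: "\<zeta> = ((\<gamma>', u), c, l', l)" by (metis surj_pair)
      note \<gamma>1 = PK_D[OF \<xi>(2)[unfolded P(2)]]
      note \<gamma>2 = PK_D[OF \<xi>(4)[unfolded P(2)]]
      obtain y\<^sub>1 v\<^sub>1 x\<^sub>1 q\<^sub>1 k\<^sub>1 where 1: "y\<^sub>1 = \<phi> v\<^sub>1 (pt \<gamma>')" "\<bar>v\<^sub>1 - u\<bar> < \<kappa>"
        "x\<^sub>1 \<in> fst \<gamma>\<^sub>1" "x\<^sub>1 \<in> K\<^sub>0" "0 < q\<^sub>1" "\<phi> q\<^sub>1 x\<^sub>1 = x\<^sub>1" "l = bin \<kappa> (snd \<gamma>\<^sub>1 - L)"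
        "0 \<le> snd \<gamma>' - (real i\<^sub>1 * A + real j\<^sub>1 * B + real k\<^sub>1 * A + q\<^sub>1)"
        "l' = bin \<kappa> (snd \<gamma>' - (real i\<^sub>1 * A + real j\<^sub>1 * B + real k\<^sub>1 * A + q\<^sub>1))"
        "good y\<^sub>1 i\<^sub>1 j\<^sub>1 k\<^sub>1 x\<^sub>1 q\<^sub>1 c"
        using rel(1) unfolding rel_def \<xi>(1) \<zeta> split by blast
      obtain y\<^sub>2 v\<^sub>2 x\<^sub>2 q\<^sub>2 k\<^sub>2 where 2: "y\<^sub>2 = \<phi> v\<^sub>2 (pt \<gamma>')" "\<bar>v\<^sub>2 - u\<bar> < \<kappa>"
        "x\<^sub>2 \<in> fst \<gamma>\<^sub>2" "x\<^sub>2 \<in> K\<^sub>0" "0 < q\<^sub>2" "\<phi> q\<^sub>2 x\<^sub>2 = x\<^sub>2" "l = bin \<kappa> (snd \<gamma>\<^sub>2 - L)"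
        "0 \<le> snd \<gamma>' - (real i\<^sub>2 * A + real j\<^sub>2 * B + real k\<^sub>2 * A + q\<^sub>2)"
        "l' = bin \<kappa> (snd \<gamma>' - (real i\<^sub>2 * A + real j\<^sub>2 * B + real k\<^sub>2 * A + q\<^sub>2))"
        "good y\<^sub>2 i\<^sub>2 j\<^sub>2 k\<^sub>2 x\<^sub>2 q\<^sub>2 c"
        using rel(2) unfolding rel_def \<xi>(3) \<zeta> split by blast
      have v: "\<bar>v\<^sub>1 - v\<^sub>2\<bar> \<le> 2 * \<kappa>" using 1(2) 2(2) by linarith
      have l: "\<bar>snd \<gamma>\<^sub>1 - snd \<gamma>\<^sub>2\<bar> < \<kappa>"
        using bin_eqD[of \<kappa> "snd \<gamma>\<^sub>1 - L" "snd \<gamma>\<^sub>2 - L"] 1(7) 2(7) \<kappa>(1) \<gamma>1 \<gamma>2 by auto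
      have close: "dist (\<phi> s y\<^sub>1) (\<phi> s y\<^sub>2) \<le> B' * (2 * \<kappa> + 0)"
        "dist (\<phi> s y\<^sub>2) (\<phi> s y\<^sub>1) \<le> B' * (2 * \<kappa> + 0)" for s
        using dist_shift[OF B'(2,1) v 1(1) 2(1), of s s 0] by (auto simp: dist_commute)
      have i: "i\<^sub>1 = i\<^sub>2"
        using eq_i[OF 1(10) 2(10) close(1)] eq_i[OF 2(10) 1(10) close(2)] by simp
      have j: "j\<^sub>1 = j\<^sub>2"
        using eq_j[OF 1(10) 2(10)[folded i] close(1)] eq_j[OF 2(10) 1(10)[unfolded i] close(2)] by simp
      have k: "k\<^sub>1 = k\<^sub>2"
        using eq_k[OF 1(10) 2(10)[folded i j] close(1)] eq_k[OF 2(10) 1(10)[unfolded i j] close(2)] by simp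
      have q: "\<bar>q\<^sub>1 - q\<^sub>2\<bar> < \<kappa>"
        using bin_eqD[OF _ \<kappa>(1) 1(8) 2(8)] 1(9) 2(9) unfolding i j k by simp
      have "\<bar>q\<^sub>1 - q\<^sub>2\<bar> \<le> e" using q \<kappa>(4) by linarith
      moreover have "dist (\<phi> r x\<^sub>1) (\<phi> r x\<^sub>2) \<le> e" if r: "0 \<le> r" "r \<le> q\<^sub>1" "r \<le> q\<^sub>2" for r
      proof -
        have "dist (\<phi> (r + (o\<^sub>3 i\<^sub>1 j\<^sub>1 k\<^sub>1 + c)) y\<^sub>1) (\<phi> r x\<^sub>1) \<le> \<delta>'"
          "dist (\<phi> (r + (o\<^sub>3 i\<^sub>1 j\<^sub>1 k\<^sub>1 + c)) y\<^sub>2) (\<phi> r x\<^sub>2) \<le> \<delta>'"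
          using 1(10) 2(10)[folded i j k] r unfolding good_def by auto
        then have "dist (\<phi> r x\<^sub>1) (\<phi> r x\<^sub>2) \<le> \<delta>' + B' * (2 * \<kappa> + 0) + \<delta>'"
          using close(1)
          by (intro dist_triangle_four[of _ "\<phi> (r + (o\<^sub>3 i\<^sub>1 j\<^sub>1 k\<^sub>1 + c)) y\<^sub>1" _ "\<phi> (r + (o\<^sub>3 i\<^sub>1 j\<^sub>1 k\<^sub>1 + c)) y\<^sub>2"])
            (auto simp: dist_commute)
        also have "\<dots> \<le> e" using b\<kappa> m by (simp add: \<delta>'_def)
        finally show ?thesis .
      qed
      ultimately obtain r where r: "x\<^sub>2 = \<phi> r x\<^sub>1"
        using expansive_constD[OF e(2) 1(6) 2(6) 1(5) 2(5)] by metis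
      have "\<And>t. 0 < t \<Longrightarrow> \<phi> t x\<^sub>1 = x\<^sub>1 \<Longrightarrow> p \<le> t" using 1(4) by (rule p(2))
      then have "\<gamma>\<^sub>1 = \<gamma>\<^sub>2"
        using less_le_trans[OF l \<kappa>(3)] by (intro periodic_orbits_eqI[OF \<gamma>1(1) \<gamma>2(1) 1(3) 2(3) r, of p]) auto
      then show "\<xi>\<^sub>1 = \<xi>\<^sub>2" using \<xi> i j by simp
    qed
    moreover have "card X = card NP * (I * I)" by (simp add: X_def card_cartesian_product)
    moreover have "card Y = card (Sigma P Q) * M"
      by (simp add: Y_def M_def card_cartesian_product)
    moreover have "real (card (Sigma P Q)) \<le> (4 * L / \<kappa>) * real (card P)"
      by (rule card_positions_le[OF P Q(1,3) \<kappa>(1)]) (use \<kappa>(2) L'(3) L'(4) in auto)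
    ultimately have *: "card NP * (I * I) \<le> card (Sigma P Q) * M"
      "real (card (Sigma P Q)) \<le> (4 * L / \<kappa>) * real (card P)" by simp_all
    have "real (card NP) * (real I * real I) \<le> real (card (Sigma P Q)) * real M"
      using *(1) by (metis of_nat_le_iff of_nat_mult)
    also have "\<dots> \<le> (4 * L / \<kappa>) * real (card P) * real M"
      using *(2) by (intro mult_right_mono) auto
    finally have 1: "real (card NP) * (real I * real I) \<le> (4 * L / \<kappa>) * real (card P) * real M" .
    have "0 \<le> L / (8 * (A + B))" using L' A(2) B(2) by simp
    then have "real (card NP) * (L / (8 * (A + B)) * (L / (8 * (A + B)))) \<le> real (card NP) * (real I * real I)"
      using I(2) by (intro mult_left_mono mult_mono) auto
    then have 2: "real (card NP) * (L / (8 * (A + B)) * (L / (8 * (A + B)))) \<le> (4 * L / \<kappa>) * real (card P) * real M"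
      using 1 by linarith
    have "L * (real (card NP) * L) = (real (card NP) * (L / (8 * (A + B)) * (L / (8 * (A + B))))) * (64 * (A + B)\<^sup>2)"
    proof -
      define G where "G = A + B"
      have "0 < G" using A(2) B(2) by (simp add: G_def)
      then show ?thesis unfolding G_def[symmetric] by (simp add: power2_eq_square)
    qed
    also have "\<dots> \<le> ((4 * L / \<kappa>) * real (card P) * real M) * (64 * (A + B)\<^sup>2)"
      by (rule mult_right_mono[OF 2]) simp
    also have "\<dots> = L * (D * real (card P))" by (simp add: D_def)
    finally show ?thesis using L'(3) unfolding NP_def by simp
  qed
  ultimately show ?thesis by (intro that[of D L\<^sub>0]) (auto simp: \<tau>_def)
qed

end

section \<open>Measures and vague limits\<close>

lemma Cc_bounded:
  assumes "f \<in> Cc" obtains B where "\<And>x. \<bar>f x\<bar> \<le> B"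
proof -
  obtain C where C: "compact C" "\<And>x. x \<notin> C \<Longrightarrow> f x = 0" and f: "continuous_on UNIV f"
    using assms by (auto simp: Cc_def)
  have "compact (f ` C)" by (intro compact_continuous_image C continuous_on_subset[OF f]) auto
  then obtain B where "0 < B" "\<And>y. y \<in> f ` C \<Longrightarrow> norm y \<le> B"
    using bounded_pos compact_imp_bounded by metis
  then have "\<bar>f x\<bar> \<le> B" for x using C(2)[of x] by (cases "x \<in> C") auto
  then show ?thesis by (rule that)
qed

lemma Cc_integrable:
  fixes f :: "'a::metric_space \<Rightarrow> real"
  assumes "f \<in> Cc" "finite_measure M" "sets M = sets borel"
  shows "integrable M f"
proof -
  obtain B where B: "\<And>x. \<bar>f x\<bar> \<le> B" using Cc_bounded[OF assms(1)] by metis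
  have "f \<in> borel_measurable borel"
    using assms(1) by (intro borel_measurable_continuous_onI) (auto simp: Cc_def)
  then have "f \<in> borel_measurable M" using assms(3) measurable_cong_sets by blast
  then show ?thesis using B by (intro finite_measure.integrable_const_bound[OF assms(2), of _ B]) auto
qed

lemma bump_function:
  fixes C V :: "'a::metric_space set"
  assumes "compact C" "open V" "C \<subseteq> V" "compact W" "V \<subseteq> W"
  obtains f where "f \<in> Cc" "\<And>x. 0 \<le> f x" "\<And>x. f x \<le> 1" "\<And>x. x \<in> C \<Longrightarrow> f x = 1" "\<And>x. x \<notin> V \<Longrightarrow> f x = 0"
proof (cases "C = {} \<or> V = UNIV")
  case True
  show ?thesis
  proof (cases "C = {}")
    case True
    show ?thesis by (rule that[of "\<lambda>_. 0"]) (use True in \<open>auto simp: Cc_def\<close>)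
  next
    case False
    then have "V = UNIV" "W = UNIV" using True assms(5) by auto
    then show ?thesis using assms(4) by (intro that[of "\<lambda>_. 1"]) (auto simp: Cc_def)
  qed
next
  case False
  obtain c where c: "c \<in> C" "\<And>x. x \<in> C \<Longrightarrow> infdist c (- V) \<le> infdist x (- V)"
    using continuous_attains_inf[OF assms(1), of "\<lambda>x. infdist x (- V)"] False
    by (force intro!: continuous_intros)
  define e where "e = infdist c (- V)"
  have e: "0 < e"
    unfolding e_def using assms(2,3) c(1) False by (intro infdist_pos_not_in_closed) auto
  define f where "f x = max 0 (1 - infdist x C / e)" for x
  have 0: "f x = 0" if "x \<notin> V" for x
  proof -
    have "e \<le> dist x y" if "y \<in> C" for y
      using c(2)[OF that] infdist_le[of x "- V" y] \<open>x \<notin> V\<close> by (simp add: e_def dist_commute)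
    then have "e \<le> infdist x C"
      using False by (simp add: infdist_notempty cINF_greatest)
    then show ?thesis using e by (simp add: f_def)
  qed
  show ?thesis
  proof (rule that[of f])
    have "continuous_on UNIV f" unfolding f_def using e by (intro continuous_intros) auto
    then show "f \<in> Cc" using 0 assms(4,5) unfolding Cc_def by blast
    show "f x \<le> 1" for x using e by (simp add: f_def infdist_nonneg)
    show "f x = 1" if "x \<in> C" for x using that by (simp add: f_def)
    show "f x = 0" if "x \<notin> V" for x by (rule 0[OF that])
  qed (simp add: f_def)
qed

lemma compact_inner_approx:
  fixes V :: "'a::metric_space set"
  assumes "finite_measure M" "sets M = sets borel" "open V" "compact W" "V \<subseteq> W" "w < measure M V"
  obtains C where "compact C" "C \<subseteq> V" "w < measure M C"
proof (cases "V = UNIV")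
  case True
  then have "compact V" using assms(4,5) by (simp add: top.extremum_unique)
  then show ?thesis using that[of V] assms(6) by simp
next
  case False
  define C where "C n = {x. inverse (real (Suc n)) \<le> infdist x (- V)}" for n
  have cl: "closed (C n)" for n
    unfolding C_def by (intro closed_Collect_le continuous_intros)
  have sub: "C n \<subseteq> V" for n
  proof
    fix x assume "x \<in> C n"
    then have "inverse (real (Suc n)) \<le> infdist x (- V)" by (simp add: C_def)
    moreover have "0 < inverse (real (Suc n))" by simp
    ultimately have "0 < infdist x (- V)" by linarith
    then show "x \<in> V" by (cases "x \<in> V") auto
  qed
  have "incseq C"
    unfolding C_def incseq_def
    by (auto intro: order_trans[rotated] simp: le_imp_inverse_le)
  moreover have "(\<Union>n. C n) = V"
  proof
    show "V \<subseteq> (\<Union>n. C n)"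
    proof
      fix x assume "x \<in> V"
      then have "0 < infdist x (- V)"
        using assms(3) False by (intro infdist_pos_not_in_closed) auto
      then obtain n where "inverse (real (Suc n)) < infdist x (- V)" using reals_Archimedean by blast
      then show "x \<in> (\<Union>n. C n)" by (auto simp: C_def intro: less_imp_le)
    qed
  qed (use sub in auto)
  moreover have "range C \<subseteq> sets M" using borel_closed[OF cl] assms(2) by auto
  ultimately have "(\<lambda>n. measure M (C n)) \<longlonglongrightarrow> measure M V"
    using finite_measure.finite_Lim_measure_incseq[OF assms(1), of C] by auto
  then have "eventually (\<lambda>n. w < measure M (C n)) sequentially" using assms(6) by (rule order_tendstoD(1))
  then obtain n where "w < measure M (C n)" by (auto simp: eventually_sequentially)
  moreover have "compact (C n)"
    using cl[of n] sub[of n] assms(4,5) by (metis closed_subset compact_imp_closed closed_Int_compact inf.absorb1 order_trans)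
  ultimately show ?thesis using that sub by blast
qed

lemma measure_le_integral_le_measure:
  fixes f :: "'a::metric_space \<Rightarrow> real"
  assumes M: "finite_measure M" "sets M = sets borel" and f: "f \<in> Cc" "\<And>x. 0 \<le> f x" "\<And>x. f x \<le> 1"
  shows "C \<in> sets borel \<Longrightarrow> (\<And>x. x \<in> C \<Longrightarrow> f x = 1) \<Longrightarrow> measure M C \<le> integral\<^sup>L M f"
    and "V \<in> sets borel \<Longrightarrow> (\<And>x. x \<notin> V \<Longrightarrow> f x = 0) \<Longrightarrow> integral\<^sup>L M f \<le> measure M V"
proof -
  interpret finite_measure M by (rule M(1))
  have int: "integrable M f" by (rule Cc_integrable[OF f(1) M])
  have ind: "integrable M (indicat_real A)" if "A \<in> sets borel" for A
    using that M(2) by (intro integrable_real_indicator) (auto simp: less_top[symmetric])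
  show "measure M C \<le> integral\<^sup>L M f" if "C \<in> sets borel" "\<And>x. x \<in> C \<Longrightarrow> f x = 1"
  proof -
    have "integral\<^sup>L M (indicator C) \<le> integral\<^sup>L M f"
      using that ind int f by (intro integral_mono) (auto simp: indicator_def)
    then show ?thesis using that M(2) by simp
  qed
  show "integral\<^sup>L M f \<le> measure M V" if "V \<in> sets borel" "\<And>x. x \<notin> V \<Longrightarrow> f x = 0"
  proof -
    have "integral\<^sup>L M f \<le> integral\<^sup>L M (indicator V)"
      using that ind int f by (intro integral_mono) (auto simp: indicator_def)
    then show ?thesis using that M(2) by simp
  qed
qed

text \<open>The portmanteau inequalities for relatively compact sets.\<close>

lemma vague_limit_open:
  fixes m :: "'a::metric_space measure"
  assumes "vague_limit ms m" "\<And>k. finite_measure (ms k)" "\<And>k. sets (ms k) = sets borel"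
    and "finite_measure m" "sets m = sets borel" "open V" "compact W" "V \<subseteq> W" "w < measure m V"
  shows "eventually (\<lambda>k. w < measure (ms k) V) sequentially"
proof -
  obtain C where C: "compact C" "C \<subseteq> V" "w < measure m C"
    using compact_inner_approx[OF assms(4-9)] by metis
  obtain f where f: "f \<in> Cc" "\<And>x. 0 \<le> f x" "\<And>x. f x \<le> 1" "\<And>x. x \<in> C \<Longrightarrow> f x = 1" "\<And>x. x \<notin> V \<Longrightarrow> f x = 0"
    using bump_function[OF C(1) assms(6) C(2) assms(7,8)] by metis
  have "w < integral\<^sup>L m f"
    using C measure_le_integral_le_measure(1)[OF assms(4,5) f(1-3), of C] f(4) by (simp add: borel_compact)
  then have "eventually (\<lambda>k. w < integral\<^sup>L (ms k) f) sequentially"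
    using assms(1) f(1) order_tendstoD(1) unfolding vague_limit_def by blast
  then show ?thesis
  proof (rule eventually_mono)
    fix k assume "w < integral\<^sup>L (ms k) f"
    also have "\<dots> \<le> measure (ms k) V"
      using measure_le_integral_le_measure(2)[OF assms(2,3) f(1-3), of V k] assms(6) f(5) by simp
    finally show "w < measure (ms k) V" .
  qed
qed

lemma vague_limit_compact:
  fixes m :: "'a::metric_space measure"
  assumes "vague_limit ms m" "\<And>k. finite_measure (ms k)" "\<And>k. sets (ms k) = sets borel"
    and "finite_measure m" "sets m = sets borel" "compact C" "C \<subseteq> V" "open V" "compact W" "V \<subseteq> W"
    and "eventually (\<lambda>k. w \<le> measure (ms k) C) sequentially"
  shows "w \<le> measure m V"
proof -
  obtain f where f: "f \<in> Cc" "\<And>x. 0 \<le> f x" "\<And>x. f x \<le> 1" "\<And>x. x \<in> C \<Longrightarrow> f x = 1" "\<And>x. x \<notin> V \<Longrightarrow> f x = 0"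
    using bump_function[OF assms(6,8,7,9,10)] by metis
  have "measure (ms k) C \<le> integral\<^sup>L (ms k) f" for k
    using assms(6) measure_le_integral_le_measure(1)[OF assms(2,3) f(1-3), of C k] f(4) by (simp add: borel_compact)
  then have "eventually (\<lambda>k. w \<le> integral\<^sup>L (ms k) f) sequentially"
    using assms(11) by (auto elim!: eventually_mono intro: order_trans)
  moreover have "(\<lambda>k. integral\<^sup>L (ms k) f) \<longlonglongrightarrow> integral\<^sup>L m f"
    using assms(1) f(1) by (simp add: vague_limit_def)
  ultimately have "w \<le> integral\<^sup>L m f"
    by (intro tendsto_lowerbound) auto
  also have "\<dots> \<le> measure m V"
    using measure_le_integral_le_measure(2)[OF assms(4,5) f(1-3), of V] assms(8) f(5) by simp
  finally show ?thesis .
qed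

context H_flow
begin

lemma flow_measurable: "\<phi> s \<in> borel_measurable borel"
  by (intro borel_measurable_continuous_onI continuous_on_flow continuous_on_const continuous_on_id)

lemma emeasure_mu_orbit:
  assumes "\<gamma> \<in> periodic_orbits \<phi>" "A \<in> sets borel"
  shows "emeasure (mu_orbit \<phi> \<gamma>) A = ennreal (occ \<gamma> A / snd \<gamma>)"
proof -
  define l where "l = snd \<gamma>"
  have l: "0 < l" using periodic_orbitsD(3)[OF assms(1)] by (simp add: l_def)
  have meas: "(\<lambda>t. \<phi> t (pt \<gamma>)) \<in> borel_measurable borel"
    by (intro borel_measurable_continuous_onI continuous_orbit)
  have E: "(\<lambda>t. \<phi> t (pt \<gamma>)) -` A \<in> sets borel" using measurable_sets_borel[OF meas assms(2)] by simp
  have "emeasure (mu_orbit \<phi> \<gamma>) A = emeasure (uniform_measure lborel {0..l}) ((\<lambda>t. \<phi> t (pt \<gamma>)) -` A)"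
    unfolding mu_orbit_def pt_def[symmetric] l_def[symmetric]
    by (subst emeasure_distr) (use meas assms(2) in \<open>auto simp: measurable_def\<close>)
  also have "\<dots> = emeasure lborel ({0..l} \<inter> (\<lambda>t. \<phi> t (pt \<gamma>)) -` A) / emeasure lborel {0..l}"
    using E by (intro emeasure_uniform_measure) auto
  also have "{0..l} \<inter> (\<lambda>t. \<phi> t (pt \<gamma>)) -` A = {t\<in>{0..l}. \<phi> t (pt \<gamma>) \<in> A}" by auto
  also have "emeasure lborel {t\<in>{0..l}. \<phi> t (pt \<gamma>) \<in> A} = ennreal (occ \<gamma> A)"
  proof -
    have "{t\<in>{0..l}. \<phi> t (pt \<gamma>) \<in> A} \<in> fmeasurable lborel"
      by (rule fmeasurableI2[of "{0..l}"]) (use sets_occ[OF assms(2)] in auto)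
    then show ?thesis unfolding occ_def l_def[symmetric] by (simp add: emeasure_eq_measure2)
  qed
  also have "emeasure lborel {0..l} = ennreal l" using l by simp
  finally show ?thesis
    using l occ_bounds(1)[of \<gamma> A] by (simp add: divide_ennreal l_def)
qed

lemma space_m_KL [simp]: "space (m_KL \<phi> K L) = UNIV"
  by (simp add: m_KL_def Let_def space_measure_of_conv)

lemma sets_m_KL [simp]: "sets (m_KL \<phi> K L) = sets borel"
  unfolding m_KL_def Let_def using sets.sigma_sets_eq[of borel]
  by (simp add: sets_measure_of_conv)

text \<open>This holds also if there are no or infinitely many orbits, when both sides vanish because \<open>0 / 0 = 0\<close>.\<close>

lemma emeasure_m_KL_sum:
  assumes "A \<in> sets borel"
  shows "emeasure (m_KL \<phi> K L) A =
    (\<Sum>\<gamma>\<in>PK \<phi> K L (L + 5 * tau_K \<phi> K). emeasure (mu_orbit \<phi> \<gamma>) A) / of_nat (card (PK \<phi> K L (L + 5 * tau_K \<phi> K)))"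
proof -
  define P where "P = PK \<phi> K L (L + 5 * tau_K \<phi> K)"
  define \<mu> where "\<mu> A = (\<Sum>\<gamma>\<in>P. emeasure (mu_orbit \<phi> \<gamma>) A) / (of_nat (card P) :: ennreal)" for A
  have "countably_additive (sets borel) \<mu>"
    unfolding countably_additive_def
  proof (intro allI impI)
    fix F :: "nat \<Rightarrow> 'a set" assume F: "range F \<subseteq> sets borel" "disjoint_family F"
    have "(\<Sum>i. \<mu> (F i)) = (\<Sum>i. \<Sum>\<gamma>\<in>P. emeasure (mu_orbit \<phi> \<gamma>) (F i)) / of_nat (card P)"
      unfolding \<mu>_def by (rule ennreal_suminf_divide)
    also have "(\<Sum>i. \<Sum>\<gamma>\<in>P. emeasure (mu_orbit \<phi> \<gamma>) (F i)) = (\<Sum>\<gamma>\<in>P. \<Sum>i. emeasure (mu_orbit \<phi> \<gamma>) (F i))"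
      by (rule suminf_sum) simp
    also have "\<dots> = (\<Sum>\<gamma>\<in>P. emeasure (mu_orbit \<phi> \<gamma>) (\<Union> (range F)))"
      using F by (intro sum.cong refl suminf_emeasure) (auto simp: mu_orbit_def)
    finally show "(\<Sum>i. \<mu> (F i)) = \<mu> (\<Union> (range F))" by (simp add: \<mu>_def)
  qed
  moreover have "positive (sets borel) \<mu>" by (simp add: positive_def \<mu>_def)
  moreover have "sigma_algebra UNIV (sets (borel :: 'a measure))"
    using sets.sigma_algebra_axioms[of "borel :: 'a measure"] by simp
  ultimately have "emeasure (measure_of UNIV (sets borel) \<mu>) A = \<mu> A"
    using assms by (intro emeasure_measure_of_sigma)
  then show ?thesis unfolding m_KL_def Let_def P_def[symmetric] \<mu>_def by simp
qed

lemma emeasure_m_KL_le_1: "A \<in> sets borel \<Longrightarrow> emeasure (m_KL \<phi> K L) A \<le> 1"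
proof -
  assume A: "A \<in> sets borel"
  define P where "P = PK \<phi> K L (L + 5 * tau_K \<phi> K)"
  have le: "emeasure (mu_orbit \<phi> \<gamma>) A \<le> 1" if "\<gamma> \<in> P" for \<gamma>
  proof -
    have \<gamma>: "\<gamma> \<in> periodic_orbits \<phi>" using that PK_D(1) by (simp add: P_def)
    have "occ \<gamma> A \<le> snd \<gamma>" "0 < snd \<gamma>"
      using occ_bounds(2)[of \<gamma> A] periodic_orbitsD(3)[OF \<gamma>] by auto
    then show ?thesis unfolding emeasure_mu_orbit[OF \<gamma> A] by (simp add: ennreal_le_1)
  qed
  have "(\<Sum>\<gamma>\<in>P. emeasure (mu_orbit \<phi> \<gamma>) A) \<le> (\<Sum>\<gamma>\<in>P. 1)" by (rule sum_mono[OF le])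
  also have "\<dots> = of_nat (card P)" by simp
  finally have le: "(\<Sum>\<gamma>\<in>P. emeasure (mu_orbit \<phi> \<gamma>) A) \<le> of_nat (card P)" .
  show ?thesis
  proof (cases "card P = 0")
    case True
    then show ?thesis unfolding emeasure_m_KL_sum[OF A] P_def[symmetric] using le by simp
  next
    case False
    have "(\<Sum>\<gamma>\<in>P. emeasure (mu_orbit \<phi> \<gamma>) A) / of_nat (card P) \<le> of_nat (card P) / of_nat (card P)"
      by (rule divide_right_mono_ennreal[OF le])
    also have "\<dots> = 1" using False by (intro ennreal_divide_self) (auto simp: of_nat_less_top)
    finally show ?thesis unfolding emeasure_m_KL_sum[OF A] P_def[symmetric] .
  qed
qed

lemma finite_measure_m_KL: "finite_measure (m_KL \<phi> K L)"
proof (rule finite_measureI)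
  have "emeasure (m_KL \<phi> K L) UNIV \<le> 1" by (rule emeasure_m_KL_le_1) simp
  then show "emeasure (m_KL \<phi> K L) (space (m_KL \<phi> K L)) \<noteq> \<infinity>"
    by (auto simp: top_unique)
qed

lemma measure_m_KL:
  assumes "A \<in> sets borel" "P = PK \<phi> K L (L + 5 * tau_K \<phi> K)"
  shows "measure (m_KL \<phi> K L) A = (\<Sum>\<gamma>\<in>P. occ \<gamma> A / snd \<gamma>) / real (card P)"
proof (cases "finite P \<and> P \<noteq> {}")
  case True
  have nn: "0 \<le> occ \<gamma> A / snd \<gamma>" if "\<gamma> \<in> P" for \<gamma>
    using periodic_orbitsD(3) PK_D(1) that assms(2) occ_bounds(1) by (metis divide_nonneg_pos less_imp_le)
  have "emeasure (m_KL \<phi> K L) A = (\<Sum>\<gamma>\<in>P. ennreal (occ \<gamma> A / snd \<gamma>)) / of_nat (card P)"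
    unfolding emeasure_m_KL_sum[OF assms(1)] assms(2)[symmetric]
    using emeasure_mu_orbit[OF _ assms(1)] PK_D(1) assms(2) by (metis (no_types, lifting) sum.cong)
  also have "(\<Sum>\<gamma>\<in>P. ennreal (occ \<gamma> A / snd \<gamma>)) = ennreal (\<Sum>\<gamma>\<in>P. occ \<gamma> A / snd \<gamma>)"
    using nn by (intro sum_ennreal)
  also have "\<dots> / of_nat (card P) = ennreal ((\<Sum>\<gamma>\<in>P. occ \<gamma> A / snd \<gamma>) / real (card P))"
    using True nn by (simp add: ennreal_of_nat_eq_real_of_nat divide_ennreal sum_nonneg card_gt_0_iff)
  finally show ?thesis
    using nn by (simp add: measure_def sum_nonneg)
next
  case False
  then have "emeasure (m_KL \<phi> K L) A = 0"
    unfolding emeasure_m_KL_sum[OF assms(1)] assms(2)[symmetric] by auto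
  then show ?thesis using False by (auto simp: measure_def)
qed

text \<open>Shifting by \<open>s\<close> does not change the time spent in \<open>A\<close>: cut the shifted period \<open>(r, l + r]\<close> at \<open>l\<close>.\<close>

lemma occ_vimage_flow:
  assumes "\<gamma> \<in> periodic_orbits \<phi>" "A \<in> sets borel"
  shows "occ \<gamma> (\<phi> s -` A) = occ \<gamma> A"
proof -
  define l where "l = snd \<gamma>"
  have l: "0 < l" "\<phi> l (pt \<gamma>) = pt \<gamma>"
    using periodic_orbitsD[OF assms(1)] by (auto simp: l_def)
  define E where "E = {t. \<phi> t (pt \<gamma>) \<in> A}"
  have "(\<lambda>t. \<phi> t (pt \<gamma>)) -` A \<in> sets borel"
    using assms(2) by (intro measurable_sets_borel[OF borel_measurable_continuous_onI[OF continuous_orbit]])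
  moreover have "(\<lambda>t. \<phi> t (pt \<gamma>)) -` A = E" by (auto simp: E_def)
  ultimately have E: "E \<in> sets borel" by simp
  have per: "t + of_int k * l \<in> E \<longleftrightarrow> t \<in> E" for t k
    using flow_period_of_int[OF l(2), of k] by (simp add: E_def flow_add)
  have shift: "measure lborel {t. t + c \<in> X} = measure lborel X" if "X \<in> sets borel" for X and c :: real
  proof -
    have "measure lborel X = measure (distr lborel borel ((+) c)) X" by (simp only: lborel_distr_plus)
    also have "\<dots> = measure lborel ((+) c -` X)" using that by (subst measure_distr) auto
    also have "(+) c -` X = {t. t + c \<in> X}" by (auto simp: add.commute)
    finally show ?thesis by simp
  qed
  define k where "k = \<lfloor>s / l\<rfloor>"
  define r where "r = s - of_int k * l"
  have "of_int k \<le> s / l" "s / l < of_int k + 1" unfolding k_def by linarith+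
  then have r: "0 \<le> r" "r < l" using l(1) by (auto simp: r_def field_simps)
  have fm: "{a<..b} \<inter> E \<in> fmeasurable lborel" for a b :: real
    by (rule fmeasurableI2[of "{a..b}"]) (use E in auto)
  have un: "measure lborel (({a<..b} \<inter> E) \<union> ({c<..d} \<inter> E)) =
      measure lborel ({a<..b} \<inter> E) + measure lborel ({c<..d} \<inter> E)"
    if "{a<..b} \<inter> {c<..d} = {}" for a b c d :: real
  proof -
    have "({a<..b} \<inter> E) \<inter> ({c<..d} \<inter> E) = {}" using that by blast
    then show ?thesis using measure_Un3[OF fm fm, of a b c d] by simp
  qed
  have occ: "occ \<gamma> B = measure lborel ({0<..l} \<inter> {t. \<phi> t (pt \<gamma>) \<in> B})" if "B \<in> sets borel" for B
  proof -
    have "{t. \<phi> t (pt \<gamma>) \<in> B} \<in> sets borel"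
      using that measurable_sets_borel[OF borel_measurable_continuous_onI[OF continuous_orbit], of B "pt \<gamma>"]
      by (simp add: vimage_def)
    then show ?thesis
      unfolding occ_def l_def[symmetric]
      using sets_occ[OF that] AE_lborel_singleton[of "0::real"]
      by (intro measure_eq_AE) (auto elim!: eventually_mono)
  qed
  have pre: "\<phi> s -` A \<in> sets borel" using measurable_sets_borel[OF flow_measurable assms(2)] by simp
  have "t \<in> {0<..l} \<inter> {t. \<phi> t (pt \<gamma>) \<in> \<phi> s -` A} \<longleftrightarrow> t + r \<in> {r<..l + r} \<inter> E" for t
  proof -
    have "\<phi> s (\<phi> t (pt \<gamma>)) \<in> A \<longleftrightarrow> (t + r) + of_int k * l \<in> E"
      by (simp add: E_def flow_flow r_def add.commute)
    then show ?thesis using per by auto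
  qed
  then have "{0<..l} \<inter> {t. \<phi> t (pt \<gamma>) \<in> \<phi> s -` A} = {t. t + r \<in> {r<..l + r} \<inter> E}" by blast
  then have "occ \<gamma> (\<phi> s -` A) = measure lborel ({r<..l + r} \<inter> E)"
    using occ[OF pre] shift[of "{r<..l + r} \<inter> E" r] E by simp
  also have "{r<..l + r} \<inter> E = ({r<..l} \<inter> E) \<union> ({l<..l + r} \<inter> E)" using r by auto
  also have "measure lborel \<dots> = measure lborel ({r<..l} \<inter> E) + measure lborel ({l<..l + r} \<inter> E)"
    by (rule un) auto
  also have "measure lborel ({l<..l + r} \<inter> E) = measure lborel {t. t + l \<in> {l<..l + r} \<inter> E}"
    using shift[of "{l<..l + r} \<inter> E" l] E by simp
  also have "{t. t + l \<in> {l<..l + r} \<inter> E} = {0<..r} \<inter> E"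
    using per[of _ 1] by auto
  also have "measure lborel ({r<..l} \<inter> E) + measure lborel ({0<..r} \<inter> E) =
      measure lborel (({r<..l} \<inter> E) \<union> ({0<..r} \<inter> E))"
    by (rule un[symmetric]) auto
  also have "({r<..l} \<inter> E) \<union> ({0<..r} \<inter> E) = {0<..l} \<inter> E" using r by auto
  also have "measure lborel ({0<..l} \<inter> E) = occ \<gamma> A" using occ[OF assms(2)] by (simp add: E_def)
  finally show ?thesis .
qed

lemma measure_m_KL_invariant: "distr (m_KL \<phi> K L) borel (\<phi> s) = m_KL \<phi> K L"
proof (rule measure_eqI)
  fix A assume "A \<in> sets (distr (m_KL \<phi> K L) borel (\<phi> s))"
  then have A: "A \<in> sets borel" by simp
  have pre: "\<phi> s -` A \<in> sets borel" using measurable_sets_borel[OF flow_measurable A] by simp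
  have "\<phi> s \<in> measurable (m_KL \<phi> K L) borel" using flow_measurable measurable_cong_sets sets_m_KL by blast
  then have "emeasure (distr (m_KL \<phi> K L) borel (\<phi> s)) A = emeasure (m_KL \<phi> K L) (\<phi> s -` A)"
    using A by (subst emeasure_distr) auto
  also have "\<dots> = emeasure (m_KL \<phi> K L) A"
    unfolding emeasure_m_KL_sum[OF A] emeasure_m_KL_sum[OF pre]
    using emeasure_mu_orbit[OF _ A] emeasure_mu_orbit[OF _ pre] occ_vimage_flow[OF _ A] PK_D(1)
    by (intro arg_cong2[where f = "(/)"] sum.cong refl) metis
  finally show "emeasure (distr (m_KL \<phi> K L) borel (\<phi> s)) A = emeasure (m_KL \<phi> K L) A" .
qed simp

text \<open>Vague limits of the measures on periodic orbits are flow invariant.\<close>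

lemma vague_limit_invariant:
  assumes "vague_limit (\<lambda>k. m_KL \<phi> K (L k)) m" "finite_measure m" "sets m = sets borel"
    and "open V" "compact W" "V \<subseteq> W"
  shows "measure m V \<le> measure m (\<phi> s -` V)"
proof (rule dense_le)
  fix w assume "w < measure m V"
  then obtain C where C: "compact C" "C \<subseteq> V" "w < measure m C"
    using compact_inner_approx[OF assms(2-6)] by metis
  obtain f where f: "f \<in> Cc" "\<And>x. 0 \<le> f x" "\<And>x. f x \<le> 1" "\<And>x. x \<in> C \<Longrightarrow> f x = 1" "\<And>x. x \<notin> V \<Longrightarrow> f x = 0"
    using bump_function[OF C(1) assms(4) C(2) assms(5,6)] by metis
  define h where "h x = f (\<phi> s x)" for x
  have "h \<in> Cc"
  proof -
    have f': "continuous_on UNIV f" using f(1) by (simp add: Cc_def)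
    have "continuous_on UNIV h"
      unfolding h_def by (rule continuous_on_compose2[OF f' continuous_on_flow[OF continuous_on_const continuous_on_id]]) auto
    moreover have "compact (\<phi> (- s) ` W)"
      by (intro compact_continuous_image continuous_on_flow continuous_on_const continuous_on_id assms(5))
    moreover have "h x = 0" if "x \<notin> \<phi> (- s) ` W" for x
    proof -
      have "\<phi> s x \<notin> W" using that flow_minus(1)[of s x] by (metis image_eqI)
      then show ?thesis using f(5) assms(6) by (auto simp: h_def)
    qed
    ultimately show ?thesis unfolding Cc_def by blast
  qed
  have "integral\<^sup>L (m_KL \<phi> K (L k)) h = integral\<^sup>L (m_KL \<phi> K (L k)) f" for k
  proof -
    have "\<phi> s \<in> measurable (m_KL \<phi> K (L k)) borel" using flow_measurable measurable_cong_sets sets_m_KL by blast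
    moreover have "f \<in> borel_measurable borel"
      using f(1) by (intro borel_measurable_continuous_onI) (auto simp: Cc_def)
    ultimately have "integral\<^sup>L (distr (m_KL \<phi> K (L k)) borel (\<phi> s)) f = integral\<^sup>L (m_KL \<phi> K (L k)) h"
      unfolding h_def by (rule integral_distr)
    then show ?thesis by (simp add: measure_m_KL_invariant)
  qed
  then have "(\<lambda>k. integral\<^sup>L (m_KL \<phi> K (L k)) f) \<longlonglongrightarrow> integral\<^sup>L m h"
    using assms(1) \<open>h \<in> Cc\<close> unfolding vague_limit_def by (metis (no_types, lifting) ext)
  moreover have "(\<lambda>k. integral\<^sup>L (m_KL \<phi> K (L k)) f) \<longlonglongrightarrow> integral\<^sup>L m f"
    using assms(1) f(1) unfolding vague_limit_def by blast
  ultimately have eq: "integral\<^sup>L m h = integral\<^sup>L m f" by (rule LIMSEQ_unique)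
  have "w < integral\<^sup>L m f"
    using C measure_le_integral_le_measure(1)[OF assms(2,3) f(1-3), of C] f(4) by (simp add: borel_compact)
  also have "\<dots> \<le> measure m (\<phi> s -` V)"
    unfolding eq[symmetric]
    by (rule measure_le_integral_le_measure(2)[OF assms(2,3) \<open>h \<in> Cc\<close>])
      (use f assms(4) measurable_sets_borel[OF flow_measurable, of V] in \<open>auto simp: h_def\<close>)
  finally show "w \<le> measure m (\<phi> s -` V)" by simp
qed

end

section \<open>The measure of dynamical balls\<close>

lemma separating_subset: "separating \<phi> \<delta> T E \<Longrightarrow> F \<subseteq> E \<Longrightarrow> separating \<phi> \<delta> T F"
  unfolding separating_def by blast

text \<open>The upper estimate only involves finite separated sets, since an infinite one has arbitrarily large
  finite subsets.\<close>

lemma emeasure_le_divide_N_chords: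
  assumes "finite_measure m" "0 < D"
    and le: "\<And>F. \<lbrakk>finite F; F \<subseteq> chords \<phi> x y \<eta> a b; separating \<phi> \<delta> a F\<rbrakk> \<Longrightarrow> measure m U * real (card F) \<le> D"
  shows "emeasure m U \<le> ennreal D / N_chords \<phi> x y \<eta> a b \<delta>"
proof -
  interpret finite_measure m by (rule assms(1))
  define N where "N = N_chords \<phi> x y \<eta> a b \<delta>"
  have "emeasure m U * emeasure (count_space UNIV) E \<le> ennreal D"
    if E: "E \<subseteq> chords \<phi> x y \<eta> a b" "separating \<phi> \<delta> a E" for E
  proof (cases "finite E")
    case True
    have "emeasure m U * emeasure (count_space UNIV) E = ennreal (measure m U * real (card E))"
      using True by (simp add: emeasure_eq_measure ennreal_mult ennreal_of_nat_eq_real_of_nat)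
    then show ?thesis using le[OF True E] by (simp add: ennreal_leI)
  next
    case False
    have "measure m U = 0"
    proof (rule ccontr)
      assume "measure m U \<noteq> 0"
      then have pos: "0 < measure m U" by (simp add: zero_less_measure_iff)
      obtain n :: nat where n: "D < real n * measure m U" using ex_less_of_nat_mult[OF pos] by metis
      obtain F where F: "F \<subseteq> E" "finite F" "card F = n" using infinite_arbitrarily_large[OF False] by metis
      then show False using le[OF F(2)] separating_subset[OF E(2) F(1)] E(1) n by (auto simp: mult.commute)
    qed
    then show ?thesis by (simp add: emeasure_eq_measure)
  qed
  then have mult: "emeasure m U * N \<le> ennreal D"
    unfolding N_def N_chords_def SUP_mult_left_ennreal[symmetric]
    by (subst SUP_mult_left_ennreal) (auto intro!: SUP_least)
  show ?thesis
  proof (cases "N = 0 \<or> N = \<infinity>")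
    case True
    then show ?thesis
    proof
      assume "N = 0"
      then show ?thesis using assms(2) unfolding N_def[symmetric] by (simp add: ennreal_divide_zero)
    next
      assume "N = \<infinity>"
      have "emeasure m U = 0"
        using mult \<open>N = \<infinity>\<close> by (auto simp: ennreal_mult_top top_unique split: if_splits)
      then show ?thesis by simp
    qed
  next
    case False
    then have "emeasure m U = emeasure m U * N / N"
      by (simp add: mult_divide_eq_ennreal less_top)
    also have "\<dots> \<le> ennreal D / N" by (rule divide_right_mono_ennreal[OF mult])
    finally show ?thesis by (simp add: N_def)
  qed
qed

text \<open>The lower estimate only involves one maximal separated set of chords, which is covering. If it is
  infinite, the number of chords is infinite and there is nothing to show.\<close>

lemma divide_N_chords_le_emeasure:
  assumes "finite_measure m" "0 < \<delta>" "0 \<le> D"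
    and le: "\<And>E. \<lbrakk>finite E; chords \<phi> x y \<eta> a b \<subseteq> (\<Union>z\<in>E. dyn_ball \<phi> z \<delta> a)\<rbrakk> \<Longrightarrow>
       E \<noteq> {} \<and> D \<le> measure m U * real (card E)"
  shows "ennreal D / N_chords \<phi> x y \<eta> a b \<delta> \<le> emeasure m U"
proof -
  interpret finite_measure m by (rule assms(1))
  define N where "N = N_chords \<phi> x y \<eta> a b \<delta>"
  define X where "X = chords \<phi> x y \<eta> a b"
  obtain E where E: "E \<subseteq> X"
    "\<And>p q. p \<in> E \<Longrightarrow> q \<in> E \<Longrightarrow> p \<noteq> q \<Longrightarrow> \<exists>t\<in>{0..a}. \<delta> \<le> dist (\<phi> t p) (\<phi> t q)"
    "\<And>p. p \<in> X \<Longrightarrow> \<exists>s\<in>E. p = s \<or> \<not> (\<exists>t\<in>{0..a}. \<delta> \<le> dist (\<phi> t p) (\<phi> t s))"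
    by (rule maximal_separated_set[of "\<lambda>p q. \<exists>t\<in>{0..a}. \<delta> \<le> dist (\<phi> t p) (\<phi> t q)" X]) (auto simp: dist_commute)
  have cover: "X \<subseteq> (\<Union>z\<in>E. dyn_ball \<phi> z \<delta> a)"
  proof
    fix p assume "p \<in> X"
    then obtain s where "s \<in> E" "p = s \<or> \<not> (\<exists>t\<in>{0..a}. \<delta> \<le> dist (\<phi> t p) (\<phi> t s))" using E(3) by blast
    then show "p \<in> (\<Union>z\<in>E. dyn_ball \<phi> z \<delta> a)"
      using assms(2) by (intro UN_I[of s]) (auto simp: dyn_ball_def not_le dist_commute)
  qed
  have N: "emeasure (count_space UNIV) E \<le> N"
    unfolding N_def N_chords_def using E(1,2) cover
    by (intro SUP_upper) (auto simp: X_def separating_def)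
  show ?thesis
  proof (cases "finite E")
    case True
    then have *: "E \<noteq> {}" "D \<le> measure m U * real (card E)" using le cover by (auto simp: X_def)
    have N': "of_nat (card E) \<le> N" using N True by simp
    have "0 < (of_nat (card E) :: ennreal)" using *(1) True by (simp add: card_gt_0_iff)
    then have "0 < N" using N' by (rule less_le_trans)
    moreover have "ennreal D \<le> N * emeasure m U"
    proof -
      have "ennreal D \<le> ennreal (measure m U * real (card E))" using *(2) by (rule ennreal_leI)
      also have "\<dots> = of_nat (card E) * emeasure m U"
        by (simp add: emeasure_eq_measure ennreal_mult ennreal_of_nat_eq_real_of_nat mult.commute)
      also have "\<dots> \<le> N * emeasure m U" using N' by (rule mult_right_mono) simp
      finally show ?thesis .
    qed
    ultimately show ?thesis unfolding N_def[symmetric] by (rule divide_le_posI_ennreal)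
  next
    case False
    then have "N = top" using N by (simp add: top_unique)
    then show ?thesis unfolding N_def[symmetric] by simp
  qed
qed

context H_flow
begin

text \<open>Replacing the fractions of time by the times spent, and restricting to primitive orbits.\<close>

lemma sum_occ_fraction_le:
  assumes "P = PK \<phi> K\<^sub>0 L (L + c)" "finite P" "0 < L"
  shows "(\<Sum>\<gamma>\<in>P. occ \<gamma> A / snd \<gamma>) \<le> (\<Sum>\<gamma>\<in>{\<gamma>\<in>P. primitive \<gamma>}. occ \<gamma> A) / L + real (card {\<gamma>\<in>P. \<not> primitive \<gamma>})"
proof -
  have b: "occ \<gamma> A / snd \<gamma> \<le> occ \<gamma> A / L" "occ \<gamma> A / snd \<gamma> \<le> 1" if "\<gamma> \<in> P" for \<gamma>
  proof -
    have \<gamma>: "L \<le> snd \<gamma>" using that assms(1) PK_D(2) by simp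
    then show "occ \<gamma> A / snd \<gamma> \<le> occ \<gamma> A / L" "occ \<gamma> A / snd \<gamma> \<le> 1"
      using occ_bounds[of \<gamma> A] assms(3) by (auto intro!: divide_left_mono)
  qed
  have "P = {\<gamma>\<in>P. primitive \<gamma>} \<union> {\<gamma>\<in>P. \<not> primitive \<gamma>}" by auto
  then have "(\<Sum>\<gamma>\<in>P. occ \<gamma> A / snd \<gamma>) =
      (\<Sum>\<gamma>\<in>{\<gamma>\<in>P. primitive \<gamma>}. occ \<gamma> A / snd \<gamma>) + (\<Sum>\<gamma>\<in>{\<gamma>\<in>P. \<not> primitive \<gamma>}. occ \<gamma> A / snd \<gamma>)"
    using assms(2) sum.union_disjoint[of "{\<gamma>\<in>P. primitive \<gamma>}" "{\<gamma>\<in>P. \<not> primitive \<gamma>}" "\<lambda>\<gamma>. occ \<gamma> A / snd \<gamma>"] by auto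
  also have "\<dots> \<le> (\<Sum>\<gamma>\<in>{\<gamma>\<in>P. primitive \<gamma>}. occ \<gamma> A / L) + (\<Sum>\<gamma>\<in>{\<gamma>\<in>P. \<not> primitive \<gamma>}. 1)"
    using b by (intro add_mono sum_mono) auto
  finally show ?thesis by (simp add: sum_divide_distrib)
qed

lemma sum_occ_le_fraction:
  assumes "P = PK \<phi> K\<^sub>0 L (L + c)" "0 < L"
  shows "(\<Sum>\<gamma>\<in>P. occ \<gamma> A) \<le> (L + c) * (\<Sum>\<gamma>\<in>P. occ \<gamma> A / snd \<gamma>)"
  unfolding sum_distrib_left
proof (rule sum_mono)
  fix \<gamma> assume "\<gamma> \<in> P"
  then have \<gamma>: "L \<le> snd \<gamma>" "snd \<gamma> \<le> L + c" using assms(1) PK_D by auto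
  have "occ \<gamma> A = snd \<gamma> * (occ \<gamma> A / snd \<gamma>)" using \<gamma> assms(2) by simp
  also have "\<dots> \<le> (L + c) * (occ \<gamma> A / snd \<gamma>)"
    using \<gamma> assms(2) occ_bounds(1)[of \<gamma> A] by (intro mult_right_mono) auto
  finally show "occ \<gamma> A \<le> (L + c) * (occ \<gamma> A / snd \<gamma>)" .
qed

text \<open>The two estimates when there are at least two periodic orbits. The bounds of the counts,
  divided by \<open>L\<close> and by the number of periodic orbits of length about \<open>L\<close>, pass to the vague limit.\<close>

lemma bounds_two_orbits:
  assumes K\<^sub>0: "compact K\<^sub>0" "interior K\<^sub>0 \<noteq> {}"
    and K: "compact K" "y\<^sub>0 \<in> K" and C: "compact C" "\<And>x. x \<in> K \<Longrightarrow> ball x r \<subseteq> C"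
    and m: "finite_measure m" "sets m = sets borel" "measure m UNIV * (3/4) < measure m (interior K)"
    and L: "filterlim L at_top sequentially" "vague_limit (\<lambda>k. m_KL \<phi> K\<^sub>0 (L k)) m"
    and orbits: "\<phi> \<alpha> a = a" "0 < \<alpha>" "\<phi> \<beta> b = b" "0 < \<beta>" "orbit a \<noteq> orbit b"
    and e: "0 < e" "expansive_const e"
    and \<delta>: "0 < \<delta>" "4 * \<delta> \<le> e" and \<epsilon>: "0 < \<epsilon>" "2 * \<epsilon> \<le> e" "\<epsilon> \<le> r" and \<eta>: "0 < \<eta>"
  obtains S\<^sub>m S\<^sub>p D\<^sub>m D\<^sub>p T\<^sub>0 where "0 < S\<^sub>m" "0 < S\<^sub>p" "0 < D\<^sub>m" "0 < D\<^sub>p" "0 < T\<^sub>0"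
    "\<And>x T F. \<lbrakk>x \<in> K; T\<^sub>0 < T; \<phi> T x \<in> K; finite F;
       F \<subseteq> chords \<phi> x y\<^sub>0 \<epsilon> (T - S\<^sub>p) (T - S\<^sub>p + 5 * tau_K \<phi> K\<^sub>0); separating \<phi> \<delta> (T - S\<^sub>p) F\<rbrakk> \<Longrightarrow>
       measure m (dyn_ball \<phi> x \<epsilon> T) * real (card F) \<le> D\<^sub>p"
    "\<And>x T E. \<lbrakk>x \<in> K; T\<^sub>0 < T; \<phi> T x \<in> K; finite E;
       chords \<phi> x y\<^sub>0 \<eta> (T + S\<^sub>m) (T + S\<^sub>m + 5 * tau_K \<phi> K\<^sub>0) \<subseteq> (\<Union>z\<in>E. dyn_ball \<phi> z \<delta> (T + S\<^sub>m))\<rbrakk> \<Longrightarrow>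
       E \<noteq> {} \<and> D\<^sub>m \<le> measure m (dyn_ball \<phi> x \<epsilon> T) * real (card E)"
proof -
  interpret m: finite_measure m by (rule m(1))
  define \<tau> where "\<tau> = tau_K \<phi> K\<^sub>0"
  have \<tau>: "1 \<le> \<tau>" using tau_K_approx(1)[OF K\<^sub>0(2)] \<tau>_def by metis
  define P where "P l = PK \<phi> K\<^sub>0 l (l + 5 * \<tau>)" for l
  define M where "M k = m_KL \<phi> K\<^sub>0 (L k)" for k
  have M: "finite_measure (M k)" "sets (M k) = sets borel" for k
    unfolding M_def by (rule finite_measure_m_KL, simp)
  have vague: "vague_limit M m" using L(2) by (simp add: M_def[abs_def])
  define \<mu> where "\<mu> = measure m UNIV"
  have \<mu>: "0 < \<mu>"
  proof -
    have "measure m (interior K) \<le> \<mu>" unfolding \<mu>_def using m(2) by (intro m.finite_measure_mono) auto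
    then show ?thesis using m(3) unfolding \<mu>_def[symmetric] by linarith
  qed
  have L_large: "eventually (\<lambda>k. c \<le> L k) sequentially" for c
    using L(1) by (simp add: filterlim_at_top)
  obtain S\<^sub>1 D\<^sub>1 where up: "0 < S\<^sub>1" "0 < D\<^sub>1"
    "\<And>x T F l. \<lbrakk>S\<^sub>1 < T; ball x \<epsilon> \<subseteq> C; ball (\<phi> T x) \<epsilon> \<subseteq> C; ball y\<^sub>0 \<epsilon> \<subseteq> C; T + S\<^sub>1 \<le> l; finite F;
       F \<subseteq> chords \<phi> x y\<^sub>0 \<epsilon> (T - S\<^sub>1) (T - S\<^sub>1 + 5 * \<tau>); separating \<phi> \<delta> (T - S\<^sub>1) F; finite (P l)\<rbrakk> \<Longrightarrow>
       (\<Sum>\<gamma>\<in>{\<gamma>\<in>P l. primitive \<gamma>}. occ \<gamma> (dyn_ball \<phi> x \<epsilon> T)) * real (card F) \<le> D\<^sub>1 * l * real (card (P l))"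
    by (rule upper_count[OF K\<^sub>0 C(1) \<delta>(1) \<epsilon>(1,2) e, of y\<^sub>0, folded \<tau>_def, folded P_def]) (rule that)
  have \<epsilon>2: "0 < \<epsilon> / 2" using \<epsilon> by simp
  obtain S\<^sub>2 S\<^sub>2' D\<^sub>2 where low: "0 < S\<^sub>2" "0 < S\<^sub>2'" "0 < D\<^sub>2"
    "\<And>x T E l. \<lbrakk>x \<in> K; \<phi> T x \<in> K; 0 < T; T + S\<^sub>2' \<le> l; finite E;
       chords \<phi> x y\<^sub>0 \<eta> (T + S\<^sub>2') (T + S\<^sub>2' + 5 * \<tau>) \<subseteq> (\<Union>z\<in>E. dyn_ball \<phi> z \<delta> (T + S\<^sub>2')); finite (P l)\<rbrakk> \<Longrightarrow>
       (\<Sum>\<gamma>\<in>{\<gamma>\<in>P l. primitive \<gamma>}. occ \<gamma> {q. q \<in> K \<and> \<phi> (T + S\<^sub>2) q \<in> K})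
         \<le> D\<^sub>2 * real (card E) * (\<Sum>\<gamma>\<in>P l. occ \<gamma> (cdyn_ball x (\<epsilon> / 2) T))"
    by (rule lower_count[OF K\<^sub>0 K \<delta>(1) \<epsilon>2 \<eta> \<delta>(2) e, folded \<tau>_def, folded P_def]) (rule that)
  obtain D\<^sub>3 L\<^sub>0 where np: "0 < D\<^sub>3"
    "\<And>l. L\<^sub>0 \<le> l \<Longrightarrow> finite (P l) \<Longrightarrow> real (card {\<gamma>\<in>P l. \<not> primitive \<gamma>}) * l \<le> D\<^sub>3 * real (card (P l))"
    by (rule nonprimitive_count[OF K\<^sub>0 orbits, folded \<tau>_def, folded P_def]) (rule that)
  have meas: "measure (M k) A = (\<Sum>\<gamma>\<in>P (L k). occ \<gamma> A / snd \<gamma>) / real (card (P (L k)))" if "A \<in> sets borel" for A k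
    unfolding M_def by (rule measure_m_KL[OF that]) (simp add: P_def \<tau>_def)
  \<comment> \<open>A positive value of the measures excludes that the set of orbits is empty or infinite.\<close>
  have fraction: "measure (M k) A \<le> (\<Sum>\<gamma>\<in>{\<gamma>\<in>P (L k). primitive \<gamma>}. occ \<gamma> A) / (L k * real (card (P (L k)))) + D\<^sub>3 / L k"
      and fin: "finite (P (L k))" "0 < card (P (L k))"
    if "A \<in> sets borel" "0 < measure (M k) A" "0 < L k" "L\<^sub>0 \<le> L k" for A k
  proof -
    show c: "0 < card (P (L k))"
      using that(2) unfolding meas[OF that(1)] by (cases "card (P (L k)) = 0") auto
    then show f: "finite (P (L k))" by (rule card_ge_0_finite)
    have "(\<Sum>\<gamma>\<in>P (L k). occ \<gamma> A / snd \<gamma>) \<le> (\<Sum>\<gamma>\<in>{\<gamma>\<in>P (L k). primitive \<gamma>}. occ \<gamma> A) / L k + real (card {\<gamma>\<in>P (L k). \<not> primitive \<gamma>})"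
      by (rule sum_occ_fraction_le[OF P_def f that(3)])
    also have "real (card {\<gamma>\<in>P (L k). \<not> primitive \<gamma>}) \<le> D\<^sub>3 * real (card (P (L k))) / L k"
      using np(2)[OF that(4) f] that(3) by (simp add: field_simps)
    finally have "measure (M k) A \<le> ((\<Sum>\<gamma>\<in>{\<gamma>\<in>P (L k). primitive \<gamma>}. occ \<gamma> A) / L k + D\<^sub>3 * real (card (P (L k))) / L k) / real (card (P (L k)))"
      unfolding meas[OF that(1)] by (intro divide_right_mono) auto
    also have "\<dots> = (\<Sum>\<gamma>\<in>{\<gamma>\<in>P (L k). primitive \<gamma>}. occ \<gamma> A) / (L k * real (card (P (L k)))) + D\<^sub>3 / L k"
      using c that(3) by (simp add: add_divide_distrib)
    finally show "measure (M k) A \<le> (\<Sum>\<gamma>\<in>{\<gamma>\<in>P (L k). primitive \<gamma>}. occ \<gamma> A) / (L k * real (card (P (L k)))) + D\<^sub>3 / L k" .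
  qed
  have small: "eventually (\<lambda>k. D\<^sub>3 / L k \<le> c) sequentially" if "0 < c" for c
    using L_large[of "max 1 (D\<^sub>3 / c)"]
    by (rule eventually_mono) (use that np(1) in \<open>auto simp: field_simps\<close>)
  have ball_C: "ball x \<epsilon> \<subseteq> C" if "x \<in> K" for x using C(2)[OF that] \<epsilon>(3) by auto
  have dyn_C: "dyn_ball \<phi> x \<epsilon> T \<subseteq> C" if "x \<in> K" "0 < T" for x T
    using ball_C[OF that(1)] dyn_ball_subset_ball[of T x \<epsilon>] that(2) by auto
  have upper: "measure m (dyn_ball \<phi> x \<epsilon> T) * real (card F) \<le> D\<^sub>1"
    if x: "x \<in> K" "S\<^sub>1 < T" "\<phi> T x \<in> K" and F: "finite F"
      "F \<subseteq> chords \<phi> x y\<^sub>0 \<epsilon> (T - S\<^sub>1) (T - S\<^sub>1 + 5 * \<tau>)" "separating \<phi> \<delta> (T - S\<^sub>1) F" for x T F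
  proof (rule ccontr)
    define U where "U = dyn_ball \<phi> x \<epsilon> T"
    define f where "f = real (card F)"
    assume "\<not> ?thesis"
    then have gt: "D\<^sub>1 < measure m U * f" by (simp add: U_def f_def)
    then have f: "0 < f" using up(2) by (cases "f = 0") (auto simp: f_def)
    have U: "open U" "U \<in> sets borel" by (simp_all add: U_def open_dyn_ball)
    have "D\<^sub>1 / f < measure m U" using gt f by (simp add: field_simps)
    then obtain w where w: "w < measure m U" "D\<^sub>1 / f < w" using dense by blast
    have "0 < w" using w(2) up(2) f by (meson divide_pos_pos less_trans)
    have "eventually (\<lambda>k. w < measure (M k) U) sequentially"
      using vague_limit_open[OF vague M m(1,2) U(1) C(1) _ w(1)] dyn_C[OF x(1)] x(2) up(1) by (simp add: U_def)
    moreover have "eventually (\<lambda>k. D\<^sub>3 / L k \<le> w - D\<^sub>1 / f) sequentially" using small w(2) by simp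
    ultimately have "eventually (\<lambda>k. w < measure (M k) U \<and> D\<^sub>3 / L k \<le> w - D\<^sub>1 / f \<and> 1 \<le> L k \<and> L\<^sub>0 \<le> L k \<and> T + S\<^sub>1 \<le> L k) sequentially"
      using L_large[of 1] L_large[of L\<^sub>0] L_large[of "T + S\<^sub>1"] by eventually_elim simp
    then obtain k where k: "w < measure (M k) U" "D\<^sub>3 / L k \<le> w - D\<^sub>1 / f" "1 \<le> L k" "L\<^sub>0 \<le> L k" "T + S\<^sub>1 \<le> L k"
      by (auto simp: eventually_sequentially)
    have pos: "0 < measure (M k) U" "0 < L k" using k \<open>0 < w\<close> by auto
    note P = fin[OF U(2) pos k(4)]
    have "(\<Sum>\<gamma>\<in>{\<gamma>\<in>P (L k). primitive \<gamma>}. occ \<gamma> U) * f \<le> D\<^sub>1 * L k * real (card (P (L k)))"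
      unfolding U_def f_def
      by (rule up(3)[OF x(2) ball_C[OF x(1)] ball_C[OF x(3)] ball_C[OF K(2)] k(5) F P(1)])
    then have "(\<Sum>\<gamma>\<in>{\<gamma>\<in>P (L k). primitive \<gamma>}. occ \<gamma> U) / (L k * real (card (P (L k)))) \<le> D\<^sub>1 / f"
      using pos P f by (simp add: field_simps)
    then have "measure (M k) U \<le> D\<^sub>1 / f + D\<^sub>3 / L k" using fraction[OF U(2) pos k(4)] by linarith
    then show False using k(1,2) by linarith
  qed
  define D\<^sub>m where "D\<^sub>m = \<mu> / (8 * D\<^sub>2)"
  have lower: "E \<noteq> {} \<and> D\<^sub>m \<le> measure m (dyn_ball \<phi> x \<epsilon> T) * real (card E)"
    if x: "x \<in> K" "0 < T" "\<phi> T x \<in> K" and E: "finite E"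
      "chords \<phi> x y\<^sub>0 \<eta> (T + S\<^sub>2') (T + S\<^sub>2' + 5 * \<tau>) \<subseteq> (\<Union>z\<in>E. dyn_ball \<phi> z \<delta> (T + S\<^sub>2'))" for x T E
  proof -
    define V where "V = interior K"
    define W where "W = V \<inter> \<phi> (T + S\<^sub>2) -` V"
    define A where "A = {q. q \<in> K \<and> \<phi> (T + S\<^sub>2) q \<in> K}"
    define B where "B = cdyn_ball x (\<epsilon> / 2) T"
    have V: "open V" "V \<subseteq> K" by (simp_all add: V_def interior_subset)
    have "open (\<phi> (T + S\<^sub>2) -` V)"
      by (intro open_vimage V continuous_on_flow continuous_on_const continuous_on_id)
    then have W: "open W" "W \<subseteq> K" "W \<subseteq> A" using V by (auto simp: W_def A_def)
    have A: "A \<in> sets borel"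
    proof -
      have "A = K \<inter> \<phi> (T + S\<^sub>2) -` K" by (auto simp: A_def)
      moreover have "closed (K \<inter> \<phi> (T + S\<^sub>2) -` K)"
        using K(1) by (intro closed_Int closed_vimage compact_imp_closed continuous_on_flow continuous_on_const continuous_on_id)
      ultimately show ?thesis by simp
    qed
    have B: "B \<in> sets borel" using closed_cdyn_ball by (simp add: B_def)
    \<comment> \<open>By invariance, the points that are in \<open>V\<close> now and after the time \<open>T + S\<^sub>2\<close> have measure more
      than \<open>\<mu> / 2\<close>.\<close>
    have "\<mu> / 2 < measure m W"
    proof -
      have inv: "measure m V \<le> measure m (\<phi> (T + S\<^sub>2) -` V)"
        by (rule vague_limit_invariant[OF L(2) m(1,2) V(1) K(1) V(2)])
      have s: "V \<in> sets m" "\<phi> (T + S\<^sub>2) -` V \<in> sets m"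
        using V(1) \<open>open (\<phi> (T + S\<^sub>2) -` V)\<close> m(2) by auto
      have "measure m (V \<union> \<phi> (T + S\<^sub>2) -` V) + measure m W = measure m V + measure m (\<phi> (T + S\<^sub>2) -` V)"
        unfolding W_def using s by (simp add: measure_Un3 m.fmeasurable_eq_sets)
      moreover have "measure m (V \<union> \<phi> (T + S\<^sub>2) -` V) \<le> \<mu>"
        unfolding \<mu>_def using m(2) by (intro m.finite_measure_mono) auto
      ultimately show ?thesis using inv m(3) unfolding V_def[symmetric] \<mu>_def[symmetric] by linarith
    qed
    then have ev: "eventually (\<lambda>k. \<mu> / 2 < measure (M k) W) sequentially"
      by (rule vague_limit_open[OF vague M m(1,2) W(1) K(1) W(2)])
    have key: "\<mu> / 8 \<le> D\<^sub>2 * real (card E) * measure (M k) B"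
      if k: "\<mu> / 2 < measure (M k) W" "D\<^sub>3 / L k \<le> \<mu> / 4" "5 * \<tau> \<le> L k" "L\<^sub>0 \<le> L k" "T + S\<^sub>2' \<le> L k" for k
    proof -
      have Wb: "W \<in> sets borel" using W(1) by simp
      have pos: "0 < measure (M k) W" "0 < L k" using k \<mu> \<tau> by auto
      note Pk = fin[OF Wb pos k(4)]
      define n where "n = L k * real (card (P (L k)))"
      have n: "0 < n" using pos Pk by (simp add: n_def)
      have "\<mu> / 4 \<le> (\<Sum>\<gamma>\<in>{\<gamma>\<in>P (L k). primitive \<gamma>}. occ \<gamma> W) / n"
        using fraction[OF Wb pos k(4)] k(1,2) unfolding n_def by linarith
      also have "\<dots> \<le> (\<Sum>\<gamma>\<in>{\<gamma>\<in>P (L k). primitive \<gamma>}. occ \<gamma> A) / n"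
        using n by (intro divide_right_mono sum_mono occ_mono Wb A W(3)) auto
      also have "\<dots> \<le> (D\<^sub>2 * real (card E) * (\<Sum>\<gamma>\<in>P (L k). occ \<gamma> B)) / n"
        unfolding A_def B_def using n by (intro divide_right_mono low(4)[OF x(1,3,2) k(5) E Pk(1)]) auto
      also have "\<dots> \<le> (D\<^sub>2 * real (card E) * (2 * n * measure (M k) B)) / n"
      proof -
        have "(\<Sum>\<gamma>\<in>P (L k). occ \<gamma> B) \<le> (L k + 5 * \<tau>) * (\<Sum>\<gamma>\<in>P (L k). occ \<gamma> B / snd \<gamma>)"
          by (rule sum_occ_le_fraction[OF P_def pos(2)])
        also have "(\<Sum>\<gamma>\<in>P (L k). occ \<gamma> B / snd \<gamma>) = real (card (P (L k))) * measure (M k) B"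
          using Pk(2) unfolding meas[OF B] by simp
        also have "(L k + 5 * \<tau>) * (real (card (P (L k))) * measure (M k) B) \<le> (2 * L k) * (real (card (P (L k))) * measure (M k) B)"
          using k(3) by (intro mult_right_mono) auto
        finally have "(\<Sum>\<gamma>\<in>P (L k). occ \<gamma> B) \<le> 2 * n * measure (M k) B" by (simp add: n_def mult_ac)
        then show ?thesis using low(3) n by (intro divide_right_mono mult_left_mono) auto
      qed
      also have "\<dots> = 2 * (D\<^sub>2 * real (card E) * measure (M k) B)" using n by simp
      finally show ?thesis by simp
    qed
    have ev': "eventually (\<lambda>k. \<mu> / 8 \<le> D\<^sub>2 * real (card E) * measure (M k) B) sequentially"
      using ev small[OF divide_pos_pos[OF \<mu> zero_less_numeral]] L_large[of "5 * \<tau>"] L_large[of L\<^sub>0] L_large[of "T + S\<^sub>2'"]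
      by eventually_elim (rule key)
    obtain k where "\<mu> / 8 \<le> D\<^sub>2 * real (card E) * measure (M k) B"
      using ev' by (auto simp: eventually_sequentially)
    then have cE: "0 < real (card E)" using \<mu> by (cases "card E = 0") auto
    have "eventually (\<lambda>k. D\<^sub>m / real (card E) \<le> measure (M k) B) sequentially"
      using ev' by (rule eventually_mono) (use cE low(3) in \<open>simp add: D\<^sub>m_def field_simps\<close>)
    moreover have sub: "B \<subseteq> dyn_ball \<phi> x \<epsilon> T"
      unfolding B_def using \<epsilon>(1) by (intro cdyn_ball_subset_dyn_ball) simp
    moreover have "compact B"
    proof -
      have "closed B" by (simp add: B_def closed_cdyn_ball)
      moreover have "B = C \<inter> B" using sub dyn_C[OF x(1,2)] by auto
      ultimately show ?thesis using C(1) compact_Int_closed by metis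
    qed
    ultimately have "D\<^sub>m / real (card E) \<le> measure m (dyn_ball \<phi> x \<epsilon> T)"
      using vague_limit_compact[OF vague M m(1,2) _ _ open_dyn_ball C(1) dyn_C[OF x(1,2)]] by blast
    then have "D\<^sub>m \<le> measure m (dyn_ball \<phi> x \<epsilon> T) * real (card E)" using cE by (simp add: field_simps)
    then show ?thesis using cE by auto
  qed
  have D\<^sub>m: "0 < D\<^sub>m" using \<mu> low(3) by (simp add: D\<^sub>m_def)
  have lower': "E \<noteq> {} \<and> D\<^sub>m \<le> measure m (dyn_ball \<phi> x \<epsilon> T) * real (card E)"
    if "x \<in> K" "S\<^sub>1 < T" "\<phi> T x \<in> K" "finite E"
      "chords \<phi> x y\<^sub>0 \<eta> (T + S\<^sub>2') (T + S\<^sub>2' + 5 * \<tau>) \<subseteq> (\<Union>z\<in>E. dyn_ball \<phi> z \<delta> (T + S\<^sub>2'))" for x T E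
    using lower[OF that(1) _ that(3-5)] that(2) up(1) by simp
  show ?thesis
    by (rule that[OF low(2) up(1) D\<^sub>m up(2,1) upper[unfolded \<tau>_def] lower'[unfolded \<tau>_def]])
qed

text \<open>If there is only one periodic orbit, that of \<open>a\<close>, then it is the whole manifold, because
  periodic points are dense. The numbers of separated chords are bounded, and the measure of a
  dynamical ball is bounded below by invariance.\<close>

lemma bounds_one_orbit:
  assumes K\<^sub>0: "interior K\<^sub>0 \<noteq> {}"
    and m: "finite_measure m" "sets m = sets borel" "0 < measure m UNIV"
    and L: "vague_limit (\<lambda>k. m_KL \<phi> K\<^sub>0 (L k)) m"
    and a: "\<phi> \<alpha> a = a" "0 < \<alpha>" "\<And>b \<beta>. \<phi> \<beta> b = b \<Longrightarrow> 0 < \<beta> \<Longrightarrow> orbit a = orbit b"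
    and \<delta>: "0 < \<delta>" and \<epsilon>: "0 < \<epsilon>" and \<eta>: "0 < \<eta>"
  obtains D\<^sub>m D\<^sub>p where "0 < D\<^sub>m" "0 < D\<^sub>p"
    "\<And>x T R F. separating \<phi> \<delta> R F \<Longrightarrow> measure m (dyn_ball \<phi> x \<epsilon> T) * real (card F) \<le> D\<^sub>p"
    "\<And>x T R E. finite E \<Longrightarrow>
       chords \<phi> x y\<^sub>0 \<eta> R (R + 5 * tau_K \<phi> K\<^sub>0) \<subseteq> (\<Union>z\<in>E. dyn_ball \<phi> z \<delta> R) \<Longrightarrow>
       E \<noteq> {} \<and> D\<^sub>m \<le> measure m (dyn_ball \<phi> x \<epsilon> T) * real (card E)"
proof -
  interpret m: finite_measure m by (rule m(1))
  obtain b where b: "0 < b" "\<And>s t x. dist (\<phi> s x) (\<phi> t x) \<le> b * \<bar>s - t\<bar>"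
    using speed_bound by metis
  have cpt: "compact (orbit a)" by (rule compact_periodic_orbit[OF a(1,2)])
  have all: "x \<in> orbit a" for x
  proof -
    have "x \<in> closure (orbit a)"
      unfolding closure_approachable
    proof (intro allI impI)
      fix e :: real assume "0 < e"
      then obtain z T where z: "dist x z < e" "1 \<le> T" "\<phi> T z = z" using periodic_point_near by metis
      then have "z \<in> orbit a" using a(3)[of T z] orbit_self[of z] by simp
      then show "\<exists>y\<in>orbit a. dist y x < e" using z(1) by (auto simp: dist_commute)
    qed
    then show ?thesis using compact_imp_closed[OF cpt] by simp
  qed
  have cU: "compact (UNIV :: 'a set)" using cpt all by (metis UNIV_eq_I)
  have per: "\<phi> \<alpha> x = x" for x
    using all[of x] a(1) flow_period_shift by auto
  have pos: "\<exists>v. 0 \<le> v \<and> v \<le> \<alpha> \<and> y = \<phi> v x" for x y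
  proof -
    have "y \<in> orbit x" using all[of x] all[of y] orbit_eqI by metis
    then obtain t where "y = \<phi> t x" by auto
    moreover obtain k r where "0 \<le> r" "r < \<alpha>" "\<phi> t x = \<phi> r x"
      using flow_period_reduce[OF per a(2)] by metis
    ultimately show ?thesis by (intro exI[of _ r]) simp
  qed
  define \<mu> where "\<mu> = measure m UNIV"
  have \<mu>: "0 < \<mu>" using m(3) by (simp add: \<mu>_def)
  define n where "n = Suc (bin (\<delta> / b) \<alpha>)"
  have card: "card F \<le> n" if sep: "separating \<phi> \<delta> R F" for R F
  proof -
    define v where "v y = (SOME v. 0 \<le> v \<and> v \<le> \<alpha> \<and> y = \<phi> v a)" for y
    have v: "0 \<le> v y \<and> v y \<le> \<alpha> \<and> y = \<phi> (v y) a" for y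
      unfolding v_def by (rule someI_ex[OF pos])
    have \<kappa>: "0 < \<delta> / b" using \<delta> b(1) by simp
    have "inj_on (\<lambda>y. bin (\<delta> / b) (v y)) F"
    proof (rule inj_onI, rule ccontr)
      fix y z assume yz: "y \<in> F" "z \<in> F" "bin (\<delta> / b) (v y) = bin (\<delta> / b) (v z)" "y \<noteq> z"
      then obtain t where t: "\<delta> \<le> dist (\<phi> t y) (\<phi> t z)" using sep by (auto simp: separating_def)
      have "\<bar>v y - v z\<bar> < \<delta> / b" using bin_eqD[OF yz(3) \<kappa>] v by blast
      then have "b * \<bar>v y - v z\<bar> < \<delta>" using b(1) by (simp add: field_simps)
      moreover have "dist (\<phi> t y) (\<phi> t z) \<le> b * \<bar>(t + v y) - (t + v z)\<bar>"
        using b(2)[of "t + v y" a "t + v z"] v[of y] v[of z] by (metis flow_add)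
      ultimately show False using t by simp
    qed
    moreover have "(\<lambda>y. bin (\<delta> / b) (v y)) ` F \<subseteq> {..bin (\<delta> / b) \<alpha>}" using v bin_le[OF \<kappa>] by auto
    ultimately have "card F \<le> card {..bin (\<delta> / b) \<alpha>}" by (intro card_inj_on_le) auto
    then show ?thesis by (simp add: n_def)
  qed
  define D\<^sub>p where "D\<^sub>p = \<mu> * real n"
  have "0 < D\<^sub>p" using \<mu> by (simp add: D\<^sub>p_def n_def)
  have upper: "measure m (dyn_ball \<phi> x \<epsilon> T) * real (card F) \<le> D\<^sub>p" if "separating \<phi> \<delta> R F" for x T R F
    unfolding D\<^sub>p_def \<mu>_def using card[OF that] m(2)
    by (intro mult_mono m.finite_measure_mono) auto
  define \<kappa> where "\<kappa> = \<epsilon> / b"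
  have \<kappa>: "0 < \<kappa>" using \<epsilon> b by (simp add: \<kappa>_def)
  define n' where "n' = bin \<kappa> \<alpha>"
  define D\<^sub>m where "D\<^sub>m = \<mu> / real (Suc n')"
  have "0 < D\<^sub>m" using \<mu> by (simp add: D\<^sub>m_def)
  have ball: "D\<^sub>m \<le> measure m (dyn_ball \<phi> x \<epsilon> T)" for x T
  proof -
    define U where "U = dyn_ball \<phi> x \<epsilon> T"
    define V where "V i = \<phi> (- (real i * \<kappa>)) -` U" for i
    have U: "open U" by (simp add: U_def open_dyn_ball)
    have V: "open (V i)" for i
      unfolding V_def by (intro open_vimage U continuous_on_flow continuous_on_const continuous_on_id)
    have V_le: "measure m (V i) \<le> measure m U" for i
    proof -
      have "measure m (V i) \<le> measure m (\<phi> (real i * \<kappa>) -` V i)"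
        by (rule vague_limit_invariant[OF L m(1,2) V cU]) simp
      also have "\<phi> (real i * \<kappa>) -` V i = U" by (auto simp: V_def)
      finally show ?thesis .
    qed
    have "UNIV = (\<Union>i\<in>{..n'}. V i)"
    proof (rule UNIV_eq_I[symmetric, THEN sym])
      fix y
      obtain v where v: "0 \<le> v" "v \<le> \<alpha>" "y = \<phi> v x" using pos by metis
      define i where "i = bin \<kappa> v"
      have "0 \<le> v / \<kappa>" using v(1) \<kappa> by simp
      then have "real i \<le> v / \<kappa>" "v / \<kappa> < real i + 1" unfolding i_def bin_def by linarith+
      then have i: "0 \<le> v - real i * \<kappa>" "v - real i * \<kappa> < \<kappa>" using \<kappa> by (auto simp: field_simps)
      have "dist (\<phi> t x) (\<phi> t (\<phi> (v - real i * \<kappa>) x)) < \<epsilon>" for t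
      proof -
        have "dist (\<phi> t x) (\<phi> t (\<phi> (v - real i * \<kappa>) x)) \<le> b * \<bar>t - (t + (v - real i * \<kappa>))\<bar>"
          unfolding flow_flow by (rule b(2))
        also have "\<dots> = b * (v - real i * \<kappa>)" using i(1) by simp
        also have "\<dots> < b * \<kappa>" using i(2) b(1) by simp
        also have "\<dots> = \<epsilon>" using b(1) by (simp add: \<kappa>_def)
        finally show ?thesis .
      qed
      moreover have "\<phi> (- (real i * \<kappa>)) y = \<phi> (v - real i * \<kappa>) x" by (simp add: v(3) flow_flow)
      ultimately have "y \<in> V i" by (simp add: V_def U_def dyn_ball_def)
      moreover have "i \<le> n'" unfolding i_def n'_def by (rule bin_le[OF \<kappa> v(2)])
      ultimately show "y \<in> (\<Union>i\<in>{..n'}. V i)" by auto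
    qed
    then have "\<mu> = measure m (\<Union>i\<in>{..n'}. V i)" by (simp add: \<mu>_def)
    also have "\<dots> \<le> (\<Sum>i\<in>{..n'}. measure m (V i))"
      using V m(2) by (intro m.finite_measure_subadditive_finite) auto
    also have "\<dots> \<le> (\<Sum>i\<in>{..n'}. measure m U)" by (intro sum_mono V_le)
    also have "\<dots> = real (Suc n') * measure m U" by simp
    finally show ?thesis by (simp add: D\<^sub>m_def U_def field_simps)
  qed
  have lower: "E \<noteq> {} \<and> D\<^sub>m \<le> measure m (dyn_ball \<phi> x \<epsilon> T) * real (card E)"
    if E: "finite E" "chords \<phi> x y\<^sub>0 \<eta> R (R + 5 * tau_K \<phi> K\<^sub>0) \<subseteq> (\<Union>z\<in>E. dyn_ball \<phi> z \<delta> R)" for x T R E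
  proof -
    obtain z \<tau>' where z: "\<phi> \<tau>' z = z" "tau_K \<phi> K\<^sub>0 \<le> \<tau>'" "\<tau>' < 2 * tau_K \<phi> K\<^sub>0"
      using tau_K_approx(2)[OF K\<^sub>0] by metis
    have \<tau>: "1 \<le> tau_K \<phi> K\<^sub>0" by (rule tau_K_approx(1)[OF K\<^sub>0])
    obtain v where "x = \<phi> v z" using pos by metis
    then have per': "\<phi> \<tau>' x = x" using flow_period_shift[OF z(1)] by simp
    obtain s where s: "\<phi> (- R) y\<^sub>0 = \<phi> s x" using pos by metis
    have "0 < \<tau>'" using z \<tau> by linarith
    then obtain k r where r: "0 \<le> r" "r < \<tau>'" "\<phi> s x = \<phi> r x"
      using flow_period_reduce[OF per'] by metis
    have "\<phi> (R + r) x = y\<^sub>0" using s r(3) flow_minus(2)[of R y\<^sub>0] by (simp add: flow_add)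
    moreover have "R + r \<in> {R..R + 5 * tau_K \<phi> K\<^sub>0}" using r z \<tau> by simp
    ultimately have "y\<^sub>0 \<in> (\<lambda>t. \<phi> t x) ` {R..R + 5 * tau_K \<phi> K\<^sub>0}" by (metis image_eqI)
    then have "x \<in> chords \<phi> x y\<^sub>0 \<eta> R (R + 5 * tau_K \<phi> K\<^sub>0)"
      unfolding chords_def using \<eta> by auto
    then have "E \<noteq> {}" using E(2) by auto
    then have "1 \<le> real (card E)" using E(1) by (simp add: Suc_le_eq card_gt_0_iff)
    then have "D\<^sub>m * 1 \<le> measure m (dyn_ball \<phi> x \<epsilon> T) * real (card E)"
      using ball \<open>0 < D\<^sub>m\<close> by (intro mult_mono) auto
    then show ?thesis using \<open>E \<noteq> {}\<close> by simp
  qed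
  show ?thesis by (rule that[OF \<open>0 < D\<^sub>m\<close> \<open>0 < D\<^sub>p\<close> upper lower])
qed

end

theorem theorem7p6:
  fixes \<A> :: "('a::metric_space, 'e::euclidean_space) chart set"
    and g :: "('a, 'e) chart \<Rightarrow> 'a \<Rightarrow> 'e \<Rightarrow> 'e \<Rightarrow> real"
    and \<phi> :: "real \<Rightarrow> 'a \<Rightarrow> 'a"
    and K\<^sub>0 K :: "'a set"
    and \<epsilon>\<^sub>0 :: real
    and m_inf :: "'a measure"
    and Lk :: "nat \<Rightarrow> real"
    and y\<^sub>0 :: 'a
  assumes "H_flow \<A> g \<phi>"
    and "h_Gur_infinity \<phi> < h_Gur \<phi>"
    and "compact K\<^sub>0" and "interior K\<^sub>0 \<noteq> {}"
    and "\<epsilon>\<^sub>0 > 0"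
    and "Limsup at_top (\<lambda>L::real. log_card (PK_alpha \<phi> K\<^sub>0 \<epsilon>\<^sub>0 L (L + 5 * tau_K \<phi> K\<^sub>0)) / ereal L)
           < Lim at_top (\<lambda>L::real. log_card (PK \<phi> K\<^sub>0 L (L + 5 * tau_K \<phi> K\<^sub>0)) / ereal L)"
    and "vague_accumulation_point (m_KL \<phi> K\<^sub>0) m_inf"
    and "compact K" and "K\<^sub>0 \<subseteq> interior K"
    and "emeasure m_inf (interior K) > ennreal (3 / 4) * emeasure m_inf UNIV"
    and "incseq Lk" and "filterlim Lk at_top sequentially"
    and "vague_limit (\<lambda>k. m_KL \<phi> K\<^sub>0 (Lk k)) m_inf"
    and "y\<^sub>0 \<in> K\<^sub>0"
  shows "\<exists>\<delta>end>0. \<forall>\<delta>. 0 < \<delta> \<and> \<delta> < \<delta>end \<longrightarrow>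
     (\<exists>\<epsilon>end>0. \<forall>\<epsilon>. 0 < \<epsilon> \<and> \<epsilon> < \<epsilon>end \<longrightarrow>
       (\<exists>\<eta>end>0. \<forall>\<eta>. 0 < \<eta> \<and> \<eta> < \<eta>end \<longrightarrow>
         (\<exists>Sm Sp Dm Dp Tend :: real.
            0 < Sm \<and> 0 < Sp \<and> 0 < Dm \<and> 0 < Dp \<and> 0 < Tend \<and>
            (\<forall>x\<in>K. \<forall>T. T > Tend \<and> \<phi> T x \<in> K \<longrightarrow>
               ennreal Dm / N_chords \<phi> x y\<^sub>0 \<eta> (T + Sm) (T + Sm + 5 * tau_K \<phi> K\<^sub>0) \<delta>
                 \<le> emeasure m_inf (dyn_ball \<phi> x \<epsilon> T) \<and>
               emeasure m_inf (dyn_ball \<phi> x \<epsilon> T)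
                 \<le> ennreal Dp / N_chords \<phi> x y\<^sub>0 \<epsilon> (T - Sp) (T - Sp + 5 * tau_K \<phi> K\<^sub>0) \<delta>))))"
proof -
  interpret H_flow \<A> g \<phi> by (rule assms(1))
  define \<tau> where "\<tau> = tau_K \<phi> K\<^sub>0"
  have y\<^sub>0: "y\<^sub>0 \<in> K" using assms(9,14) interior_subset by blast
  have sets: "sets m_inf = sets borel"
    using assms(7) by (simp add: vague_accumulation_point_def radon_measure_def)
  have space: "space m_inf = UNIV" using sets_eq_imp_space_eq[OF sets] by simp
  have "emeasure m_inf UNIV \<noteq> \<infinity>"
  proof
    assume "emeasure m_inf UNIV = \<infinity>"
    then have "ennreal (3 / 4) * emeasure m_inf UNIV = top" by (simp add: ennreal_mult_top)
    then show False using assms(10) by simp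
  qed
  then have fin: "finite_measure m_inf" by (intro finite_measureI) (simp add: space)
  interpret m: finite_measure m_inf by (rule fin)
  have large: "measure m_inf UNIV * (3/4) < measure m_inf (interior K)"
  proof -
    have "ennreal (3 / 4 * measure m_inf UNIV) = ennreal (3 / 4) * ennreal (measure m_inf UNIV)"
      by (rule ennreal_mult) auto
    then have "ennreal (3 / 4 * measure m_inf UNIV) < ennreal (measure m_inf (interior K))"
      using assms(10) by (simp only: m.emeasure_eq_measure)
    then show ?thesis by (simp add: ennreal_less_iff mult.commute)
  qed
  have "measure m_inf (interior K) \<le> measure m_inf UNIV"
    using sets by (intro m.finite_measure_mono) auto
  then have \<mu>: "0 < measure m_inf UNIV" using large by linarith
  obtain r C where C: "0 < r" "compact C" "\<And>x. x \<in> K \<Longrightarrow> ball x r \<subseteq> C" using compact_nbhd[OF assms(8)] by metis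
  obtain e where e: "0 < e" "expansive_const e" using expansive_const_exists by metis
  obtain a \<alpha> where a: "\<phi> \<alpha> a = a" "0 < \<alpha>"
    using periodic_point_near[OF zero_less_one, of y\<^sub>0] by (metis less_le_trans zero_less_one)
  \<comment> \<open>The thresholds do not depend on each other: \<open>\<delta>\<close> and \<open>\<epsilon>\<close> must be small compared with the expansivity
      constant, \<open>\<epsilon>\<close> also with the size of the compact neighbourhood of \<open>K\<close>, and \<open>\<eta>\<close> is arbitrary.\<close>
  have main: "\<exists>Sm Sp Dm Dp Tend :: real.
            0 < Sm \<and> 0 < Sp \<and> 0 < Dm \<and> 0 < Dp \<and> 0 < Tend \<and>
            (\<forall>x\<in>K. \<forall>T. T > Tend \<and> \<phi> T x \<in> K \<longrightarrow>
               ennreal Dm / N_chords \<phi> x y\<^sub>0 \<eta> (T + Sm) (T + Sm + 5 * \<tau>) \<delta>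
                 \<le> emeasure m_inf (dyn_ball \<phi> x \<epsilon> T) \<and>
               emeasure m_inf (dyn_ball \<phi> x \<epsilon> T)
                 \<le> ennreal Dp / N_chords \<phi> x y\<^sub>0 \<epsilon> (T - Sp) (T - Sp + 5 * \<tau>) \<delta>)"
    if \<delta>: "0 < \<delta>" "4 * \<delta> \<le> e" and \<epsilon>: "0 < \<epsilon>" "2 * \<epsilon> \<le> e" "\<epsilon> \<le> r" and \<eta>: "0 < \<eta>" for \<delta> \<epsilon> \<eta>
  proof -
    define bounds where "bounds Sm Sp Dm Dp Tend \<longleftrightarrow>
        0 < Sm \<and> 0 < Sp \<and> 0 < Dm \<and> 0 < Dp \<and> 0 < Tend \<and>
        (\<forall>x T. x \<in> K \<and> Tend < T \<and> \<phi> T x \<in> K \<longrightarrow>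
          (\<forall>F. finite F \<and> F \<subseteq> chords \<phi> x y\<^sub>0 \<epsilon> (T - Sp) (T - Sp + 5 * \<tau>) \<and> separating \<phi> \<delta> (T - Sp) F \<longrightarrow>
             measure m_inf (dyn_ball \<phi> x \<epsilon> T) * real (card F) \<le> Dp) \<and>
          (\<forall>E. finite E \<and> chords \<phi> x y\<^sub>0 \<eta> (T + Sm) (T + Sm + 5 * \<tau>) \<subseteq> (\<Union>z\<in>E. dyn_ball \<phi> z \<delta> (T + Sm)) \<longrightarrow>
             E \<noteq> {} \<and> Dm \<le> measure m_inf (dyn_ball \<phi> x \<epsilon> T) * real (card E)))" for Sm Sp Dm Dp Tend :: real
    have "\<exists>Sm Sp Dm Dp Tend. bounds Sm Sp Dm Dp Tend"
    proof (cases "\<exists>b \<beta>. \<phi> \<beta> b = b \<and> 0 < \<beta> \<and> orbit a \<noteq> orbit b")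
      case True
      then obtain b \<beta> where b: "\<phi> \<beta> b = b" "0 < \<beta>" "orbit a \<noteq> orbit b" by blast
      show ?thesis
      proof (rule bounds_two_orbits[OF assms(3,4,8) y\<^sub>0 C(2,3) fin sets large assms(12,13) a b e \<delta> \<epsilon> \<eta>, folded \<tau>_def])
        fix Sm Sp Dm Dp Tend :: real
        assume "0 < Sm" "0 < Sp" "0 < Dm" "0 < Dp" "0 < Tend"
          and "\<And>x T F. \<lbrakk>x \<in> K; Tend < T; \<phi> T x \<in> K; finite F; F \<subseteq> chords \<phi> x y\<^sub>0 \<epsilon> (T - Sp) (T - Sp + 5 * \<tau>);
              separating \<phi> \<delta> (T - Sp) F\<rbrakk> \<Longrightarrow> measure m_inf (dyn_ball \<phi> x \<epsilon> T) * real (card F) \<le> Dp"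
          and "\<And>x T E. \<lbrakk>x \<in> K; Tend < T; \<phi> T x \<in> K; finite E;
              chords \<phi> x y\<^sub>0 \<eta> (T + Sm) (T + Sm + 5 * \<tau>) \<subseteq> (\<Union>z\<in>E. dyn_ball \<phi> z \<delta> (T + Sm))\<rbrakk> \<Longrightarrow>
              E \<noteq> {} \<and> Dm \<le> measure m_inf (dyn_ball \<phi> x \<epsilon> T) * real (card E)"
        then have "bounds Sm Sp Dm Dp Tend" unfolding bounds_def by blast
        then show ?thesis by blast
      qed
    next
      case False
      then have one: "\<And>b \<beta>. \<phi> \<beta> b = b \<Longrightarrow> 0 < \<beta> \<Longrightarrow> orbit a = orbit b" by blast
      show ?thesis
      proof (rule bounds_one_orbit[OF assms(4) fin sets \<mu> assms(13) a one \<delta>(1) \<epsilon>(1) \<eta>, folded \<tau>_def])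
        fix Dm Dp :: real
        assume pos: "0 < Dm" "0 < Dp"
          and F: "\<And>x T R F. separating \<phi> \<delta> R F \<Longrightarrow> measure m_inf (dyn_ball \<phi> x \<epsilon> T) * real (card F) \<le> Dp"
          and E: "\<And>x T R E. finite E \<Longrightarrow> chords \<phi> x y\<^sub>0 \<eta> R (R + 5 * \<tau>) \<subseteq> (\<Union>z\<in>E. dyn_ball \<phi> z \<delta> R) \<Longrightarrow>
              E \<noteq> {} \<and> Dm \<le> measure m_inf (dyn_ball \<phi> x \<epsilon> T) * real (card E)"
        have "bounds 1 1 Dm Dp 1"
          unfolding bounds_def
          by (intro conjI allI impI zero_less_one pos; elim conjE;
              (erule F | erule (1) E[THEN conjunct1] | erule (1) E[THEN conjunct2]))
        then show ?thesis by blast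
      qed auto
    qed
    then obtain Sm Sp Dm Dp Tend where B: "bounds Sm Sp Dm Dp Tend" by blast
    then have B': "0 < Sm" "0 < Sp" "0 < Dm" "0 < Dp" "0 < Tend" by (simp_all add: bounds_def)
    have est: "ennreal Dm / N_chords \<phi> x y\<^sub>0 \<eta> (T + Sm) (T + Sm + 5 * \<tau>) \<delta> \<le> emeasure m_inf (dyn_ball \<phi> x \<epsilon> T)"
      "emeasure m_inf (dyn_ball \<phi> x \<epsilon> T) \<le> ennreal Dp / N_chords \<phi> x y\<^sub>0 \<epsilon> (T - Sp) (T - Sp + 5 * \<tau>) \<delta>"
      if "x \<in> K" "Tend < T" "\<phi> T x \<in> K" for x T
    proof -
      have F: "measure m_inf (dyn_ball \<phi> x \<epsilon> T) * real (card F) \<le> Dp"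
        if "finite F" "F \<subseteq> chords \<phi> x y\<^sub>0 \<epsilon> (T - Sp) (T - Sp + 5 * \<tau>)" "separating \<phi> \<delta> (T - Sp) F" for F
        using B \<open>x \<in> K\<close> \<open>Tend < T\<close> \<open>\<phi> T x \<in> K\<close> that unfolding bounds_def by simp
      have E: "E \<noteq> {} \<and> Dm \<le> measure m_inf (dyn_ball \<phi> x \<epsilon> T) * real (card E)"
        if "finite E" "chords \<phi> x y\<^sub>0 \<eta> (T + Sm) (T + Sm + 5 * \<tau>) \<subseteq> (\<Union>z\<in>E. dyn_ball \<phi> z \<delta> (T + Sm))" for E
        using B \<open>x \<in> K\<close> \<open>Tend < T\<close> \<open>\<phi> T x \<in> K\<close> that unfolding bounds_def by simp
      show "ennreal Dm / N_chords \<phi> x y\<^sub>0 \<eta> (T + Sm) (T + Sm + 5 * \<tau>) \<delta> \<le> emeasure m_inf (dyn_ball \<phi> x \<epsilon> T)"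
        using B'(3) by (intro divide_N_chords_le_emeasure[OF fin \<delta>(1) _ E]) auto
      show "emeasure m_inf (dyn_ball \<phi> x \<epsilon> T) \<le> ennreal Dp / N_chords \<phi> x y\<^sub>0 \<epsilon> (T - Sp) (T - Sp + 5 * \<tau>) \<delta>"
        by (rule emeasure_le_divide_N_chords[OF fin B'(4) F])
    qed
    show ?thesis
      by (rule exI[of _ Sm], rule exI[of _ Sp], rule exI[of _ Dm], rule exI[of _ Dp], rule exI[of _ Tend])
        (use B' est in simp)
  qed
  show ?thesis
  proof (rule exI[of _ "e / 4"], intro conjI allI impI, goal_cases)
    case 1
    show ?case using e by simp
  next
    case (2 \<delta>)
    then have \<delta>: "0 < \<delta>" "4 * \<delta> \<le> e" by auto
    show ?case
    proof (rule exI[of _ "min (e / 2) r"], intro conjI allI impI, goal_cases)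
      case 1
      show ?case using e C by simp
    next
      case (2 \<epsilon>)
      then have \<epsilon>: "0 < \<epsilon>" "2 * \<epsilon> \<le> e" "\<epsilon> \<le> r" by auto
      show ?case
      proof (rule exI[of _ 1], intro conjI allI impI, goal_cases)
        case 1
        show ?case by simp
      next
        case (2 \<eta>)
        then have "0 < \<eta>" by simp
        from main[OF \<delta> \<epsilon> this] show ?case unfolding \<tau>_def .
      qed
    qed
  qed
qed

end
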